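(* Let $0<p<\infty$ and $\alpha>-1$, and let $\mu$ be a positive Borel measure on $[0,1)$ such that: $\mu$ is a $\frac{2}{p}$-Carleson measure if $0<p\le 1$; $\mu$ is a $\frac{2-(p-1)^{2}}{p}$-Carleson measure if $1\le p\le 2$; and $\mu$ is a $\frac{1}{p}$-Carleson measure if $2<p<\infty$. Then the following statements are equivalent: (a) $\mathcal{H}_{\mu}^{\alpha}:A^{p}\to\mathcal{B}$ is compact; (b) $\widetilde{\mathcal{I}}_{\mu_{\alpha+1}}:A^{p}\to\mathcal{B}$ is compact; (c) $\mu$ is a vanishing $\left(\frac{2}{p}+\alpha+1\right)$-Carleson measure.
   Context: $\mathbb{D}$ is the open unit disk in $\mathbb{C}$, $H(\mathbb{D})$ is the space of analytic functions on $\mathbb{D}$, and $dA=\frac{dx\,dy}{\pi}$. For $0<p<\infty$, the Bergman space $A^{p}$ consists of all $f\in H(\mathbb{D})$ with $\|f\|_{A^{p}}=\left(\int_{\mathbb{D}}|f(z)|^{p}dA(z)\right)^{1/p}<\infty$. The Bloch space $\mathcal{B}$ consists of all $f\in H(\mathbb{D})$ with $\|f\|_{\mathcal{B}}=|f(0)|+\sup_{z\in\mathbb{D}}(1-|z|^{2})|f'(z)|<\infty$. For $s>0$, a positive Borel measure $\mu$ on $[0,1)$ is an $s$-Carleson measure if there is $M>0$ with $\mu([t,1))\le M(1-t)^{s}$ for all $0\le t<1$; it is a vanishing $s$-Carleson measure if moreover $\lim_{t\to 1^{-}}\frac{\mu([t,1))}{(1-t)^{s}}=0$. Put $\mu_{n}=\int_{[0,1)}t^{n}d\mu(t)$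 and $\mu_{n,k}=\mu_{n+k}$ for $n,k\ge 0$. For $\alpha>-1$ and $f(z)=\sum_{k=0}^{\infty}a_{k}z^{k}\in H(\mathbb{D})$, define $$\mathcal{H}_{\mu}^{\alpha}(f)(z)=\sum_{n=0}^{\infty}\frac{\Gamma(n+1+\alpha)}{\Gamma(n+1)\Gamma(\alpha+1)}\left(\sum_{k=0}^{\infty}\mu_{n,k}a_{k}\right)z^{n},\quad z\in\mathbb{D},$$ whenever the inner series converge and the power series converges in $\mathbb{D}$, and define the sublinear operator $$\widetilde{\mathcal{I}}_{\mu_{\alpha+1}}(f)(z)=\int_{[0,1)}\frac{|f(t)|}{(1-tz)^{\alpha+1}}\,d\mu(t),\quad z\in\mathbb{D},$$ whenever the integral converges absolutely for every $z\in\mathbb{D}$. An operator $T:A^{p}\to\mathcal{B}$ (possibly only sublinear) is compact if $T(f)$ is well defined (meaning, for $T=\mathcal{H}_{\mu}^{\alpha}$, that the series $\sum_{k=0}^{\infty}\mu_{n,k}a_{k}$ converges for every $n\ge 0$ and the power series defining $\mathcal{H}_{\mu}^{\alpha}(f)$ converges in $\mathbb{D}$, and, for $T=\widetilde{\mathcal{I}}_{\mu_{\alpha+1}}$, that the integral defining $\widetilde{\mathcal{I}}_{\mu_{\alpha+1}}(f)(z)$ converges absolutely for every $z\in\mathbb{D}$) and belongs to $\mathcal{B}$ for every $f\in A^{p}$, and for every sequence $\{f_{k}\}$ bounded in $A^{p}$ the sequence $\{T(f_{k})\}$ has a subsequence converging in the norm of $\mathcal{B}$. *)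

theory Defs
  imports "HOL-Complex_Analysis.Complex_Analysis"
begin

(* Functions on the unit disk are total functions complex => complex; only their values on
   ball 0 1 are ever used. *)

definition bergman :: "real \<Rightarrow> (complex \<Rightarrow> complex) set" where
  "bergman p = {f. f holomorphic_on ball 0 1 \<and>
     set_integrable lborel (ball 0 1) (\<lambda>z. norm (f z) powr p)}"

(* The factor 1/pi is the normalisation dA = dx dy / pi. For p < 1 this is only a quasi-norm. *)
definition bergman_norm :: "real \<Rightarrow> (complex \<Rightarrow> complex) \<Rightarrow> real" where
  "bergman_norm p f =
     ((LINT z:ball 0 1|lborel. norm (f z) powr p) / pi) powr (1 / p)"

definition bloch :: "(complex \<Rightarrow> complex) set" where
  "bloch = {f. f holomorphic_on ball 0 1 \<and>
     bdd_above ((\<lambda>z. (1 - (norm z)\<^sup>2) * norm (deriv f z)) ` ball 0 1)}"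

(* Meaningful for members of bloch only: the supremum is a real number. *)
definition bloch_norm :: "(complex \<Rightarrow> complex) \<Rightarrow> real" where
  "bloch_norm f = norm (f 0) + (SUP z\<in>ball 0 1. (1 - (norm z)\<^sup>2) * norm (deriv f z))"

(* Borel measures on [0,1) have space {0..<1}; they are not assumed finite, but the Carleson
   condition at t = 0 forces finiteness. *)
definition borel_measure_unit :: "real measure \<Rightarrow> bool" where
  "borel_measure_unit \<mu> \<longleftrightarrow> sets \<mu> = sets (restrict_space borel {0..<1})"

definition carleson :: "real \<Rightarrow> real measure \<Rightarrow> bool" where
  "carleson s \<mu> \<longleftrightarrow>
     (\<exists>M>0. \<forall>t\<in>{0..<1}. emeasure \<mu> {t..<1} \<le> ennreal (M * (1 - t) powr s))"

definition vanishing_carleson :: "real \<Rightarrow> real measure \<Rightarrow> bool" where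
  "vanishing_carleson s \<mu> \<longleftrightarrow> carleson s \<mu> \<and>
     ((\<lambda>t. measure \<mu> {t..<1} / (1 - t) powr s) \<longlongrightarrow> 0) (at_left 1)"

definition moment :: "real measure \<Rightarrow> nat \<Rightarrow> real" where
  "moment \<mu> n = (LINT t|\<mu>. t ^ n)"

definition taylor_coeff :: "(complex \<Rightarrow> complex) \<Rightarrow> nat \<Rightarrow> complex" where
  "taylor_coeff f k = fps_nth (fps_expansion f 0) k"

definition hankel_coeff :: "real \<Rightarrow> real measure \<Rightarrow> (complex \<Rightarrow> complex) \<Rightarrow> nat \<Rightarrow> complex" where
  "hankel_coeff \<alpha> \<mu> f n =
     of_real (Gamma (real n + 1 + \<alpha>) / (Gamma (real n + 1) * Gamma (\<alpha> + 1))) *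
     (\<Sum>k. of_real (moment \<mu> (n + k)) * taylor_coeff f k)"

definition hankel :: "real \<Rightarrow> real measure \<Rightarrow> (complex \<Rightarrow> complex) \<Rightarrow> complex \<Rightarrow> complex" where
  "hankel \<alpha> \<mu> f z = (\<Sum>n. hankel_coeff \<alpha> \<mu> f n * z ^ n)"

definition hankel_dom :: "real \<Rightarrow> real measure \<Rightarrow> (complex \<Rightarrow> complex) set" where
  "hankel_dom \<alpha> \<mu> = {f.
     (\<forall>n. summable (\<lambda>k. of_real (moment \<mu> (n + k)) * taylor_coeff f k)) \<and>
     (\<forall>z\<in>ball 0 1. summable (\<lambda>n. hankel_coeff \<alpha> \<mu> f n * z ^ n))}"

(* Re (1 - t z) > 0, so the principal branch used by powr is the intended one. *)
definition int_kernel :: "real \<Rightarrow> (complex \<Rightarrow> complex) \<Rightarrow> complex \<Rightarrow> real \<Rightarrow> complex" where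
  "int_kernel \<alpha> f z t =
     of_real (norm (f (of_real t))) / (1 - of_real t * z) powr of_real (\<alpha> + 1)"

definition int_op :: "real \<Rightarrow> real measure \<Rightarrow> (complex \<Rightarrow> complex) \<Rightarrow> complex \<Rightarrow> complex" where
  "int_op \<alpha> \<mu> f z = (LINT t|\<mu>. int_kernel \<alpha> f z t)"

definition int_op_dom :: "real \<Rightarrow> real measure \<Rightarrow> (complex \<Rightarrow> complex) set" where
  "int_op_dom \<alpha> \<mu> = {f. \<forall>z\<in>ball 0 1. integrable \<mu> (int_kernel \<alpha> f z)}"

(* T need not be linear. D is the set of functions on which T is well defined. *)
definition compact_bergman_bloch ::
  "real \<Rightarrow> (complex \<Rightarrow> complex) set \<Rightarrow> ((complex \<Rightarrow> complex) \<Rightarrow> complex \<Rightarrow> complex) \<Rightarrow> bool" where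
  "compact_bergman_bloch p D T \<longleftrightarrow>
     (\<forall>f\<in>bergman p. f \<in> D \<and> T f \<in> bloch) \<and>
     (\<forall>F :: nat \<Rightarrow> complex \<Rightarrow> complex.
        (\<forall>k. F k \<in> bergman p) \<and> (\<exists>C. \<forall>k. bergman_norm p (F k) \<le> C) \<longrightarrow>
        (\<exists>r g. strict_mono (r :: nat \<Rightarrow> nat) \<and> g \<in> bloch \<and>
           (\<lambda>k. bloch_norm (\<lambda>z. T (F (r k)) z - g z)) \<longlonglongrightarrow> 0))"

end

theory Submission
  imports Defs
begin

text \<open>
Put b = 2 / p and l = \<alpha> + 1, and for a density g on [0,1) let J g (z) be the Cauchy transform
\<integral> g(t) (1 - t z)^(-l) d\<mu>(t). Both operators are J applied to the values of f on the radius: the Hankel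
operator takes g = f, the integral operator takes g = |f|. Hence (a) and (b) are each compared with (c)
by one argument about J.

\<^item> Differentiation raises the exponent, (J g)' (z) = l \<integral> t g(t) (1 - t z)^(-l-1) d\<mu>(t), so the Bloch norm
of J g is governed by (1 - r) \<integral> |g(t)| (1 - t r)^(-l-1) d\<mu>(t). A function of norm at most 1 in A^p is
O((1 - |z|)^(-b)) (lemma bergman_growth). For such data only the tails \<mu>([t,1)) relative to
(1 - t)^(b+l) matter: if they are bounded by K for t \<ge> d, the part of the integral over [d,1) is O(K)
uniformly in r (lemma carleson_kernel_bound, a dyadic decomposition).

\<^item> (c) gives compactness: a bounded sequence of A^p has, by Montel, a subsequence converging locally
uniformly. On [0,d) the differences of the data are uniformly small, and on [d,1) the vanishing Carleson
condition makes K small; so the images converge in the Bloch norm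
(lemma vanishing_carleson_imp_compact).

\<^item> That the Hankel operator equals J needs care because the series of the \<mu>_(n+k) a_k need not converge
absolutely. A Cauchy integral shows that every Taylor section of f at t is O((1 - t)^(-b-e))
for any fixed e > 0, uniformly in the order of the section (lemma partial_sum_growth). Since e < l is
possible, this majorant is \<mu>-integrable, and dominated convergence sums the series
(lemma hankel_eq_cauchy_op).

\<^item> Compactness gives (c): the functions f_a (z) = ((1 - a) / (1 - a z)^2)^b, a < 1, are bounded in A^p and
positive on the radius. Positivity of the kernel yields
(1 - a^2) |(J f_a)' (a)| \<ge> c \<mu>([a,1)) / (1 - a)^(b+l). Relative compactness in the Bloch space bounds the left side, so
\<mu> is (b + l)-Carleson. This makes (1 - t)^(-b) integrable and, by dominated convergence,
(J f_a)' tends to 0 pointwise as a tends to 1. Every Bloch limit of the J f_a therefore has zero derivative,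
and the left side above tends to 0 (lemma compact_imp_vanishing_carleson).
\<close>


section \<open>Point evaluations on Bergman spaces\<close>

text \<open>
Fubini's theorem becomes available on the complex plane by identifying it with the product of two real lines.
\<close>

lemma lborel_complex:
  "(lborel :: complex measure) = distr (lborel \<Otimes>\<^sub>M lborel) borel (\<lambda>(x, y). Complex x y)"
proof (rule lborel_eqI)
  have meas: "(\<lambda>(x, y). Complex x y) \<in> borel_measurable (lborel \<Otimes>\<^sub>M lborel)"
    unfolding Complex_eq case_prod_beta by measurable
  fix l u :: complex
  assume le: "\<And>b. b \<in> Basis \<Longrightarrow> l \<bullet> b \<le> u \<bullet> b"
  have le': "Re l \<le> Re u" "Im l \<le> Im u" using le[of 1] le[of \<i>] by (auto simp: Basis_complex_def)
  have "(\<lambda>(x, y). Complex x y) -` box l u \<inter> space (lborel \<Otimes>\<^sub>M lborel) =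
     {Re l<..<Re u} \<times> {Im l<..<Im u}"
    by (auto simp: in_box_complex_iff space_pair_measure)
  then have "emeasure (distr (lborel \<Otimes>\<^sub>M lborel) borel (\<lambda>(x, y). Complex x y)) (box l u) =
    emeasure (lborel \<Otimes>\<^sub>M lborel) ({Re l<..<Re u} \<times> {Im l<..<Im u})"
    using meas by (simp add: emeasure_distr)
  also have "\<dots> = ennreal (Re u - Re l) * ennreal (Im u - Im l)"
    using le' by (subst lborel.emeasure_pair_measure_Times) auto
  also have "\<dots> = ennreal (\<Prod>b\<in>Basis. (u - l) \<bullet> b)"
    using le' by (simp add: Basis_complex_def ennreal_mult)
  finally show "emeasure (distr (lborel \<Otimes>\<^sub>M lborel) borel (\<lambda>(x, y). Complex x y)) (box l u) =
    ennreal (\<Prod>b\<in>Basis. (u - l) \<bullet> b)" .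
qed simp

lemma nn_integral_complex:
  fixes G :: "complex \<Rightarrow> ennreal"
  assumes [measurable]: "G \<in> borel_measurable borel"
  shows "(\<integral>\<^sup>+w. G w \<partial>lborel) = (\<integral>\<^sup>+x. \<integral>\<^sup>+y. G (Complex x y) \<partial>lborel \<partial>lborel)"
    and "(\<integral>\<^sup>+w. G w \<partial>lborel) = (\<integral>\<^sup>+y. \<integral>\<^sup>+x. G (Complex x y) \<partial>lborel \<partial>lborel)"
proof -
  have meas[measurable]: "(\<lambda>(x, y). Complex x y) \<in> borel_measurable (lborel \<Otimes>\<^sub>M lborel)"
    unfolding Complex_eq case_prod_beta by measurable
  have m2: "(\<lambda>(x, y). G (Complex x y)) \<in> borel_measurable (lborel \<Otimes>\<^sub>M lborel)"
    using measurable_compose[OF meas assms] by (simp add: case_prod_beta)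
  have eq: "(\<integral>\<^sup>+w. G w \<partial>lborel) = (\<integral>\<^sup>+q. (\<lambda>(x, y). G (Complex x y)) q \<partial>(lborel \<Otimes>\<^sub>M lborel))"
    by (subst lborel_complex, subst nn_integral_distr)
       (use meas in \<open>auto simp: case_prod_beta'\<close>)
  show "(\<integral>\<^sup>+w. G w \<partial>lborel) = (\<integral>\<^sup>+x. \<integral>\<^sup>+y. G (Complex x y) \<partial>lborel \<partial>lborel)"
    unfolding eq using lborel.nn_integral_fst[OF m2] by simp
  show "(\<integral>\<^sup>+w. G w \<partial>lborel) = (\<integral>\<^sup>+y. \<integral>\<^sup>+x. G (Complex x y) \<partial>lborel \<partial>lborel)"
    unfolding eq using lborel_pair.nn_integral_snd[OF m2] by simp
qed

text \<open>
Only segments with a unit direction u (here 1 or \<i>) occur, so that the parameter x is arc length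
and the right-hand side is a one-dimensional Lebesgue integral to which Fubini applies later. Both
orientations are admitted because a rectangular path runs through opposite sides in opposite directions.
\<close>

lemma norm_contour_integral_segment_le:
  fixes F :: "complex \<Rightarrow> complex" and u w0 :: complex and x1 x2 :: real
  assumes u: "norm u = 1" and ne: "x1 \<noteq> x2"
    and cont: "continuous_on (closed_segment x1 x2) (\<lambda>x. F (w0 + of_real x * u))"
  shows "ennreal (norm (contour_integral (linepath (w0 + of_real x1 * u) (w0 + of_real x2 * u)) F)) \<le>
    (\<integral>\<^sup>+x. ennreal (norm (F (w0 + of_real x * u))) * indicator (closed_segment x1 x2) x \<partial>lborel)"
proof -
  define P where "P = (\<lambda>x. F (w0 + of_real x * u))"
  define c where "c = x2 - x1"
  have seg: "x1 + c * s \<in> closed_segment x1 x2 \<longleftrightarrow> s \<in> {0..1}" for s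
  proof
    assume "x1 + c * s \<in> closed_segment x1 x2"
    then obtain v where v: "0 \<le> v" "v \<le> 1" "x1 + c * s = (1 - v) * x1 + v * x2" 
      by (auto simp: in_segment)
    then have "c * s = c * v" by (simp add: c_def algebra_simps)
    then have "s = v" using ne by (simp add: c_def)
    then show "s \<in> {0..1}" using v by simp
  next
    assume "s \<in> {0..1}"
    then show "x1 + c * s \<in> closed_segment x1 x2"
      by (auto simp: in_segment c_def algebra_simps intro!: exI[of _ s])
  qed
  have contP: "continuous_on {0..1} (\<lambda>s. P (x1 + c * s))"
  proof (rule continuous_on_compose2[OF cont[folded P_def]])
    show "continuous_on {0..1} (\<lambda>s. x1 + c * s)" by (intro continuous_intros)
    show "(\<lambda>s. x1 + c * s) ` {0..1} \<subseteq> closed_segment x1 x2" using seg by blast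
  qed
  have si: "set_integrable lborel {0..1} (\<lambda>s. P (x1 + c * s))"
    unfolding set_integrable_def using contP by (intro borel_integrable_compact) auto
  have "contour_integral (linepath (w0 + of_real x1 * u) (w0 + of_real x2 * u)) F =
     (of_real c * u) * integral {0..1} (\<lambda>s. F (linepath (w0 + of_real x1 * u) (w0 + of_real x2 * u) s))"
  proof -
    have "contour_integral (linepath a b) F = (b - a) * integral {0..1} (\<lambda>s. F (linepath a b s))" for a b
      by (simp add: contour_integral_integral)
    moreover have "(w0 + of_real x2 * u) - (w0 + of_real x1 * u) = of_real c * u"
      by (simp add: c_def algebra_simps)
    ultimately show ?thesis by simp
  qed
  also have "(\<lambda>s. F (linepath (w0 + of_real x1 * u) (w0 + of_real x2 * u) s)) = (\<lambda>s. P (x1 + c * s))"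
  proof
    fix s
    have "linepath (w0 + of_real x1 * u) (w0 + of_real x2 * u) s = w0 + of_real (x1 + c * s) * u"
      by (simp add: linepath_def c_def scaleR_conv_of_real algebra_simps)
    then show "F (linepath (w0 + of_real x1 * u) (w0 + of_real x2 * u) s) = P (x1 + c * s)"
      by (simp only: P_def)
  qed
  finally have "norm (contour_integral (linepath (w0 + of_real x1 * u) (w0 + of_real x2 * u)) F) =
     \<bar>c\<bar> * norm (integral {0..1} (\<lambda>s. P (x1 + c * s)))"
    using u by (simp add: norm_mult)
  also have "integral {0..1} (\<lambda>s. P (x1 + c * s)) = (LINT s|lborel. indicator {0..1} s *\<^sub>R P (x1 + c * s))"
    using set_borel_integral_eq_integral(2)[OF si] by (simp add: set_lebesgue_integral_def)
  finally have "ennreal (norm (contour_integral (linepath (w0 + of_real x1 * u) (w0 + of_real x2 * u)) F)) =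
     ennreal \<bar>c\<bar> * ennreal (norm (LINT s|lborel. indicator {0..1} s *\<^sub>R P (x1 + c * s)))"
    by (simp add: ennreal_mult)
  also have "\<dots> \<le> ennreal \<bar>c\<bar> * (\<integral>\<^sup>+s. ennreal (norm (indicator {0..1} s *\<^sub>R P (x1 + c * s))) \<partial>lborel)"
    using si unfolding set_integrable_def by (intro mult_left_mono integral_norm_bound_ennreal) auto
  also have "(\<integral>\<^sup>+s. ennreal (norm (indicator {0..1} s *\<^sub>R P (x1 + c * s))) \<partial>lborel) =
     (\<integral>\<^sup>+s. ennreal (norm (P (x1 + c * s))) * indicator (closed_segment x1 x2) (x1 + c * s) \<partial>lborel)"
    using seg by (intro nn_integral_cong) (auto simp: indicator_def)
  also have "ennreal \<bar>c\<bar> * \<dots> = (\<integral>\<^sup>+x. ennreal (norm (P x)) * indicator (closed_segment x1 x2) x \<partial>lborel)"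
  proof (rule nn_integral_real_affine[symmetric])
    have "(\<lambda>x. indicator (closed_segment x1 x2) x *\<^sub>R P x) \<in> borel_measurable borel"
      using cont by (intro borel_measurable_continuous_on_indicator) (auto simp: P_def)
    then have "(\<lambda>x. ennreal (norm (indicator (closed_segment x1 x2) x *\<^sub>R P x))) \<in> borel_measurable borel"
      by measurable
    also have "(\<lambda>x. ennreal (norm (indicator (closed_segment x1 x2) x *\<^sub>R P x))) =
       (\<lambda>x. ennreal (norm (P x)) * indicator (closed_segment x1 x2) x)"
      by (auto simp: indicator_def)
    finally show "(\<lambda>x. ennreal (norm (P x)) * indicator (closed_segment x1 x2) x) \<in> borel_measurable borel" .
    show "c \<noteq> 0" using ne by (simp add: c_def)
  qed
  finally show ?thesis by (simp add: P_def)
qed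

text \<open>
Squares replace discs: their boundary integrals over varying side length add up to area integrals by
Fubini in Cartesian coordinates, so no polar coordinates are involved.
\<close>

definition square :: "complex \<Rightarrow> real \<Rightarrow> complex set" where
  "square z d = cbox (z - Complex d d) (z + Complex d d)"

lemma square_measurable:
  fixes f :: "complex \<Rightarrow> complex"
  assumes "f holomorphic_on square z0 d"
  shows "(\<lambda>w. ennreal (norm (f w)) * indicator (square z0 d) w) \<in> borel_measurable borel"
proof -
  have "continuous_on (square z0 d) f" using assms by (rule holomorphic_on_imp_continuous_on)
  then have "(\<lambda>w. indicator (square z0 d) w *\<^sub>R f w) \<in> borel_measurable borel"
    by (intro borel_measurable_continuous_on_indicator) (auto simp: square_def)
  then have "(\<lambda>w. ennreal (norm (indicator (square z0 d) w *\<^sub>R f w))) \<in> borel_measurable borel" by measurable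
  also have "(\<lambda>w. ennreal (norm (indicator (square z0 d) w *\<^sub>R f w))) =
      (\<lambda>w. ennreal (norm (f w)) * indicator (square z0 d) w)"
    by (auto simp: indicator_def)
  finally show ?thesis .
qed

text \<open>
Cauchy's formula over the boundary of the square of half-side r, where |w - z0| \<ge> r. The four sides are
enlarged to full lines through the big square of half-side d, which makes the bound integrable in r.
\<close>

lemma norm_center_le_boundary_integrals:
  fixes f :: "complex \<Rightarrow> complex" and x0 y0 r d :: real
  defines "z0 \<equiv> Complex x0 y0"
  assumes hol: "f holomorphic_on square z0 d" and r: "0 < r" "r \<le> d"
  defines "G \<equiv> \<lambda>w. ennreal (norm (f w)) * indicator (square z0 d) w"
  shows "ennreal (2 * pi * r * norm (f z0)) \<le>
     (\<integral>\<^sup>+x. G (Complex x (y0 - r)) \<partial>lborel) + (\<integral>\<^sup>+y. G (Complex (x0 + r) y) \<partial>lborel) +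
     (\<integral>\<^sup>+x. G (Complex x (y0 + r)) \<partial>lborel) + (\<integral>\<^sup>+y. G (Complex (x0 - r) y) \<partial>lborel)"
proof -
  define a1 a2 a3 a4 where "a1 = Complex (x0 - r) (y0 - r)" and "a2 = Complex (x0 + r) (y0 - r)"
    and "a3 = Complex (x0 + r) (y0 + r)" and "a4 = Complex (x0 - r) (y0 + r)"
  define F where "F = (\<lambda>w. f w / (w - z0))"
  define S where "S = square z0 d"
  have S: "w \<in> S \<longleftrightarrow> x0 - d \<le> Re w \<and> Re w \<le> x0 + d \<and> y0 - d \<le> Im w \<and> Im w \<le> y0 + d" for w
    by (auto simp: S_def square_def in_cbox_complex_iff z0_def)
  have path: "rectpath a1 a3 = linepath a1 a2 +++ linepath a2 a3 +++ linepath a3 a4 +++ linepath a4 a1"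
    by (simp add: rectpath_def Let_def a1_def a2_def a3_def a4_def)
  have le: "Re a1 \<le> Re a3" "Im a1 \<le> Im a3" using r by (auto simp: a1_def a3_def)
  have z0box: "z0 \<in> box a1 a3" using r by (auto simp: in_box_complex_iff z0_def a1_def a3_def)
  have "((\<lambda>w. f w / (w - z0)) has_contour_integral (2*pi * \<i> * winding_number (rectpath a1 a3) z0 * f z0)) (rectpath a1 a3)"
  proof (rule Cauchy_integral_formula_convex_simple)
    show "convex S" by (simp add: S_def square_def)
    show "f holomorphic_on S" using hol by (simp add: S_def)
    have "z0 \<in> box (z0 - Complex d d) (z0 + Complex d d)" using r by (auto simp: in_box_complex_iff z0_def)
    then show "z0 \<in> interior S" by (simp add: S_def square_def interior_cbox)
    have "path_image (rectpath a1 a3) \<subseteq> cbox a1 a3 - box a1 a3"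
      using path_image_rectpath_cbox_minus_box[OF le] by simp
    also have "\<dots> \<subseteq> S - {z0}" using z0box r by (auto simp: in_cbox_complex_iff S a1_def a3_def)
    finally show "path_image (rectpath a1 a3) \<subseteq> S - {z0}" .
  qed auto
  then have ci: "(F has_contour_integral (2*pi * \<i> * f z0)) (rectpath a1 a3)"
    using winding_number_rectpath[OF z0box] by (simp add: F_def)
  have side: "ennreal (norm (contour_integral (linepath (w0 + of_real s1 * u) (w0 + of_real s2 * u)) F)) \<le>
      ennreal (1 / r) * (\<integral>\<^sup>+x. G (w0 + of_real x * u) \<partial>lborel)" (is ?A)
    and int: "F contour_integrable_on linepath (w0 + of_real s1 * u) (w0 + of_real s2 * u)" (is ?B)
    if u: "norm u = 1" "s1 \<noteq> s2"
      and far: "\<And>x. x \<in> closed_segment s1 s2 \<Longrightarrow> w0 + of_real x * u \<in> S \<and> r \<le> norm (w0 + of_real x * u - z0)"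
    for w0 u :: complex and s1 s2 :: real
  proof -
    have contS: "continuous_on S f" using hol by (auto simp: S_def intro: holomorphic_on_imp_continuous_on)
    have ne: "w0 + of_real x * u - z0 \<noteq> 0" if "x \<in> closed_segment s1 s2" for x using far[OF that] r by auto
    have cont: "continuous_on (closed_segment s1 s2) (\<lambda>x. F (w0 + of_real x * u))"
      unfolding F_def using far ne
      by (intro continuous_intros continuous_on_compose2[OF contS]) auto
    have im: "w \<in> S \<and> w - z0 \<noteq> 0" if ws: "w \<in> closed_segment (w0 + of_real s1 * u) (w0 + of_real s2 * u)" for w
    proof -
      obtain k where k: "0 \<le> k" "k \<le> 1" "w = (1 - k) *\<^sub>R (w0 + of_real s1 * u) + k *\<^sub>R (w0 + of_real s2 * u)"
        using ws unfolding in_segment by blast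
      define x where "x = (1 - k) * s1 + k * s2"
      have "x \<in> closed_segment s1 s2" using k by (auto simp: in_segment x_def)
      moreover have "w = w0 + of_real x * u" by (simp add: k(3) x_def scaleR_conv_of_real algebra_simps)
      ultimately show ?thesis using far[of x] ne[of x] by auto
    qed
    show ?B unfolding F_def using im
      by (intro contour_integrable_continuous_linepath continuous_intros continuous_on_subset[OF contS]) auto
    have "ennreal (norm (contour_integral (linepath (w0 + of_real s1 * u) (w0 + of_real s2 * u)) F)) \<le>
      (\<integral>\<^sup>+x. ennreal (norm (F (w0 + of_real x * u))) * indicator (closed_segment s1 s2) x \<partial>lborel)"
      by (rule norm_contour_integral_segment_le[OF u cont])
    also have "\<dots> \<le> (\<integral>\<^sup>+x. ennreal (1 / r) * G (w0 + of_real x * u) \<partial>lborel)"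
    proof (rule nn_integral_mono)
      fix x
      show "ennreal (norm (F (w0 + of_real x * u))) * indicator (closed_segment s1 s2) x \<le> ennreal (1 / r) * G (w0 + of_real x * u)"
      proof (cases "x \<in> closed_segment s1 s2")
        case True
        have "norm (F (w0 + of_real x * u)) \<le> 1 / r * norm (f (w0 + of_real x * u))"
          using far[OF True] r unfolding F_def norm_divide by (simp add: frac_le)
        then show ?thesis using True far[OF True] r
          by (simp add: G_def S_def ennreal_mult[symmetric] ennreal_leI)
      qed auto
    qed
    also have "\<dots> = ennreal (1 / r) * (\<integral>\<^sup>+x. G (w0 + of_real x * u) \<partial>lborel)"
    proof (rule nn_integral_cmult)
      have [measurable]: "G \<in> borel_measurable borel"
        unfolding G_def by (rule square_measurable[OF hol])
      show "(\<lambda>x. G (w0 + of_real x * u)) \<in> borel_measurable lborel" by measurable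
    qed
    finally show ?A .
  qed
  define h v :: "real \<Rightarrow> complex" where "h = (\<lambda>y. Complex 0 y)" and "v = (\<lambda>x. Complex x 0)"
  have hv: "h y + of_real x * 1 = Complex x y" "v x + of_real y * \<i> = Complex x y" for x y
    by (auto simp: h_def v_def complex_eq_iff)
  have nr: "r \<le> norm w" if "\<bar>Re w\<bar> = r \<or> \<bar>Im w\<bar> = r" for w
    using that abs_Re_le_cmod[of w] abs_Im_le_cmod[of w] by auto
  have segx: "x \<in> closed_segment (x0 - r) (x0 + r) \<Longrightarrow> x0 - r \<le> x \<and> x \<le> x0 + r"
    "x \<in> closed_segment (x0 + r) (x0 - r) \<Longrightarrow> x0 - r \<le> x \<and> x \<le> x0 + r"
    "x \<in> closed_segment (y0 - r) (y0 + r) \<Longrightarrow> y0 - r \<le> x \<and> x \<le> y0 + r"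
    "x \<in> closed_segment (y0 + r) (y0 - r) \<Longrightarrow> y0 - r \<le> x \<and> x \<le> y0 + r" for x
    using r by (auto simp: closed_segment_eq_real_ivl)
  have far1: "h (y0 - r) + of_real x * 1 \<in> S \<and> r \<le> norm (h (y0 - r) + of_real x * 1 - z0)"
    if "x \<in> closed_segment (x0 - r) (x0 + r)" for x
    unfolding hv using segx(1)[OF that] r by (auto simp: S z0_def intro!: nr)
  have far2: "v (x0 + r) + of_real x * \<i> \<in> S \<and> r \<le> norm (v (x0 + r) + of_real x * \<i> - z0)"
    if "x \<in> closed_segment (y0 - r) (y0 + r)" for x
    unfolding hv using segx(3)[OF that] r by (auto simp: S z0_def intro!: nr)
  have far3: "h (y0 + r) + of_real x * 1 \<in> S \<and> r \<le> norm (h (y0 + r) + of_real x * 1 - z0)"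
    if "x \<in> closed_segment (x0 + r) (x0 - r)" for x
    unfolding hv using segx(2)[OF that] r by (auto simp: S z0_def intro!: nr)
  have far4: "v (x0 - r) + of_real x * \<i> \<in> S \<and> r \<le> norm (v (x0 - r) + of_real x * \<i> - z0)"
    if "x \<in> closed_segment (y0 + r) (y0 - r)" for x
    unfolding hv using segx(4)[OF that] r by (auto simp: S z0_def intro!: nr)
  have rne: "x0 - r \<noteq> x0 + r" "x0 + r \<noteq> x0 - r" "y0 - r \<noteq> y0 + r" "y0 + r \<noteq> y0 - r" using r by auto
  note s1 = side[OF norm_one rne(1) far1] int[OF norm_one rne(1) far1]
  note s2 = side[OF norm_ii rne(3) far2] int[OF norm_ii rne(3) far2]
  note s3 = side[OF norm_one rne(2) far3] int[OF norm_one rne(2) far3]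
  note s4 = side[OF norm_ii rne(4) far4] int[OF norm_ii rne(4) far4]
  note ss = s1[unfolded hv, folded a1_def a2_def] s2[unfolded hv, folded a3_def a2_def]
    s3[unfolded hv, folded a3_def a4_def] s4[unfolded hv, folded a1_def a4_def]
  have "2*pi * \<i> * f z0 = contour_integral (rectpath a1 a3) F"
    using ci by (simp add: contour_integral_unique)
  also have "\<dots> = contour_integral (linepath a1 a2) F + (contour_integral (linepath a2 a3) F +
     (contour_integral (linepath a3 a4) F + contour_integral (linepath a4 a1) F))"
    unfolding path using ss by (simp add: contour_integral_join contour_integrable_joinI)
  finally have "norm (2*pi * \<i> * f z0) \<le> norm (contour_integral (linepath a1 a2) F) + (norm (contour_integral (linepath a2 a3) F) +
     (norm (contour_integral (linepath a3 a4) F) + norm (contour_integral (linepath a4 a1) F)))"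
    by (auto intro!: norm_triangle_mono)
  then have "ennreal (2 * pi * norm (f z0)) \<le> ennreal (norm (contour_integral (linepath a1 a2) F)) + (ennreal (norm (contour_integral (linepath a2 a3) F)) +
     (ennreal (norm (contour_integral (linepath a3 a4) F)) + ennreal (norm (contour_integral (linepath a4 a1) F))))"
    by (simp add: norm_mult ennreal_leI mult.assoc flip: ennreal_plus)
  also have "\<dots> \<le> ennreal (1 / r) * (\<integral>\<^sup>+x. G (Complex x (y0 - r)) \<partial>lborel) +
      (ennreal (1 / r) * (\<integral>\<^sup>+y. G (Complex (x0 + r) y) \<partial>lborel) +
      (ennreal (1 / r) * (\<integral>\<^sup>+x. G (Complex x (y0 + r)) \<partial>lborel) +
       ennreal (1 / r) * (\<integral>\<^sup>+y. G (Complex (x0 - r) y) \<partial>lborel)))"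
    by (intro add_mono ss)
  finally have "ennreal r * ennreal (2 * pi * norm (f z0)) \<le> ennreal r * \<dots>"
    by (rule mult_left_mono) simp
  also have "ennreal r * (ennreal (1 / r) * (\<integral>\<^sup>+x. G (Complex x (y0 - r)) \<partial>lborel) +
      (ennreal (1 / r) * (\<integral>\<^sup>+y. G (Complex (x0 + r) y) \<partial>lborel) +
      (ennreal (1 / r) * (\<integral>\<^sup>+x. G (Complex x (y0 + r)) \<partial>lborel) +
       ennreal (1 / r) * (\<integral>\<^sup>+y. G (Complex (x0 - r) y) \<partial>lborel)))) = 
     (ennreal r * ennreal (1 / r)) * (
     (\<integral>\<^sup>+x. G (Complex x (y0 - r)) \<partial>lborel) + (\<integral>\<^sup>+y. G (Complex (x0 + r) y) \<partial>lborel) +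
     (\<integral>\<^sup>+x. G (Complex x (y0 + r)) \<partial>lborel) + (\<integral>\<^sup>+y. G (Complex (x0 - r) y) \<partial>lborel))"
    by (simp add: algebra_simps)
  also have "ennreal r * ennreal (1 / r) = 1" using r by (simp flip: ennreal_mult)
  also have "ennreal r * ennreal (2 * pi * norm (f z0)) = ennreal (2 * pi * r * norm (f z0))"
    using r by (simp add: mult_ac flip: ennreal_mult)
  finally show ?thesis by simp
qed

text \<open>
Averaging the boundary estimate over the half-sides r between d/2 and d turns each of the four line integrals
into an integral over a part of the square. This is the submean value property of |f| up to a constant.
\<close>

lemma norm_center_square_le:
  fixes f :: "complex \<Rightarrow> complex"
  assumes hol: "f holomorphic_on square z0 d" and d: "0 < d"
  shows "ennreal (d\<^sup>2 * norm (f z0)) \<le> 4 * (\<integral>\<^sup>+w. ennreal (norm (f w)) * indicator (square z0 d) w \<partial>lborel)"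
proof -
  obtain x0 y0 where z0: "z0 = Complex x0 y0" by (cases z0)
  define G where "G = (\<lambda>w. ennreal (norm (f w)) * indicator (square z0 d) w)"
  have G[measurable]: "G \<in> borel_measurable borel"
    using square_measurable[OF hol] by (simp add: G_def)
  have C[measurable]: "(\<lambda>(x, y). Complex x y) \<in> borel_measurable (lborel \<Otimes>\<^sub>M lborel)"
    unfolding Complex_eq case_prod_beta by measurable
  define H V where "H = (\<lambda>y. \<integral>\<^sup>+x. G (Complex x y) \<partial>lborel)" and "V = (\<lambda>x. \<integral>\<^sup>+y. G (Complex x y) \<partial>lborel)"
  have H[measurable]: "H \<in> borel_measurable borel" and V[measurable]: "V \<in> borel_measurable borel"
    unfolding H_def V_def Complex_eq by measurable
  have I: "(\<integral>\<^sup>+y. H y \<partial>lborel) = (\<integral>\<^sup>+w. G w \<partial>lborel)" "(\<integral>\<^sup>+x. V x \<partial>lborel) = (\<integral>\<^sup>+w. G w \<partial>lborel)"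
    unfolding H_def V_def using nn_integral_complex[OF G] by auto
  have aff: "(\<integral>\<^sup>+r. K (t + r) \<partial>lborel) = (\<integral>\<^sup>+r. K r \<partial>lborel)"
    "(\<integral>\<^sup>+r. K (t - r) \<partial>lborel) = (\<integral>\<^sup>+r. K r \<partial>lborel)"
    if "K \<in> borel_measurable borel" for K :: "real \<Rightarrow> ennreal" and t
    using nn_integral_real_affine[OF that, of 1 t] nn_integral_real_affine[OF that, of "-1" t] by auto
  have "ennreal (d\<^sup>2 * norm (f z0)) \<le> ennreal (pi * d * norm (f z0)) * ennreal (d / 2)"
    using d pi_ge_two mult_right_mono[of 2 pi "d\<^sup>2 * norm (f z0)"]
    by (auto intro!: ennreal_leI simp: power2_eq_square mult_ac simp flip: ennreal_mult)
  also have "\<dots> = (\<integral>\<^sup>+r. ennreal (pi * d * norm (f z0)) * indicator {d/2..d} r \<partial>lborel)"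
    using d by (subst nn_integral_cmult_indicator) auto
  also have "\<dots> \<le> (\<integral>\<^sup>+r. H (y0 - r) + V (x0 + r) + H (y0 + r) + V (x0 - r) \<partial>lborel)"
  proof (rule nn_integral_mono)
    fix r
    show "ennreal (pi * d * norm (f z0)) * indicator {d/2..d} r \<le> H (y0 - r) + V (x0 + r) + H (y0 + r) + V (x0 - r)"
    proof (cases "r \<in> {d/2..d}")
      case True
      have "pi * d * norm (f z0) \<le> 2 * pi * r * norm (f z0)"
        using True by (intro mult_right_mono) auto
      then have "ennreal (pi * d * norm (f z0)) \<le> ennreal (2 * pi * r * norm (f z0))" by (rule ennreal_leI)
      also have "\<dots> \<le> H (y0 - r) + V (x0 + r) + H (y0 + r) + V (x0 - r)"
        using norm_center_le_boundary_integrals[of f x0 y0 d r] hol True d unfolding H_def V_def G_def z0 by simp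
      finally show ?thesis using True by simp
    qed simp
  qed
  also have "\<dots> = (\<integral>\<^sup>+w. G w \<partial>lborel) + (\<integral>\<^sup>+w. G w \<partial>lborel) + (\<integral>\<^sup>+w. G w \<partial>lborel) + (\<integral>\<^sup>+w. G w \<partial>lborel)"
    by (simp add: nn_integral_add aff[OF H] aff[OF V] I)
  also have "\<dots> = 4 * (\<integral>\<^sup>+w. G w \<partial>lborel)"
  proof -
    have "(4 :: ennreal) = 1 + 1 + 1 + 1" by simp
    then show ?thesis by (simp only: distrib_right mult_1)
  qed
  finally show ?thesis by (simp add: G_def)
qed

lemma emeasure_square: "0 \<le> d \<Longrightarrow> emeasure lborel (square z d) = ennreal (4 * d\<^sup>2)"
  by (simp add: square_def emeasure_lborel_cbox_eq Basis_complex_def inner_complex_def power2_eq_square)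

lemma square_norm_le:
  assumes "w \<in> square z d"
  shows "norm (w - z) \<le> 2 * d"
proof -
  have "\<bar>Re (w - z)\<bar> \<le> d" "\<bar>Im (w - z)\<bar> \<le> d"
    using assms by (auto simp: square_def in_cbox_complex_iff)
  then show ?thesis using cmod_le[of "w - z"] by linarith
qed

text \<open>
An interface between |f| and |f|^p: the pointwise inequality |f| \<le> a + c |f|^p is the only place where the
exponent enters. It is applied with a > 0 if p > 1 and with a = 0 if p \<le> 1.
\<close>

lemma norm_le_of_pth_power:
  fixes f :: "complex \<Rightarrow> complex" and a c I :: real
  assumes hol: "f holomorphic_on square z d" and d: "0 < d" and ac: "0 \<le> a" "0 \<le> c"
    and sub: "square z d \<subseteq> S"
    and le: "\<And>w. w \<in> square z d \<Longrightarrow> norm (f w) \<le> a + c * norm (f w) powr p"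
    and I: "(\<integral>\<^sup>+w. ennreal (norm (f w) powr p) * indicator S w \<partial>lborel) \<le> ennreal I" "0 \<le> I"
  shows "d\<^sup>2 * norm (f z) \<le> 4 * (4 * d\<^sup>2 * a + c * I)"
proof -
  let ?Q = "square z d"
  have "continuous_on ?Q (\<lambda>w. norm (f w))" using hol by (intro continuous_on_norm holomorphic_on_imp_continuous_on)
  then have m: "(\<lambda>w. indicator ?Q w *\<^sub>R norm (f w)) \<in> borel_measurable borel"
    by (intro borel_measurable_continuous_on_indicator) (auto simp: square_def)
  have "(\<lambda>w. ennreal ((indicator ?Q w *\<^sub>R norm (f w)) powr p) * indicator ?Q w) \<in> borel_measurable borel"
    using m by measurable (auto simp: square_def)
  also have "(\<lambda>w. ennreal ((indicator ?Q w *\<^sub>R norm (f w)) powr p) * indicator ?Q w) =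
     (\<lambda>w. ennreal (norm (f w) powr p) * indicator ?Q w)"
    by (auto simp: indicator_def)
  finally have mp: "(\<lambda>w. ennreal (norm (f w) powr p) * indicator ?Q w) \<in> borel_measurable borel" .
  have "ennreal (d\<^sup>2 * norm (f z)) \<le> 4 * (\<integral>\<^sup>+w. ennreal (norm (f w)) * indicator ?Q w \<partial>lborel)"
    by (rule norm_center_square_le[OF hol d])
  also have "\<dots> \<le> 4 * (\<integral>\<^sup>+w. ennreal a * indicator ?Q w + ennreal c * (ennreal (norm (f w) powr p) * indicator ?Q w) \<partial>lborel)"
  proof (intro mult_left_mono nn_integral_mono)
    fix w
    show "ennreal (norm (f w)) * indicator ?Q w \<le> ennreal a * indicator ?Q w + ennreal c * (ennreal (norm (f w) powr p) * indicator ?Q w)"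
    proof (cases "w \<in> ?Q")
      case True
      have "ennreal (norm (f w)) \<le> ennreal (a + c * norm (f w) powr p)" by (intro ennreal_leI le True)
      then show ?thesis using True ac by (simp add: ennreal_mult)
    qed simp
  qed simp
  also have "(\<integral>\<^sup>+w. ennreal a * indicator ?Q w + ennreal c * (ennreal (norm (f w) powr p) * indicator ?Q w) \<partial>lborel)
     = (\<integral>\<^sup>+w. ennreal a * indicator ?Q w \<partial>lborel) + (\<integral>\<^sup>+w. ennreal c * (ennreal (norm (f w) powr p) * indicator ?Q w) \<partial>lborel)"
    using mp by (intro nn_integral_add) (auto simp: square_def)
  also have "(\<integral>\<^sup>+w. ennreal c * (ennreal (norm (f w) powr p) * indicator ?Q w) \<partial>lborel) =
     ennreal c * (\<integral>\<^sup>+w. ennreal (norm (f w) powr p) * indicator ?Q w \<partial>lborel)"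
    using mp by (intro nn_integral_cmult) auto
  also have "(\<integral>\<^sup>+w. ennreal a * indicator ?Q w \<partial>lborel) = ennreal a * ennreal (4 * d\<^sup>2)"
    using d emeasure_square[of d z] by (subst nn_integral_cmult_indicator) (auto simp: square_def)
  also have "4 * (ennreal a * ennreal (4 * d\<^sup>2) + ennreal c * (\<integral>\<^sup>+w. ennreal (norm (f w) powr p) * indicator ?Q w \<partial>lborel))
     \<le> 4 * (ennreal a * ennreal (4 * d\<^sup>2) + ennreal c * ennreal I)"
  proof (intro mult_left_mono add_left_mono)
    show "(\<integral>\<^sup>+w. ennreal (norm (f w) powr p) * indicator ?Q w \<partial>lborel) \<le> ennreal I"
      using sub by (intro order_trans[OF _ I(1)] nn_integral_mono) (auto simp: indicator_def)
  qed auto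
  also have "\<dots> = ennreal (4 * (4 * d\<^sup>2 * a + c * I))"
  proof -
    have "4 * (ennreal a * ennreal (4 * d\<^sup>2) + ennreal c * ennreal I) = ennreal (4 * (a * (4 * d\<^sup>2) + c * I))"
      using ac I d by (simp flip: ennreal_numeral ennreal_mult ennreal_plus)
    then show ?thesis by (simp add: mult_ac)
  qed
  finally have "ennreal (d\<^sup>2 * norm (f z)) \<le> ennreal (4 * (4 * d\<^sup>2 * a + c * I))" .
  moreover have "0 \<le> 4 * (4 * d\<^sup>2 * a + c * I)" using ac I d by simp
  ultimately show ?thesis using ennreal_le_iff by blast
qed


text \<open>
With half-side a quarter of the distance to the boundary, the square stays at half that distance from the
boundary.
\<close>

lemma square_in_ball:
  fixes z :: complex and \<rho> :: real
  assumes "w \<in> square z ((\<rho> - norm z) / 4)"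
  shows "2 * ((\<rho> - norm z) / 4) \<le> \<rho> - norm w"
  using square_norm_le[OF assms] norm_triangle_ineq2[of w z] by (simp add: field_simps)

text \<open>
For p > 1 every x \<ge> 0 satisfies x \<le> \<lambda> + \<lambda>^(1-p) x^p, which replaces Jensen's inequality; \<lambda> is chosen so that
both terms are of the same order.
\<close>

lemma growth_of_pth_power_large:
  fixes p A :: real
  assumes p: "1 < p" and hol: "f holomorphic_on ball 0 1" and A: "0 < A"
    and I: "(\<integral>\<^sup>+w. ennreal (norm (f w) powr p) * indicator (ball 0 1) w \<partial>lborel) \<le> ennreal A"
    and z: "norm z < 1"
  shows "norm (f z) \<le> 20 * 4 powr (2 / p) * A powr (1 / p) * (1 - norm z) powr (- 2 / p)"
proof -
  define d where "d = (1 - norm z) / 4"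
  have d: "0 < d" using z by (simp add: d_def)
  have sub: "square z d \<subseteq> ball 0 1" 
  proof
    fix w assume "w \<in> square z d"
    then have "2 * d \<le> 1 - norm w" using square_in_ball[of w z 1] by (simp add: d_def)
    then show "w \<in> ball 0 1" using d by simp
  qed
  \<comment> \<open>This value makes l^(1-p) A equal to d^2 l.\<close>
  define l where "l = A powr (1 / p) * d powr (- 2 / p)"
  have l: "0 < l" using A d by (simp add: l_def)
  have key: "x \<le> l + l powr (1 - p) * x powr p" if "0 \<le> x" for x :: real
  proof (cases "x \<le> l")
    case False
    have "x powr (p - 1) \<ge> l powr (p - 1)" using False l p by (intro powr_mono2) auto
    then have "1 \<le> l powr (1 - p) * x powr (p - 1)"
      using l by (simp add: powr_minus[of l "p - 1", simplified] field_simps)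
    then have "x * 1 \<le> x * (l powr (1 - p) * x powr (p - 1))" using that by (intro mult_left_mono)
    also have "\<dots> = l powr (1 - p) * (x powr 1 * x powr (p - 1))" using that by simp
    also have "x powr 1 * x powr (p - 1) = x powr p" by (simp only: powr_add[symmetric]) simp
    finally show ?thesis using l by simp
  qed (simp add: add_increasing2)
  have "d\<^sup>2 * norm (f z) \<le> 4 * (4 * d\<^sup>2 * l + l powr (1 - p) * A)"
    using key A l by (intro norm_le_of_pth_power[OF holomorphic_on_subset[OF hol sub] d _ _ sub _ I]) auto
  also have "l powr (1 - p) * A = d\<^sup>2 * l"
  proof -
    have "l powr (1 - p) = l * l powr (- p)" using l by (simp add: powr_diff powr_minus field_simps)
    moreover have "l powr (- p) = A powr (-1) * d powr 2"
      unfolding l_def using A d p by (simp add: powr_mult powr_powr)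
    moreover have "A powr (-1) * d powr 2 * A = d\<^sup>2" using A d by (simp add: powr_minus powr_numeral)
    ultimately show ?thesis by (metis mult.commute mult.left_commute)
  qed
  finally have "d\<^sup>2 * norm (f z) \<le> d\<^sup>2 * (20 * l)" by (simp add: algebra_simps)
  then have "norm (f z) \<le> 20 * l" using d by simp
  also have "l = 4 powr (2 / p) * A powr (1 / p) * (1 - norm z) powr (- 2 / p)"
    using z by (simp add: l_def d_def powr_divide powr_minus field_simps)
  finally show ?thesis by (simp add: mult_ac)
qed

text \<open>
For p \<le> 1 write |f| = |f|^(1-p) |f|^p and bound the first factor by the weighted supremum M of
|f(w)| (\<rho> - |w|)^(2/p). The submean inequality at a maximum point gives M \<le> C M^(1-p) A, and M^(1-p)
cancels because M is finite: this is the reason for working on the smaller disc of radius \<rho> first.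
\<close>

lemma growth_of_pth_power_small:
  fixes p A :: real
  assumes p: "0 < p" "p \<le> 1" and hol: "f holomorphic_on ball 0 1" and A: "0 < A"
    and I: "(\<integral>\<^sup>+w. ennreal (norm (f w) powr p) * indicator (ball 0 1) w \<partial>lborel) \<le> ennreal A"
    and z: "norm z < 1"
  shows "norm (f z) \<le> (16 * 4 powr (2 / p)) powr (1 / p) * A powr (1 / p) * (1 - norm z) powr (- 2 / p)"
proof -
  define C where "C = 16 * 4 powr (2 / p)"
  have bound: "norm (f z) * (\<rho> - norm z) powr (2 / p) \<le> (C * A) powr (1 / p)"
    if rho: "norm z < \<rho>" "\<rho> < 1" for \<rho>
  proof -
    define N where "N = (\<lambda>w. norm (f w) * (\<rho> - norm w) powr (2 / p))"
    have contf: "continuous_on (cball 0 \<rho>) f"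
      using hol rho by (intro holomorphic_on_imp_continuous_on) (auto intro: holomorphic_on_subset)
    have "continuous_on (cball 0 \<rho>) N"
      unfolding N_def using contf p
      by (intro continuous_intros continuous_on_powr') auto
    moreover have "z \<in> cball 0 \<rho>" using rho by simp
    ultimately obtain w where w: "w \<in> cball 0 \<rho>" "\<And>v. v \<in> cball 0 \<rho> \<Longrightarrow> N v \<le> N w"
      using continuous_attains_sup[of "cball 0 \<rho>" N] compact_cball by (metis empty_iff)
    have "N w \<le> (C * A) powr (1 / p)"
    proof (cases "N w \<le> 0 \<or> norm w = \<rho>")
      case True
      then show ?thesis by (auto simp: N_def intro: order_trans[of _ 0])
    next
      case False
      define d where "d = (\<rho> - norm w) / 4"
      have d: "0 < d" using False w(1) by (auto simp: d_def)
      have sq: "2 * d \<le> \<rho> - norm v" if "v \<in> square w d" for v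
        using square_in_ball[of v w \<rho>] that by (simp add: d_def)
      have subr: "square w d \<subseteq> cball 0 \<rho>" using sq d by force
      have sub: "square w d \<subseteq> ball 0 1" using sq d rho by force
      define M where "M = N w"
      have M: "0 < M" using False by (simp add: M_def)
      \<comment> \<open>On the square the weight is at least (2 d)^(2/p), so S bounds |f| there.\<close>
      define S where "S = M * (2 * d) powr (- 2 / p)"
      have S: "0 < S" using M d by (simp add: S_def)
      have fS: "norm (f v) \<le> S" if v: "v \<in> square w d" for v
      proof -
        have "norm (f v) * (2 * d) powr (2 / p) \<le> norm (f v) * (\<rho> - norm v) powr (2 / p)"
          using sq[OF v] d p by (intro mult_left_mono powr_mono2) auto
        also have "\<dots> \<le> M" using w(2)[of v] subr v by (auto simp: N_def M_def)
        finally show ?thesis using d by (simp add: S_def powr_minus field_simps)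
      qed
      have key: "norm (f v) \<le> 0 + S powr (1 - p) * norm (f v) powr p" if v: "v \<in> square w d" for v
      proof -
        have "norm (f v) = norm (f v) powr (1 - p) * norm (f v) powr p"
          by (simp flip: powr_add)
        also have "\<dots> \<le> S powr (1 - p) * norm (f v) powr p"
          using fS[OF v] p by (intro mult_right_mono powr_mono2) auto
        finally show ?thesis by simp
      qed
      have "d\<^sup>2 * norm (f w) \<le> 4 * (4 * d\<^sup>2 * 0 + S powr (1 - p) * A)"
        using key A S by (intro norm_le_of_pth_power[OF holomorphic_on_subset[OF hol sub] d _ _ sub _ I]) auto
      moreover have "norm (f w) = M * (4 * d) powr (- 2 / p)"
      proof -
        have "4 * d = \<rho> - norm w" by (simp add: d_def)
        then show ?thesis using d by (simp add: M_def N_def powr_minus)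
      qed
      ultimately have "d\<^sup>2 * (M * (4 * d) powr (- 2 / p)) \<le> 4 * A * S powr (1 - p)"
        by (simp add: mult_ac)
      also have "S powr (1 - p) = M * M powr (- p) * ((2 * d) powr (- 2 / p) * (2 * d)\<^sup>2)"
      proof -
        have "S powr (1 - p) = M powr (1 - p) * (2 * d) powr ((- 2 / p) * (1 - p))"
          unfolding S_def using M d by (simp add: powr_mult powr_powr)
        also have "(- 2 / p) * (1 - p) = - 2 / p + 2" using p by (simp add: field_simps)
        also have "(2 * d) powr (- 2 / p + 2) = (2 * d) powr (- 2 / p) * (2 * d)\<^sup>2"
          using d by (simp only: powr_add) (simp add: powr_numeral)
        also have "M powr (1 - p) = M * M powr (- p)" using M by (simp add: powr_diff powr_minus field_simps)
        finally show ?thesis by simp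
      qed
      also have "(2 * d) powr (- 2 / p) = 2 powr (2 / p) * (4 * d) powr (- 2 / p)"
      proof -
        have "(4 * d) powr (- 2 / p) = (2 * (2 * d)) powr (- 2 / p)" by simp
        also have "\<dots> = 2 powr (- 2 / p) * (2 * d) powr (- 2 / p)" using d by (subst powr_mult) auto
        finally show ?thesis by (simp add: powr_minus)
      qed
      finally have "(d\<^sup>2 * M * (4 * d) powr (- 2 / p)) * 1 \<le>
         (d\<^sup>2 * M * (4 * d) powr (- 2 / p)) * (16 * 2 powr (2 / p) * A * M powr (- p))"
        by (simp add: power2_eq_square mult_ac)
      \<comment> \<open>All powers of d have the same total exponent on both sides and cancel.\<close>
      then have "1 \<le> 16 * 2 powr (2 / p) * A * M powr (- p)"
        using d M by (subst (asm) mult_le_cancel_left_pos) auto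
      then have "M powr p \<le> 16 * 2 powr (2 / p) * A" using M by (simp add: powr_minus field_simps)
      also have "\<dots> \<le> C * A"
        using A p by (auto simp: C_def intro!: mult_right_mono powr_mono2)
      finally have "(M powr p) powr (1 / p) \<le> (C * A) powr (1 / p)" using p by (intro powr_mono2) auto
      then show ?thesis using M p by (simp add: powr_powr M_def)
    qed
    then show ?thesis using w(2)[of z] rho by (simp add: N_def)
  qed
  \<comment> \<open>The bound is uniform in \<rho>, which may now tend to 1.\<close>
  have "((\<lambda>\<rho>. norm (f z) * (\<rho> - norm z) powr (2 / p)) \<longlongrightarrow> norm (f z) * (1 - norm z) powr (2 / p)) (at_left 1)"
    using z by (intro tendsto_intros) auto
  moreover have "\<forall>\<^sub>F \<rho> in at_left 1. norm (f z) * (\<rho> - norm z) powr (2 / p) \<le> (C * A) powr (1 / p)"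
    using eventually_at_left_real[OF z] by eventually_elim (auto intro: bound)
  ultimately have "norm (f z) * (1 - norm z) powr (2 / p) \<le> (C * A) powr (1 / p)"
    by (intro tendsto_upperbound) auto
  then have "norm (f z) \<le> (C * A) powr (1 / p) * (1 - norm z) powr (- 2 / p)"
    using z by (simp add: powr_minus field_simps)
  then show ?thesis using A by (simp add: C_def powr_mult)
qed

text \<open>
The bound B > 0 on the norm, in place of the norm itself, covers f = 0 and is the form in which bounded
sequences use the estimate.
\<close>

lemma bergman_growth:
  assumes p: "0 < p"
  obtains C where "0 < C" "\<And>f B z. f \<in> bergman p \<Longrightarrow> bergman_norm p f \<le> B \<Longrightarrow> 0 < B \<Longrightarrow> norm z < 1 \<Longrightarrow>
     norm (f z) \<le> C * B * (1 - norm z) powr (- 2 / p)"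
proof -
  define C0 where "C0 = (if p \<le> 1 then (16 * 4 powr (2 / p)) powr (1 / p) else 20 * 4 powr (2 / p))"
  have C0: "0 < C0" by (simp add: C0_def)
  show thesis
  proof (rule that[of "C0 * pi powr (1 / p)"])
    show "0 < C0 * pi powr (1 / p)" using C0 by simp
    fix f B and z :: complex
    assume f: "f \<in> bergman p" and B: "bergman_norm p f \<le> B" "0 < B" and z: "norm z < 1"
    define J where "J = (LINT z:ball 0 1|lborel. norm (f z) powr p)"
    have int: "integrable lborel (\<lambda>w. indicator (ball 0 1) w *\<^sub>R (norm (f w) powr p))"
      using f by (simp add: bergman_def set_integrable_def)
    have J0: "0 \<le> J" unfolding J_def set_lebesgue_integral_def by (intro integral_nonneg_AE) auto
    have "(\<integral>\<^sup>+w. ennreal (norm (f w) powr p) * indicator (ball 0 1) w \<partial>lborel) =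
      (\<integral>\<^sup>+w. ennreal (indicator (ball 0 1) w *\<^sub>R (norm (f w) powr p)) \<partial>lborel)"
      by (intro nn_integral_cong) (auto simp: indicator_def)
    also have "\<dots> = ennreal J"
      unfolding J_def set_lebesgue_integral_def using int by (intro nn_integral_eq_integral) auto
    also have "J \<le> pi * B powr p"
    proof -
      have "((J / pi) powr (1 / p)) powr p \<le> B powr p"
        using B p by (intro powr_mono2) (auto simp: bergman_norm_def J_def)
      then have "J / pi \<le> B powr p" using p J0 by (simp add: powr_powr)
      then show ?thesis by (simp add: field_simps)
    qed
    finally have I: "(\<integral>\<^sup>+w. ennreal (norm (f w) powr p) * indicator (ball 0 1) w \<partial>lborel) \<le> ennreal (pi * B powr p)"
      by (simp add: ennreal_leI)
    have hol: "f holomorphic_on ball 0 1" using f by (simp add: bergman_def)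
    have A: "0 < pi * B powr p" using B by simp
    have "norm (f z) \<le> C0 * (pi * B powr p) powr (1 / p) * (1 - norm z) powr (- 2 / p)"
      using growth_of_pth_power_small[OF p _ hol A I z] growth_of_pth_power_large[OF _ hol A I z]
      by (auto simp: C0_def)
    also have "(pi * B powr p) powr (1 / p) = pi powr (1 / p) * B"
      using B p by (simp add: powr_mult powr_powr)
    finally show "norm (f z) \<le> C0 * pi powr (1 / p) * B * (1 - norm z) powr (- 2 / p)"
      by (simp add: mult_ac)
  qed
qed


section \<open>Taylor sections on the radius\<close>

text \<open>
A linear lower bound for the chord length on the unit circle; the sharp constant would be 2.
\<close>

lemma sin_pi_ge:
  fixes x :: real
  assumes "0 \<le> x" "x \<le> 1"
  shows "min x (1 - x) \<le> sin (pi * x)"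
proof -
  have half: "x \<le> sin (pi * x)" if x: "0 \<le> x" "x \<le> 1 / 2" for x :: real
  proof (cases "x \<le> 1 / 3")
    case True
    have "\<exists>c. 0 \<le> c \<and> c \<le> pi * x \<and> sin (pi * x) - sin 0 = (pi * x - 0) * cos c"
    proof (cases "x = 0")
      case False
      then have "0 < pi * x" using x by simp
      from MVT2[OF this, of sin cos] show ?thesis by (meson DERIV_sin less_imp_le)
    qed auto
    then obtain c where c: "0 \<le> c" "c \<le> pi * x" "sin (pi * x) = pi * x * cos c" by auto
    have "pi * x \<le> pi * (1 / 3)" using True by (intro mult_left_mono) auto
    then have "c \<le> pi / 3" using c by linarith
    then have "cos c \<ge> cos (pi / 3)" using c by (intro cos_monotone_0_pi_le) auto
    then have "pi * x * cos c \<ge> 2 * x * (1 / 2)"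
      using x pi_ge_two by (intro mult_mono) (auto simp: cos_60)
    then show ?thesis using c(3) by simp
  next
    case False
    have "pi * (1 / 3) \<le> pi * x" using False by (intro mult_left_mono) auto
    moreover have "pi * x \<le> pi * (1 / 2)" using x by (intro mult_left_mono) auto
    ultimately have "sin (pi / 3) \<le> sin (pi * x)"
      using pi_ge_two by (intro sin_monotone_2pi_le) auto
    moreover have "1 / 2 \<le> sin (pi / 3)" by (simp add: sin_60 real_le_rsqrt)
    ultimately show ?thesis using x by linarith
  qed
  show ?thesis
  proof (cases "x \<le> 1 / 2")
    case False
    have "sin (pi * (1 - x)) = sin (pi * x)" by (simp add: right_diff_distrib sin_diff)
    then show ?thesis using half[of "1 - x"] False assms by simp
  qed (use half[of x] assms in auto)
qed

text \<open>
Two competing lower bounds for the Cauchy denominator: the first is better near the positive real axis and the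
second away from it. They are interpolated in partial_sum_growth.
\<close>

lemma circle_distance:
  fixes x t \<rho> :: real
  assumes "0 \<le> t" "t < \<rho>" "0 \<le> x" "x \<le> 1" "1 / 2 \<le> \<rho>"
  shows "\<rho> - t \<le> norm (circlepath 0 \<rho> x - of_real t)"
    and "min x (1 - x) / 2 \<le> norm (circlepath 0 \<rho> x - of_real t)"
proof -
  define w where "w = circlepath 0 \<rho> x"
  have w: "w = of_real \<rho> * exp (\<i> * of_real (2 * pi * x))"
    by (simp add: w_def circlepath mult_ac)
  have nw: "norm w = \<rho>" using assms by (simp add: w norm_mult)
  show 1: "\<rho> - t \<le> norm (circlepath 0 \<rho> x - of_real t)"
    using norm_triangle_ineq2[of w "of_real t"] nw assms by (simp add: w_def)
  \<comment> \<open>Since \<rho> - t \<le> |w - t|, the point t may be replaced by \<rho> at the cost of a factor 2.\<close>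
  have "w - of_real \<rho> = of_real \<rho> * (exp (\<i> * of_real (2 * pi * x)) - 1)"
    by (simp add: w right_diff_distrib)
  then have "norm (w - of_real \<rho>) = \<rho> * norm (exp (\<i> * of_real (2 * pi * x)) - 1)"
    using assms by (simp only: norm_mult) simp
  also have "\<dots> = \<rho> * (2 * \<bar>sin (pi * x)\<bar>)" by (subst dist_exp_i_1) simp
  also have "\<dots> \<ge> (1 / 2) * (2 * min x (1 - x))"
    using sin_pi_ge[of x] assms by (intro mult_mono) auto
  finally have "min x (1 - x) \<le> norm (w - of_real \<rho>)" by simp
  also have "\<dots> \<le> norm (w - of_real t) + norm (of_real t - of_real \<rho> :: complex)"
    by (metis norm_triangle_ineq diff_add_cancel add_diff_eq)
  also have "norm (of_real t - of_real \<rho> :: complex) = \<rho> - t"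
    using assms by (simp flip: of_real_diff)
  finally show "min x (1 - x) / 2 \<le> norm (circlepath 0 \<rho> x - of_real t)"
    using 1 by (simp add: w_def)
qed

text \<open>
The kernel of the N-th Taylor section is the Cauchy kernel times 1 - (t/u)^N, and that factor is at most 2
whatever N is.
\<close>

lemma geometric_cauchy_kernel:
  fixes t :: real and u :: complex
  assumes t: "0 \<le> t" "t < norm u"
  shows "norm (\<Sum>k<N. of_real t ^ k / u ^ Suc k) \<le> 2 / norm (u - of_real t)"
proof -
  define q where "q = of_real t / u"
  have u: "u \<noteq> 0" using t by auto
  have q: "norm q < 1" using t u by (simp add: q_def norm_divide)
  then have q1: "1 - q \<noteq> 0" by auto
  have "(\<Sum>k<N. of_real t ^ k / u ^ Suc k) = (\<Sum>k<N. q ^ k) / u"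
    using u by (simp add: sum_divide_distrib q_def power_divide mult.commute)
  also have "(\<Sum>k<N. q ^ k) = (1 - q ^ N) / (1 - q)"
    using q1 by (subst sum_gp_strict) auto
  also have "(1 - q ^ N) / (1 - q) / u = (1 - q ^ N) / (u - of_real t)"
  proof -
    have "(1 - q) * u = u - of_real t" using u by (simp add: q_def left_diff_distrib)
    then show ?thesis by simp
  qed
  finally have "norm (\<Sum>k<N. of_real t ^ k / u ^ Suc k) = norm (1 - q ^ N) / norm (u - of_real t)"
    by (simp add: norm_divide)
  also have "norm (1 - q ^ N) \<le> 1 + 1"
    using q by (intro order_trans[OF norm_triangle_ineq4] add_mono) (auto simp: norm_power power_le_one)
  then have "norm (1 - q ^ N) / norm (u - of_real t) \<le> 2 / norm (u - of_real t)"
    by (intro divide_right_mono) auto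
  finally show ?thesis .
qed

lemma taylor_coeff_eq: "taylor_coeff f k = (deriv ^^ k) f 0 / fact k"
  by (simp add: taylor_coeff_def fps_expansion_def)

lemma taylor_sums:
  assumes "f holomorphic_on ball 0 r" "norm z < r"
  shows "(\<lambda>k. taylor_coeff f k * z ^ k) sums f z"
  using holomorphic_power_series[OF assms(1), of z] assms(2) by (simp add: taylor_coeff_eq)

text \<open>
Cauchy's formula on the circle half-way between t and the unit circle bounds the section by
(1 - t)^(-b) times the integral of 1 / |u - t|. That integral is of logarithmic size; the
interpolation 1 / |u - t| = O(d^(-e) |angle|^(e-1)) with d = (1 - t) / 2 gives up a power (1 - t)^(-e) instead and leaves
an elementary integral.
\<close>

lemma partial_sum_growth:
  fixes f :: "complex \<Rightarrow> complex" and b e G t :: real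
  assumes hol: "f holomorphic_on ball 0 1" and be: "0 \<le> b" "0 < e" "e < 1" and G: "0 \<le> G"
    and growth: "\<And>z. norm z < 1 \<Longrightarrow> norm (f z) \<le> G * (1 - norm z) powr (- b)"
    and t: "0 \<le> t" "t < 1"
  shows "norm (\<Sum>k<N. taylor_coeff f k * of_real t ^ k) \<le> 8 * G / e * ((1 - t) / 2) powr (- (b + e))"
proof -
  define \<rho> where "\<rho> = (1 + t) / 2"
  define d where "d = (1 - t) / 2"
  have d: "0 < d" "\<rho> - t = d" "1 - \<rho> = d" and rho: "0 < \<rho>" "\<rho> < 1" "1 / 2 \<le> \<rho>" "t < \<rho>"
    using t by (auto simp: \<rho>_def d_def field_simps)
  define \<gamma> where "\<gamma> = circlepath 0 \<rho>"
  define D where "D = (\<lambda>u. \<Sum>k<N. of_real t ^ k / u ^ Suc k :: complex)"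
  define I where "I = 2 * pi * \<i> * (\<Sum>k<N. taylor_coeff f k * of_real t ^ k)"
  have contf: "continuous_on (cball 0 \<rho>) f" and holf: "f holomorphic_on ball 0 \<rho>"
    using rho by (auto intro!: holomorphic_on_imp_continuous_on holomorphic_on_subset[OF hol])
  have "((\<lambda>u. f u / (u - 0) ^ (Suc k)) has_contour_integral ((2 * pi * \<i>) / (fact k) * (deriv ^^ k) f 0)) \<gamma>" for k
    unfolding \<gamma>_def using rho by (intro Cauchy_has_contour_integral_higher_derivative_circlepath contf holf) auto
  then have "((\<lambda>u. of_real t ^ k * (f u / (u - 0) ^ (Suc k))) has_contour_integral
      (of_real t ^ k * ((2 * pi * \<i>) / (fact k) * (deriv ^^ k) f 0))) \<gamma>" for k
    by (rule has_contour_integral_lmul)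
  then have "((\<lambda>u. \<Sum>k<N. of_real t ^ k * (f u / (u - 0) ^ (Suc k))) has_contour_integral
     (\<Sum>k<N. of_real t ^ k * ((2 * pi * \<i>) / (fact k) * (deriv ^^ k) f 0))) \<gamma>"
    by (intro has_contour_integral_sum) auto
  also have "(\<Sum>k<N. of_real t ^ k * ((2 * pi * \<i>) / (fact k) * (deriv ^^ k) f 0)) = I"
    by (simp add: I_def sum_distrib_left taylor_coeff_eq mult_ac)
  also have "(\<lambda>u. \<Sum>k<N. of_real t ^ k * (f u / (u - 0) ^ (Suc k))) = (\<lambda>u. f u * D u)"
    by (simp add: D_def sum_distrib_left mult_ac)
  finally have "((\<lambda>u. f u * D u) has_contour_integral I) \<gamma>" .
  then have hi: "((\<lambda>x. f (\<gamma> x) * D (\<gamma> x) * vector_derivative \<gamma> (at x within {0..1})) has_integral I) {0..1}"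
    by (simp add: has_contour_integral_def)
  define h where "h = (\<lambda>x::real. x powr (e - 1) + (1 - x) powr (e - 1))"
  define M where "M = 8 * pi * G * d powr (- b) * d powr (- e)"
  \<comment> \<open>At an end point the summand 0 powr (e - 1) has value 0 and the other one has value 1, so M * h is no upper
    bound there; the two points carry no mass and get a separate value.\<close>
  define g where "g = (\<lambda>x. if x = 0 \<or> x = 1 then 8 * pi * G * d powr (- b) / d else M * h x)"
  have h1: "((\<lambda>x. x powr (e - 1)) has_integral (1 / e)) {0..1}"
    using has_integral_powr_from_0[of "e - 1" 1] be by simp
  have h2: "((\<lambda>x. (1 - x) powr (e - 1)) has_integral (1 / e)) {0..1}"
  proof -
    have "((\<lambda>x. (- x) powr (e - 1)) has_integral (1 / e)) {-1..0}"
      using h1 has_integral_reflect_real[of "\<lambda>x. x powr (e - 1)" "1 / e" 1 0] by simp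
    then show ?thesis
      using has_integral_shift_real_ivl[of "\<lambda>x. (- x) powr (e - 1)" "1/e" "-1" 0 "-1"] by simp
  qed
  have "(h has_integral (1 / e + 1 / e)) {0..1}" unfolding h_def by (intro has_integral_add h1 h2)
  then have "((\<lambda>x. M * h x) has_integral (M * (2 / e))) {0..1}"
    using has_integral_mult_right[of h "1 / e + 1 / e" "{0..1}" M] by simp
  then have gi: "(g has_integral (M * (2 / e))) {0..1}"
    by (rule has_integral_spike_finite[of "{0, 1}", rotated 2]) (auto simp: g_def)
  have le: "norm (f (\<gamma> x) * D (\<gamma> x) * vector_derivative \<gamma> (at x within {0..1})) \<le> g x" if x: "x \<in> {0..1}" for x
  proof -
    have ng: "norm (\<gamma> x) = \<rho>" using rho by (simp add: \<gamma>_def circlepath norm_mult)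
    have vd: "norm (vector_derivative \<gamma> (at x within {0..1})) = 2 * pi * \<rho>"
      using x rho by (simp add: \<gamma>_def vector_derivative_circlepath01 norm_mult)
    have nf: "norm (f (\<gamma> x)) \<le> G * d powr (- b)" using growth[of "\<gamma> x"] ng rho d by simp
    have nD: "norm (D (\<gamma> x)) \<le> 2 / norm (\<gamma> x - of_real t)"
      unfolding D_def using t ng rho by (intro geometric_cauchy_kernel) auto
    have dist: "d \<le> norm (\<gamma> x - of_real t)" "min x (1 - x) / 2 \<le> norm (\<gamma> x - of_real t)"
      using circle_distance[of t \<rho> x] t rho x d by (auto simp: \<gamma>_def)
    define v where "v = norm (\<gamma> x - of_real t)"
    have v: "0 < v" using dist d by (auto simp: v_def)
    have "norm (f (\<gamma> x) * D (\<gamma> x) * vector_derivative \<gamma> (at x within {0..1})) \<le>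
       (G * d powr (- b)) * (2 / v) * (2 * pi * \<rho>)"
      unfolding norm_mult vd using nf nD rho G by (intro mult_right_mono mult_mono) (auto simp: v_def)
    also have "\<dots> \<le> (G * d powr (- b)) * (2 / v) * (2 * pi * 1)"
      using G v rho by (intro mult_left_mono) auto
    finally have le1: "norm (f (\<gamma> x) * D (\<gamma> x) * vector_derivative \<gamma> (at x within {0..1})) \<le>
       4 * pi * G * d powr (- b) * (1 / v)" by (simp add: mult_ac)
    also have "\<dots> \<le> g x"
    proof (cases "x = 0 \<or> x = 1")
      case True
      have "1 / v \<le> 2 / d" using dist d v by (intro frac_le) (auto simp: v_def)
      then have "4 * pi * G * d powr (- b) * (1 / v) \<le> 4 * pi * G * d powr (- b) * (2 / d)"
        using G by (intro mult_left_mono) auto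
      then show ?thesis using True by (auto simp: g_def)
    next
      case False
      define m where "m = min x (1 - x)"
      have m: "0 < m" using False x by (auto simp: m_def)
      have "1 / v = v powr (- e) * v powr (e - 1)" 
      proof -
        have "v powr (- e) * v powr (e - 1) = v powr (- 1)" by (simp only: powr_add[symmetric]) simp
        then show ?thesis using v by (simp add: powr_minus_divide)
      qed
      also have "\<dots> \<le> d powr (- e) * (m / 2) powr (e - 1)"
        using v d m be dist by (intro mult_mono powr_mono2') (auto simp: v_def m_def)
      also have "(m / 2) powr (e - 1) = m powr (e - 1) * 2 powr (1 - e)"
        using m by (simp add: powr_divide powr_minus_divide[of 2 "1 - e", simplified])
      also have "\<dots> \<le> h x * 2"
      proof (rule mult_mono)
        show "m powr (e - 1) \<le> h x" by (auto simp: m_def h_def min_def)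
        have "(2::real) powr (1 - e) \<le> 2 powr 1" using be by (intro powr_mono) auto
        then show "(2::real) powr (1 - e) \<le> 2" by simp
      qed (auto simp: h_def)
      finally have "1 / v \<le> d powr (- e) * (h x * 2)" by (simp add: mult_left_mono)
      then have "4 * pi * G * d powr (- b) * (1 / v) \<le> 4 * pi * G * d powr (- b) * (d powr (- e) * (h x * 2))"
        using G by (intro mult_left_mono) auto
      also have "\<dots> = M * h x" by (simp add: M_def)
      finally show ?thesis using False by (simp add: g_def)
    qed
    finally show ?thesis .
  qed
  have "norm (integral {0..1} (\<lambda>x. f (\<gamma> x) * D (\<gamma> x) * vector_derivative \<gamma> (at x within {0..1}))) \<le> integral {0..1} g"
    using hi gi le by (intro integral_norm_bound_integral) (auto intro: has_integral_integrable)
  then have "norm I \<le> M * (2 / e)" using hi gi by (simp add: integral_unique)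
  then have "2 * pi * norm (\<Sum>k<N. taylor_coeff f k * of_real t ^ k) \<le> 2 * pi * (8 * G / e * (d powr (- b) * d powr (- e)))"
    by (simp add: I_def norm_mult M_def mult_ac)
  then have "norm (\<Sum>k<N. taylor_coeff f k * of_real t ^ k) \<le> 8 * G / e * (d powr (- b) * d powr (- e))"
    by (subst (asm) mult_le_cancel_left_pos) auto
  also have "d powr (- b) * d powr (- e) = d powr (- (b + e))" by (simp flip: powr_add)
  finally show ?thesis by (simp add: d_def)
qed


section \<open>Integrals against the tail of a Carleson measure\<close>

text \<open>
Bernoulli's inequality for an arbitrary positive exponent: concavity for l \<le> 1, monotonicity in the exponent
for l > 1.
\<close>

lemma one_minus_powr_le:
  fixes u l :: real
  assumes "0 \<le> u" "u \<le> 1" "0 < l"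
  shows "(1 - u) powr l \<le> 1 - min 1 l * u"
proof (cases "l \<le> 1")
  case True
  show ?thesis
  proof (cases "u = 1")
    case False
    have "(1 - u) powr l * 1 powr (1 - l) \<le> l * (1 - u) + (1 - l) * 1"
      using True False assms by (intro Youngs_inequality_0) auto
    then show ?thesis using True by (simp add: min_def algebra_simps)
  qed (use True in auto)
next
  case False
  then have "(1 - u) powr l \<le> (1 - u) powr 1"
    using assms by (intro powr_mono') auto
  then show ?thesis using False assms by (simp add: min_def)
qed

text \<open>
The summand d^l / (r + d)^(l+1) of the dyadic estimate is dominated, up to a constant, by the difference of the bounded
increasing function h(x) = (x / (r + x))^l between x = d/2 and x = d. The sum over d, d/2, d/4, ...
therefore telescopes, without splitting it at d = r.
\<close>

lemma dyadic_telescope: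
  fixes d r l :: real
  assumes "0 < d" "0 < r" "0 < l"
  shows "d powr l * (r + d) powr (- (l + 1)) \<le>
    2 / (min 1 l * r) * ((d / (r + d)) powr l - (d / 2 / (r + d / 2)) powr l)"
proof -
  define m where "m = min 1 l"
  have m: "0 < m" using assms by (simp add: m_def)
  define h where "h = (d / (r + d)) powr l"
  \<comment> \<open>Halving d multiplies d / (r + d) by 1 - u.\<close>
  define u where "u = r / (2 * r + d)"
  have u: "0 \<le> u" "u \<le> 1" using assms by (auto simp: u_def field_simps)
  have "d / 2 / (r + d / 2) = (d / (r + d)) * (1 - u)"
    using assms by (simp add: u_def divide_simps)
  then have "(d / 2 / (r + d / 2)) powr l = h * (1 - u) powr l"
    unfolding h_def using assms u by (simp only:) (subst powr_mult, auto)
  also have "\<dots> \<le> h * (1 - m * u)"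
    using one_minus_powr_le[OF u assms(3)] by (intro mult_left_mono) (auto simp: m_def h_def)
  finally have "h - (d / 2 / (r + d / 2)) powr l \<ge> h * m * u" by (simp add: algebra_simps)
  moreover have "u \<ge> r / (2 * (r + d))"
    unfolding u_def using assms by (intro divide_left_mono) auto
  then have "h * m * u \<ge> h * m * (r / (2 * (r + d)))"
    using m by (intro mult_left_mono) (auto simp: h_def)
  ultimately have A: "h - (d / 2 / (r + d / 2)) powr l \<ge> h * m * (r / (2 * (r + d)))" by linarith
  have "(r + d) powr (- (l + 1)) = 1 / ((r + d) powr l * (r + d))"
    unfolding powr_minus_divide powr_add using assms by simp
  then have "d powr l * (r + d) powr (- (l + 1)) = h / (r + d)"
    using assms by (simp add: h_def powr_divide)
  also have "\<dots> = 2 / (m * r) * (h * m * (r / (2 * (r + d))))"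
    using assms m by (simp add: field_simps)
  also have "\<dots> \<le> 2 / (m * r) * (h - (d / 2 / (r + d / 2)) powr l)"
    using A m assms by (intro mult_left_mono) auto
  finally show ?thesis by (simp add: m_def h_def)
qed

lemma dyadic_sum_le:
  fixes d r l :: real
  assumes "0 < d" "0 < r" "0 < l"
  shows "(\<Sum>j<N. (d / 2 ^ j) powr l * (r + d / 2 ^ j) powr (- (l + 1))) \<le> 2 / (min 1 l * r)"
proof -
  define h where "h = (\<lambda>j. (d / 2 ^ j / (r + d / 2 ^ j)) powr l)"
  have "(\<Sum>j<N. (d / 2 ^ j) powr l * (r + d / 2 ^ j) powr (- (l + 1))) \<le>
     (\<Sum>j<N. 2 / (min 1 l * r) * (h j - h (Suc j)))"
  proof (rule sum_mono)
    fix j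
    show "(d / 2 ^ j) powr l * (r + d / 2 ^ j) powr (- (l + 1)) \<le> 2 / (min 1 l * r) * (h j - h (Suc j))"
      using dyadic_telescope[of "d / 2 ^ j" r l] assms by (simp add: h_def mult.commute)
  qed
  also have "\<dots> = 2 / (min 1 l * r) * (h 0 - h N)"
    unfolding sum_distrib_left[symmetric] by (simp add: sum_lessThan_telescope')
  also have "\<dots> \<le> 2 / (min 1 l * r) * 1"
  proof (rule mult_left_mono)
    have "h 0 \<le> 1" using assms unfolding h_def
      by (intro powr_le1) auto
    then show "h 0 - h N \<le> 1" by (simp add: h_def add_increasing2 diff_le_eq)
    show "0 \<le> 2 / (min 1 l * r)" using assms by simp
  qed
  finally show ?thesis by simp
qed

text \<open>
The factor 2^b comes from the ratio of 1 - t at neighbouring dyadic points, 4^(l+1) from replacing 1 - t r by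
a sum of 1 - r and a dyadic distance, and 2 / min 1 l from the telescoping sum.
\<close>

definition carleson_const :: "real \<Rightarrow> real \<Rightarrow> real" where
  "carleson_const b l = 2 powr b * 4 powr (l + 1) * 2 / min 1 l"

locale unit_interval_measure = finite_measure \<mu> for \<mu> :: "real measure" +
  assumes sets_mu: "sets \<mu> = sets (restrict_space borel {0..<1})"
begin

lemma space_mu: "space \<mu> = {0..<1}"
  using sets_eq_imp_space_eq[OF sets_mu] by (simp add: space_restrict_space)

lemma tail_sets: "0 \<le> t \<Longrightarrow> {t..<1} \<in> sets \<mu>"
  unfolding sets_mu by (auto simp: sets_restrict_space image_iff intro!: bexI[of _ "{t..<1}"])

lemma continuous_measurable_mu:
  fixes f :: "real \<Rightarrow> 'b :: topological_space"
  shows "continuous_on {0..<1} f \<Longrightarrow> f \<in> borel_measurable \<mu>"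
  by (subst measurable_cong_sets[OF sets_mu refl]) (rule borel_measurable_continuous_on_restrict)

text \<open>
On the block between two consecutive points t_j = 1 - (1 - d) / 2^j an increasing F is at most its value at
the right end, and the mass of the block is at most that of the tail beginning at its left end.
\<close>

lemma dyadic_tail_bound:
  fixes F :: "real \<Rightarrow> real"
  assumes F: "F \<in> borel_measurable \<mu>"
    and mono: "\<And>x y. 0 \<le> x \<Longrightarrow> x \<le> y \<Longrightarrow> y < 1 \<Longrightarrow> F x \<le> F y" and F0: "0 \<le> F 0"
    and d: "0 \<le> d" "d < 1" 
    and tail: "\<And>t. d \<le> t \<Longrightarrow> t < 1 \<Longrightarrow> measure \<mu> {t..<1} \<le> K * (1 - t) powr s"
  shows "(\<integral>\<^sup>+t. ennreal (F t) * indicator {d..<1} t \<partial>\<mu>) \<le>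
    (\<Sum>j. ennreal (F (1 - (1 - d) / 2 ^ Suc j) * (K * ((1 - d) / 2 ^ j) powr s)))"
proof -
  define T where "T = (\<lambda>j. 1 - (1 - d) / 2 ^ j)"
  have T: "d \<le> T j" "T j < 1" for j
    using d mult_left_mono[of 1 "2^j" "1-d"] by (auto simp: T_def divide_simps algebra_simps)
  have T0: "0 \<le> T j" for j using T d order_trans by blast
  have Fn: "0 \<le> F x" if "0 \<le> x" "x < 1" for x using mono[of 0 x] F0 that by linarith
  \<comment> \<open>The block that contains t contributes one term which is already large enough.\<close>
  have pt: "ennreal (F t) * indicator {d..<1} t \<le> (\<Sum>j. ennreal (F (T (Suc j))) * indicator {T j..<1} t)" for t
  proof (cases "t \<in> {d..<1}")
    case True
    have "\<exists>n. t < T n"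
    proof -
      obtain n where "(1 - d) / (1 - t) < 2 ^ n" using real_arch_pow[of 2 "(1-d)/(1-t)"] by auto
      then have "t < T n" using True by (simp add: T_def field_simps)
      then show ?thesis by blast
    qed
    define n where "n = (LEAST n. t < T n)"
    have n: "t < T n" unfolding n_def using \<open>\<exists>n. t < T n\<close> by (rule LeastI_ex)
    have "T 0 = d" by (simp add: T_def)
    then obtain j where j: "n = Suc j" using n True by (cases n) auto
    then have "\<not> t < T j" using not_less_Least[of j "\<lambda>n. t < T n"] n_def by auto
    then have "ennreal (F t) * indicator {d..<1} t \<le> ennreal (F (T (Suc j))) * indicator {T j..<1} t"
      using True n j d T[of "Suc j"] by (auto intro!: ennreal_leI mono)
    also have "\<dots> \<le> (\<Sum>j. ennreal (F (T (Suc j))) * indicator {T j..<1} t)"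
    proof -
      define G where "G = (\<lambda>j. ennreal (F (T (Suc j))) * indicator {T j..<1} t)"
      have "G j \<le> suminf G" using sum_le_suminf[OF summableI, of "{j}" G] by simp
      then show ?thesis by (simp add: G_def)
    qed
    finally show ?thesis .
  qed auto
  have "(\<integral>\<^sup>+t. ennreal (F t) * indicator {d..<1} t \<partial>\<mu>) \<le>
        (\<integral>\<^sup>+t. (\<Sum>j. ennreal (F (T (Suc j))) * indicator {T j..<1} t) \<partial>\<mu>)"
    by (intro nn_integral_mono pt)
  also have "\<dots> = (\<Sum>j. \<integral>\<^sup>+t. ennreal (F (T (Suc j))) * indicator {T j..<1} t \<partial>\<mu>)"
    using tail_sets[OF T0] by (intro nn_integral_suminf) auto
  also have "\<dots> = (\<Sum>j. ennreal (F (T (Suc j))) * emeasure \<mu> {T j..<1})"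
    using tail_sets[OF T0] by (simp add: nn_integral_cmult_indicator)
  also have "\<dots> \<le> (\<Sum>j. ennreal (F (T (Suc j)) * (K * ((1 - d) / 2 ^ j) powr s)))"
  proof (intro suminf_le summableI)
    fix j
    have "ennreal (F (T (Suc j))) * emeasure \<mu> {T j..<1} = ennreal (F (T (Suc j)) * measure \<mu> {T j..<1})"
      using Fn[OF T0 T(2)] by (simp add: emeasure_eq_measure ennreal_mult)
    also have "\<dots> \<le> ennreal (F (T (Suc j)) * (K * ((1 - d) / 2 ^ j) powr s))"
      using tail[OF T(1) T(2), of j] Fn[OF T0 T(2), of "Suc j"]
      by (intro ennreal_leI mult_left_mono) (auto simp: T_def)
    finally show "ennreal (F (T (Suc j))) * emeasure \<mu> {T j..<1} \<le> ennreal (F (T (Suc j)) * (K * ((1 - d) / 2 ^ j) powr s))" .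
  qed
  finally show ?thesis by (simp add: T_def)
qed

text \<open>
The key estimate. Only the tails beyond d enter, so K may be taken small when \<mu> is vanishing Carleson; with
r = 0 it says that (1 - t)^(-b) is integrable.
\<close>

lemma carleson_kernel_bound:
  fixes b l K d r :: real
  assumes "0 \<le> b" "0 < l" "0 \<le> K" "0 \<le> d" "d < 1" "0 \<le> r" "r < 1"
    and tail: "\<And>t. d \<le> t \<Longrightarrow> t < 1 \<Longrightarrow> measure \<mu> {t..<1} \<le> K * (1 - t) powr (b + l)"
  shows "(\<integral>\<^sup>+t. ennreal ((1 - t) powr (-b) * (1 - t * r) powr (- (l + 1))) * indicator {d..<1} t \<partial>\<mu>)
     \<le> ennreal (carleson_const b l * K / (1 - r))"
proof -
  define F where "F = (\<lambda>t. (1 - t) powr (-b) * (1 - t * r) powr (- (l + 1)))"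
  define D where "D = (\<lambda>j::nat. (1 - d) / 2 ^ j)"
  define c where "c = K * (2 powr b * 4 powr (l + 1))"
  have D: "0 < D j" "D j \<le> 1" for j
    using assms order_trans[of "1 - d" 1 "2 ^ j"] by (auto simp: D_def divide_le_eq)
  have pos: "1 - t * r > 0" if "0 \<le> t" "t < 1" for t
    using mult_strict_mono'[of t 1 r 1] that assms by auto
  have dyad: "F (1 - (1 - d) / 2 ^ Suc j) * (K * ((1 - d) / 2 ^ j) powr (b + l)) \<le>
     c * (D j powr l * (1 - r + D j) powr (- (l + 1)))" for j
  proof -
    have eq: "1 - (1 - d) / 2 ^ Suc j = 1 - D j / 2" by (simp add: D_def)
    have "r * (D j / 2) \<ge> 0" "(1 - r) * (1 - D j / 2) \<ge> 0" using D[of j] assms by auto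
    \<comment> \<open>1 - t r dominates both 1 - t and 1 - r, hence also a multiple of their sum.\<close>
    then have le: "(1 - r + D j) / 4 \<le> 1 - (1 - D j / 2) * r"
      using D[of j] by (simp add: field_simps)
    have "F (1 - D j / 2) \<le> (D j / 2) powr (-b) * ((1 - r + D j) / 4) powr (- (l + 1))"
      unfolding F_def using le D[of j] assms by (auto intro!: mult_left_mono powr_mono2')
    also have "\<dots> = 2 powr b * 4 powr (l + 1) * (D j powr (-b) * (1 - r + D j) powr (- (l + 1)))"
      using D[of j] assms
      by (simp add: powr_divide powr_minus[of 2] powr_minus[of 4] inverse_eq_divide
          del: minus_add_distrib)
    finally have "F (1 - D j / 2) * (K * D j powr (b + l)) \<le>
      2 powr b * 4 powr (l + 1) * (D j powr (-b) * (1 - r + D j) powr (- (l + 1))) * (K * D j powr (b + l))"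
      using assms by (intro mult_right_mono) auto
    also have "\<dots> = c * ((D j powr (-b) * D j powr (b + l)) * (1 - r + D j) powr (- (l + 1)))"
      by (simp add: c_def)
    also have "D j powr (-b) * D j powr (b + l) = D j powr l"
      using D[of j] by (simp flip: powr_add)
    finally show ?thesis unfolding eq by (simp add: D_def)
  qed
  have "continuous_on {0..<1} F"
    unfolding F_def using pos by (intro continuous_intros) (auto simp: less_imp_neq)
  then have meas: "F \<in> borel_measurable \<mu>" by (rule continuous_measurable_mu)
  have mono: "F x \<le> F y" if "0 \<le> x" "x \<le> y" "y < 1" for x y
    unfolding F_def using that assms pos[of y] mult_right_mono[of x y r]
    by (intro mult_mono powr_mono2') auto
  have "(\<integral>\<^sup>+t. ennreal (F t) * indicator {d..<1} t \<partial>\<mu>) \<le>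
    (\<Sum>j. ennreal (F (1 - (1 - d) / 2 ^ Suc j) * (K * ((1 - d) / 2 ^ j) powr (b + l))))"
    using tail by (intro dyadic_tail_bound meas mono) (auto simp: assms F_def)
  also have "\<dots> \<le> ennreal (carleson_const b l * K / (1 - r))"
  proof (intro suminf_le_const summableI)
    fix N
    have F0: "0 \<le> F x" for x by (simp add: F_def)
    have "(\<Sum>j<N. ennreal (F (1 - (1 - d) / 2 ^ Suc j) * (K * ((1 - d) / 2 ^ j) powr (b + l)))) \<le>
       (\<Sum>j<N. ennreal (c * (D j powr l * (1 - r + D j) powr (- (l + 1)))))"
      by (intro sum_mono ennreal_leI dyad)
    also have "\<dots> = ennreal (\<Sum>j<N. c * (D j powr l * (1 - r + D j) powr (- (l + 1))))"
      using assms by (intro sum_ennreal) (auto simp: c_def)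
    also have "\<dots> \<le> ennreal (c * (2 / (min 1 l * (1 - r))))"
      unfolding sum_distrib_left[symmetric] D_def using assms
      by (intro ennreal_leI mult_left_mono dyadic_sum_le) (auto simp: c_def)
    also have "c * (2 / (min 1 l * (1 - r))) = carleson_const b l * K / (1 - r)"
      by (simp add: c_def carleson_const_def)
    finally show "(\<Sum>j<N. ennreal (F (1 - (1 - d) / 2 ^ Suc j) * (K * ((1 - d) / 2 ^ j) powr (b + l)))) \<le>
       ennreal (carleson_const b l * K / (1 - r))" .
  qed
  finally show ?thesis by (simp add: F_def)
qed

end


section \<open>Cauchy transforms of densities on the unit interval\<close>

text \<open>
The Taylor coefficients of (1 - w)^(-\<beta>); for \<beta> = \<alpha> + 1 they are the Gamma quotients in the definition of the
Hankel operator.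
\<close>

definition binom_coeff :: "real \<Rightarrow> nat \<Rightarrow> real" where
  "binom_coeff \<beta> n = pochhammer \<beta> n / fact n"

lemma binom_coeff_nonneg: "0 < \<beta> \<Longrightarrow> 0 \<le> binom_coeff \<beta> n"
  by (simp add: binom_coeff_def pochhammer_nonneg)

lemma binom_coeff_Gamma:
  assumes "\<alpha> > -1"
  shows "Gamma (real n + 1 + \<alpha>) / (Gamma (real n + 1) * Gamma (\<alpha> + 1)) = binom_coeff (\<alpha> + 1) n"
proof -
  have "\<alpha> + 1 \<notin> \<int>\<^sub>\<le>\<^sub>0" using assms by (auto elim!: nonpos_Ints_cases)
  then have "pochhammer (\<alpha> + 1) n = Gamma (\<alpha> + 1 + real n) / Gamma (\<alpha> + 1)"
    by (rule pochhammer_Gamma)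
  moreover have "Gamma (real n + 1) = fact n" by (simp add: Gamma_fact add.commute)
  ultimately show ?thesis by (simp add: binom_coeff_def add_ac)
qed

text \<open>
The coefficient form of the rule that the derivative of (1 - w)^(-\<beta>) is \<beta> (1 - w)^(-\<beta>-1).
\<close>

lemma diffs_binom_coeff: "real (Suc n) * binom_coeff \<beta> (Suc n) = \<beta> * binom_coeff (\<beta> + 1) n"
  by (simp add: binom_coeff_def pochhammer_rec field_simps del: of_nat_Suc)

lemma binom_coeff_sums:
  fixes w :: complex
  assumes "norm w < 1"
  shows "(\<lambda>n. of_real (binom_coeff \<beta> n) * w ^ n) sums ((1 - w) powr of_real (- \<beta>))"
proof -
  have "(\<lambda>n. (of_real (- \<beta>) gchoose n) * (- w) ^ n) sums (1 + (- w)) powr of_real (- \<beta>)"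
    using assms by (intro gen_binomial_complex) auto
  moreover have "(of_real (- \<beta>) gchoose n) * (- w) ^ n = of_real (binom_coeff \<beta> n) * w ^ n" for n
    by (simp add: gbinomial_pochhammer binom_coeff_def pochhammer_of_real power_minus[of w])
  ultimately show ?thesis by simp
qed

lemma binom_coeff_summable:
  assumes "0 < \<beta>" "0 \<le> x" "x < 1"
  shows "summable (\<lambda>n. binom_coeff \<beta> n * x ^ n)"
proof -
  have "summable (\<lambda>n. of_real (binom_coeff \<beta> n) * (of_real x :: complex) ^ n)"
    using assms by (intro sums_summable[OF binom_coeff_sums]) auto
  then have "summable (\<lambda>n. complex_of_real (binom_coeff \<beta> n * x ^ n))" by simp
  then show ?thesis by (simp only: summable_of_real_iff)
qed

lemma one_minus_mult_pos:
  fixes z :: complex and t :: real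
  assumes "0 \<le> t" "t \<le> 1" "norm z < 1"
  shows "0 < 1 - t * norm z" "1 - t * norm z \<le> norm (1 - of_real t * z)" "0 < Re (1 - of_real t * z)"
proof -
  have "t * norm z \<le> norm z" using mult_right_mono[of t 1 "norm z"] assms by simp
  then show 1: "0 < 1 - t * norm z" using assms by linarith
  show "1 - t * norm z \<le> norm (1 - of_real t * z)"
    using norm_triangle_ineq2[of 1 "of_real t * z"] assms by (simp add: norm_mult)
  have "Re (of_real t * z) \<le> norm (of_real t * z)" by (rule complex_Re_le_cmod)
  then show "0 < Re (1 - of_real t * z)" using 1 assms by (simp add: norm_mult)
qed

lemma norm_kernel_le:
  fixes z :: complex and t :: real
  assumes "0 \<le> t" "t \<le> 1" "norm z < 1" "0 \<le> \<beta>"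
  shows "norm ((1 - of_real t * z) powr of_real (- \<beta>)) \<le> (1 - t * norm z) powr (- \<beta>)"
  using one_minus_mult_pos[OF assms(1-3)] assms(4)
  by (simp add: norm_powr_real_powr' powr_mono2' del: of_real_minus)

context unit_interval_measure
begin

text \<open>
The Cauchy transform of the complex measure g d\<mu>, of fractional order \<beta>.
\<close>

definition cauchy_op :: "real \<Rightarrow> (real \<Rightarrow> complex) \<Rightarrow> complex \<Rightarrow> complex" where
  "cauchy_op \<beta> g z = (LINT t|\<mu>. g t * (1 - of_real t * z) powr of_real (- \<beta>))"

lemma kernel_measurable [measurable]:
  fixes z :: complex
  assumes "norm z < 1"
  shows "(\<lambda>t. (1 - of_real t * z) powr of_real \<beta>) \<in> borel_measurable \<mu>"
proof (rule continuous_measurable_mu)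
  have "1 - of_real t * z \<notin> \<real>\<^sub>\<le>\<^sub>0" if "t \<in> {0..<1}" for t :: real
    using one_minus_mult_pos(3)[of t z] that assms by (auto simp: complex_nonpos_Reals_iff)
  moreover have "continuous_on (- \<real>\<^sub>\<le>\<^sub>0) (\<lambda>w. w powr complex_of_real \<beta>)"
    by (intro holomorphic_on_imp_continuous_on holomorphic_intros) auto
  ultimately show "continuous_on {0..<1} (\<lambda>t. (1 - complex_of_real t * z) powr of_real \<beta>)"
    by (elim continuous_on_compose2) (auto intro!: continuous_intros)
qed

lemma integrable_bounded_mult:
  fixes g h :: "real \<Rightarrow> complex"
  assumes "integrable \<mu> g" "h \<in> borel_measurable \<mu>" "\<And>t. 0 \<le> t \<Longrightarrow> t < 1 \<Longrightarrow> norm (h t) \<le> B"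
  shows "integrable \<mu> (\<lambda>t. g t * h t)"
proof (rule Bochner_Integration.integrable_bound)
  show "integrable \<mu> (\<lambda>t. B * norm (g t))" using assms by auto
  show "(\<lambda>t. g t * h t) \<in> borel_measurable \<mu>" using assms by auto
  show "AE t in \<mu>. norm (g t * h t) \<le> norm (B * norm (g t))"
  proof (rule AE_I2)
    fix t assume "t \<in> space \<mu>"
    then have t: "norm (h t) \<le> B" using assms(3) by (simp add: space_mu)
    then have "0 \<le> B" using norm_ge_zero order_trans by blast
    then show "norm (g t * h t) \<le> norm (B * norm (g t))"
      using t mult_right_mono[of "norm (h t)" B "norm (g t)"] by (simp add: norm_mult mult.commute)
  qed
qed

lemma integrable_kernel:
  fixes g :: "real \<Rightarrow> complex"
  assumes "integrable \<mu> g" "norm z < 1" "0 \<le> \<beta>"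
  shows "integrable \<mu> (\<lambda>t. g t * (1 - of_real t * z) powr of_real (- \<beta>))"
proof (rule integrable_bounded_mult[OF assms(1)])
  show "(\<lambda>t. (1 - complex_of_real t * z) powr of_real (- \<beta>)) \<in> borel_measurable \<mu>"
    using assms(2) by (rule kernel_measurable)
  fix t :: real assume t: "0 \<le> t" "t < 1"
  have "norm ((1 - of_real t * z) powr of_real (- \<beta>)) \<le> (1 - t * norm z) powr (- \<beta>)"
    using t assms by (intro norm_kernel_le) auto
  also have "\<dots> \<le> (1 - norm z) powr (- \<beta>)"
    using t assms mult_right_mono[of t 1 "norm z"] by (intro powr_mono2') auto
  finally show "norm ((1 - of_real t * z) powr of_real (- \<beta>)) \<le> (1 - norm z) powr (- \<beta>)" .
qed

lemma integrable_mult_power: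
  fixes g :: "real \<Rightarrow> complex"
  assumes "integrable \<mu> g"
  shows "integrable \<mu> (\<lambda>t. g t * of_real t ^ n)"
  by (rule integrable_bounded_mult[OF assms, where B = 1])
    (auto intro!: continuous_measurable_mu continuous_intros simp: norm_power power_le_one)

lemma cauchy_op_cong:
  "(\<And>t. 0 \<le> t \<Longrightarrow> t < 1 \<Longrightarrow> g t = h t) \<Longrightarrow> cauchy_op \<beta> g z = cauchy_op \<beta> h z"
  unfolding cauchy_op_def by (rule Bochner_Integration.integral_cong) (auto simp: space_mu)

lemma cauchy_op_diff:
  assumes "integrable \<mu> g" "integrable \<mu> h" "norm z < 1" "0 \<le> \<beta>"
  shows "cauchy_op \<beta> (\<lambda>t. g t - h t) z = cauchy_op \<beta> g z - cauchy_op \<beta> h z"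
  unfolding cauchy_op_def left_diff_distrib
  by (rule Bochner_Integration.integral_diff[OF integrable_kernel[OF assms(1,3,4)] integrable_kernel[OF assms(2,3,4)]])

text \<open>
Expanding the kernel gives the power series whose coefficients are moments of g d\<mu>, weighted
by binom_coeff: the shape of the Hankel operator.
\<close>

lemma cauchy_op_sums:
  fixes g :: "real \<Rightarrow> complex"
  assumes g: "integrable \<mu> g" and z: "norm z < 1" and b: "0 < \<beta>"
  shows "(\<lambda>n. of_real (binom_coeff \<beta> n) * (LINT t|\<mu>. g t * of_real t ^ n) * z ^ n) sums cauchy_op \<beta> g z"
proof -
  define f where "f = (\<lambda>n t. (of_real (binom_coeff \<beta> n) * z ^ n) * (g t * of_real t ^ n))"
  have int: "integrable \<mu> (f n)" for n
    unfolding f_def by (intro integrable_mult_right integrable_mult_power g)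
  have nf: "norm (f n t) \<le> norm (g t) * (binom_coeff \<beta> n * norm z ^ n)" if "t \<in> space \<mu>" for n t
  proof -
    have "norm (f n t) = (norm (g t) * (binom_coeff \<beta> n * norm z ^ n)) * t ^ n"
      using that b by (simp add: f_def norm_mult norm_power binom_coeff_nonneg space_mu)
    also have "\<dots> \<le> (norm (g t) * (binom_coeff \<beta> n * norm z ^ n)) * 1"
      using that b by (intro mult_left_mono power_le_one) (auto simp: space_mu binom_coeff_nonneg)
    finally show ?thesis by simp
  qed
  have sm: "summable (\<lambda>n. binom_coeff \<beta> n * norm z ^ n)"
    using z b by (intro binom_coeff_summable) auto
  have eq: "(\<Sum>n. f n t) = g t * (1 - of_real t * z) powr of_real (- \<beta>)" if t: "t \<in> space \<mu>" for t
  proof -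
    have "norm (of_real t * z) < 1"
      using one_minus_mult_pos(1)[of t z] t z by (simp add: norm_mult space_mu)
    from sums_mult[OF binom_coeff_sums[OF this, of \<beta>], of "g t"]
    have "(\<lambda>n. f n t) sums (g t * (1 - of_real t * z) powr of_real (- \<beta>))"
      by (simp add: f_def power_mult_distrib mult_ac)
    then show ?thesis by (simp add: sums_iff)
  qed
  have "(\<lambda>n. integral\<^sup>L \<mu> (f n)) sums (LINT t|\<mu>. (\<Sum>n. f n t))"
  proof (rule sums_integral[OF int])
    show "AE t in \<mu>. summable (\<lambda>n. norm (f n t))"
      using nf by (intro AE_I2 summable_comparison_test'[OF summable_mult[OF sm]]) auto
    show "summable (\<lambda>n. LINT t|\<mu>. norm (f n t))"
    proof (rule summable_comparison_test'[OF summable_mult[OF sm]])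
      fix n
      have "(LINT t|\<mu>. norm (f n t)) \<le> (LINT t|\<mu>. norm (g t) * (binom_coeff \<beta> n * norm z ^ n))"
        using g int nf by (intro integral_mono) auto
      then show "norm (LINT t|\<mu>. norm (f n t)) \<le> (LINT t|\<mu>. norm (g t)) * (binom_coeff \<beta> n * norm z ^ n)"
        by simp
    qed
  qed
  also have "(LINT t|\<mu>. (\<Sum>n. f n t)) = cauchy_op \<beta> g z"
    unfolding cauchy_op_def by (intro Bochner_Integration.integral_cong refl eq)
  also have "(\<lambda>n. integral\<^sup>L \<mu> (f n)) =
     (\<lambda>n. of_real (binom_coeff \<beta> n) * (LINT t|\<mu>. g t * of_real t ^ n) * z ^ n)"
    unfolding f_def by (simp only: integral_mult_right_zero) (simp add: mult_ac)
  finally show ?thesis .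
qed

lemma cauchy_op_has_derivative:
  fixes g :: "real \<Rightarrow> complex"
  assumes g: "integrable \<mu> g" and z: "norm z < 1" and b: "0 < \<beta>"
  shows "(cauchy_op \<beta> g has_field_derivative
           of_real \<beta> * cauchy_op (\<beta> + 1) (\<lambda>t. g t * of_real t) z) (at z)"
proof -
  define c where "c = (\<lambda>n. complex_of_real (binom_coeff \<beta> n) * (LINT t|\<mu>. g t * of_real t ^ n))"
  have sm: "(\<lambda>n. c n * w ^ n) sums cauchy_op \<beta> g w" if "norm w < 1" for w
    using cauchy_op_sums[OF g that b] by (simp add: c_def)
  have "((\<lambda>z. \<Sum>n. c n * z^n) has_field_derivative (\<Sum>n. diffs c n * z^n)) (at z)"
    using sm z by (intro termdiffs_strong'[where K = 1]) (auto simp: sums_iff)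
  moreover have "(\<Sum>n. diffs c n * z^n) = of_real \<beta> * cauchy_op (\<beta> + 1) (\<lambda>t. g t * of_real t) z"
  proof (rule sums_unique[symmetric])
    have d: "diffs c n = of_real \<beta> * (of_real (binom_coeff (\<beta> + 1) n) * (LINT t|\<mu>. (g t * of_real t) * of_real t ^ n))" for n
    proof -
      have "diffs c n = of_real (real (Suc n) * binom_coeff \<beta> (Suc n)) * (LINT t|\<mu>. (g t * of_real t) * of_real t ^ n)"
        by (simp add: diffs_def c_def mult_ac del: of_nat_Suc)
      then show ?thesis unfolding diffs_binom_coeff by simp
    qed
    have i: "integrable \<mu> (\<lambda>t. g t * of_real t)" using integrable_mult_power[OF g, of 1] by simp
    show "(\<lambda>n. diffs c n * z^n) sums (of_real \<beta> * cauchy_op (\<beta> + 1) (\<lambda>t. g t * of_real t) z)"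
      using sums_mult[OF cauchy_op_sums[OF i z, of "\<beta> + 1"], of "of_real \<beta>"] b
      unfolding d by (simp add: mult_ac)
  qed
  ultimately have "((\<lambda>z. \<Sum>n. c n * z^n) has_field_derivative
      of_real \<beta> * cauchy_op (\<beta> + 1) (\<lambda>t. g t * of_real t) z) (at z)" by simp
  then show ?thesis
  proof (rule has_field_derivative_transform_within_open)
    show "open (ball (0::complex) 1)" "z \<in> ball 0 1" using z by auto
    show "(\<Sum>n. c n * w^n) = cauchy_op \<beta> g w" if "w \<in> ball 0 1" for w
      using sm[of w] that by (simp add: sums_iff)
  qed
qed

lemma cauchy_op_holomorphic:
  assumes "integrable \<mu> g" "0 < \<beta>"
  shows "cauchy_op \<beta> g holomorphic_on ball 0 1"
  unfolding holomorphic_on_open[OF open_ball]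
  using cauchy_op_has_derivative[OF assms(1) _ assms(2)] by (metis mem_ball_0)

lemma deriv_cauchy_op:
  assumes "integrable \<mu> g" "norm z < 1" "0 < \<beta>"
  shows "deriv (cauchy_op \<beta> g) z = of_real \<beta> * cauchy_op (\<beta> + 1) (\<lambda>t. g t * of_real t) z"
  by (rule DERIV_imp_deriv[OF cauchy_op_has_derivative[OF assms]])

lemma norm_cauchy_op_le:
  fixes g :: "real \<Rightarrow> complex"
  assumes "integrable \<mu> g" "norm z < 1" "0 \<le> \<beta>"
  shows "ennreal (norm (cauchy_op \<beta> g z)) \<le>
    (\<integral>\<^sup>+t. ennreal (norm (g t) * (1 - t * norm z) powr (- \<beta>)) \<partial>\<mu>)"
proof -
  have "ennreal (norm (cauchy_op \<beta> g z)) \<le>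
      (\<integral>\<^sup>+t. ennreal (norm (g t * (1 - of_real t * z) powr of_real (- \<beta>))) \<partial>\<mu>)"
    unfolding cauchy_op_def by (rule integral_norm_bound_ennreal[OF integrable_kernel[OF assms]])
  also have "\<dots> \<le> (\<integral>\<^sup>+t. ennreal (norm (g t) * (1 - t * norm z) powr (- \<beta>)) \<partial>\<mu>)"
  proof (intro nn_integral_mono ennreal_leI)
    fix t assume "t \<in> space \<mu>"
    then show "norm (g t * (1 - of_real t * z) powr of_real (- \<beta>)) \<le> norm (g t) * (1 - t * norm z) powr (- \<beta>)"
      unfolding norm_mult using assms by (intro mult_left_mono norm_kernel_le) (auto simp: space_mu)
  qed
  finally show ?thesis .
qed

end


section \<open>Bloch norms of Cauchy transforms\<close>

lemma bloch_normI:
  assumes hol: "F holomorphic_on ball 0 1" and z0: "norm (F 0) \<le> E"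
    and d: "\<And>z. norm z < 1 \<Longrightarrow> (1 - (norm z)\<^sup>2) * norm (deriv F z) \<le> E'"
  shows "F \<in> bloch" "bloch_norm F \<le> E + E'"
proof -
  show "F \<in> bloch" using hol d by (auto simp: bloch_def intro!: bdd_aboveI2[where M = E'])
  have "(SUP z\<in>ball 0 1. (1 - (norm z)\<^sup>2) * norm (deriv F z)) \<le> E'"
    using d by (intro cSUP_least) auto
  then show "bloch_norm F \<le> E + E'" using z0 by (simp add: bloch_norm_def)
qed

text \<open>
Functions are total on the plane, so identities that hold only on the disc have to be transported to the Bloch
norm separately.
\<close>

lemma bloch_cong:
  assumes eq: "\<And>z. norm z < 1 \<Longrightarrow> F z = G z"
  shows "F \<in> bloch \<longleftrightarrow> G \<in> bloch" "bloch_norm F = bloch_norm G"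
proof -
  have d: "deriv F z = deriv G z" if "z \<in> ball 0 1" for z
    using eq that by (intro deriv_cong_ev eventually_nhds_in_open[THEN eventually_mono, of "ball 0 1"] refl) auto
  have "F holomorphic_on ball 0 1 \<longleftrightarrow> G holomorphic_on ball 0 1"
    using eq by (intro holomorphic_cong) auto
  moreover have im: "(\<lambda>z. (1 - (norm z)\<^sup>2) * norm (deriv F z)) ` ball 0 1 = (\<lambda>z. (1 - (norm z)\<^sup>2) * norm (deriv G z)) ` ball 0 1"
    using d by (intro image_cong) auto
  ultimately show "F \<in> bloch \<longleftrightarrow> G \<in> bloch" by (simp add: bloch_def)
  show "bloch_norm F = bloch_norm G" using eq[of 0] unfolding bloch_norm_def im by simp
qed

lemma deriv_le_bloch_norm:
  assumes "F \<in> bloch" "norm z < 1"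
  shows "(1 - (norm z)\<^sup>2) * norm (deriv F z) \<le> bloch_norm F"
proof -
  have "(1 - (norm z)\<^sup>2) * norm (deriv F z) \<le> (SUP z\<in>ball 0 1. (1 - (norm z)\<^sup>2) * norm (deriv F z))"
    using assms by (intro cSUP_upper) (auto simp: bloch_def)
  then show ?thesis by (simp add: bloch_norm_def add_increasing)
qed

lemma bloch_norm_nonneg: "F \<in> bloch \<Longrightarrow> 0 \<le> bloch_norm F"
  using deriv_le_bloch_norm[of F 0] by (auto intro: order_trans[of _ "norm (deriv F 0)"])

lemma bloch_diff:
  assumes F: "F \<in> bloch" and G: "G \<in> bloch"
  shows "(\<lambda>z. F z - G z) \<in> bloch"
proof (rule bloch_normI(1))
  have hol: "F holomorphic_on ball 0 1" "G holomorphic_on ball 0 1" using F G by (auto simp: bloch_def)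
  then show "(\<lambda>z. F z - G z) holomorphic_on ball 0 1" by (intro holomorphic_intros)
  show "norm (F 0 - G 0) \<le> norm (F 0 - G 0)" ..
  fix z :: complex assume z: "norm z < 1"
  have "deriv (\<lambda>z. F z - G z) z = deriv F z - deriv G z"
    using hol z by (intro deriv_diff) (auto intro: holomorphic_on_imp_differentiable_at)
  then have "(1 - (norm z)\<^sup>2) * norm (deriv (\<lambda>z. F z - G z) z) \<le> (1 - (norm z)\<^sup>2) * (norm (deriv F z) + norm (deriv G z))"
    using z by (intro mult_left_mono) (auto simp: norm_triangle_ineq4 abs_square_le_1 power_le_one)
  also have "\<dots> \<le> bloch_norm F + bloch_norm G"
    using deriv_le_bloch_norm[OF F z] deriv_le_bloch_norm[OF G z] by (simp add: distrib_left)
  finally show "(1 - (norm z)\<^sup>2) * norm (deriv (\<lambda>z. F z - G z) z) \<le> bloch_norm F + bloch_norm G" .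
qed

lemma deriv_diff_bloch:
  assumes "F \<in> bloch" "G \<in> bloch" "norm z < 1"
  shows "(1 - (norm z)\<^sup>2) * norm (deriv F z - deriv G z) \<le> bloch_norm (\<lambda>z. F z - G z)"
proof -
  have "deriv (\<lambda>z. F z - G z) z = deriv F z - deriv G z"
    using assms by (intro deriv_diff) (auto simp: bloch_def intro: holomorphic_on_imp_differentiable_at)
  then show ?thesis using deriv_le_bloch_norm[OF bloch_diff[OF assms(1,2)] assms(3)] by simp
qed

context unit_interval_measure
begin

lemma integrable_of_growth:
  fixes g :: "real \<Rightarrow> 'b :: {banach, second_countable_topology}"
  assumes b: "0 \<le> b" "0 < l" "0 \<le> K" and g: "g \<in> borel_measurable \<mu>"
    and tail: "\<And>t. 0 \<le> t \<Longrightarrow> t < 1 \<Longrightarrow> measure \<mu> {t..<1} \<le> K * (1 - t) powr (b + l)"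
    and le: "\<And>t. 0 \<le> t \<Longrightarrow> t < 1 \<Longrightarrow> norm (g t) \<le> G * (1 - t) powr (- b)"
  shows "integrable \<mu> g"
proof -
  have "(\<integral>\<^sup>+t. ennreal ((1 - t) powr (- b) * (1 - t * 0) powr (- (l + 1))) * indicator {0..<1} t \<partial>\<mu>) < \<infinity>"
    by (rule le_less_trans[OF carleson_kernel_bound[OF b _ _ _ _ tail]]) auto
  also have "(\<integral>\<^sup>+t. ennreal ((1 - t) powr (- b) * (1 - t * 0) powr (- (l + 1))) * indicator {0..<1} t \<partial>\<mu>) =
     (\<integral>\<^sup>+t. ennreal (norm ((1 - t) powr (- b))) \<partial>\<mu>)"
    by (intro nn_integral_cong) (auto simp: space_mu)
  finally have "integrable \<mu> (\<lambda>t. (1 - t) powr (- b))"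
    by (intro integrableI_bounded) (auto intro!: continuous_measurable_mu continuous_intros)
  then have "integrable \<mu> (\<lambda>t. G * (1 - t) powr (- b))" by simp
  then show ?thesis
    by (rule Bochner_Integration.integrable_bound[OF _ g])
       (use le in \<open>auto intro!: AE_I2 simp: space_mu intro: order_trans[OF _ abs_ge_self]\<close>)
qed

text \<open>
The data are split at d: a uniform bound e near the origin, where the kernel is bounded, and the growth bound
near 1, where the tails of \<mu> decide. For compactness e and K are both small.
\<close>

lemma kernel_split_bound:
  fixes h :: "real \<Rightarrow> complex"
  assumes b: "0 \<le> b" "0 < l" "0 \<le> K" and d: "0 \<le> d" "d < 1" and r: "0 \<le> r" "r < 1"
    and eG: "0 \<le> e" "0 \<le> G"
    and tail: "\<And>t. d \<le> t \<Longrightarrow> t < 1 \<Longrightarrow> measure \<mu> {t..<1} \<le> K * (1 - t) powr (b + l)"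
    and small: "\<And>t. 0 \<le> t \<Longrightarrow> t < d \<Longrightarrow> norm (h t) \<le> e"
    and growth: "\<And>t. d \<le> t \<Longrightarrow> t < 1 \<Longrightarrow> norm (h t) \<le> G * (1 - t) powr (- b)"
  shows "(\<integral>\<^sup>+t. ennreal (norm (h t) * (1 - t * r) powr (- (l + 1))) \<partial>\<mu>) \<le>
     ennreal (e * (1 - d) powr (- (l + 1)) * measure \<mu> (space \<mu>) + G * carleson_const b l * K / (1 - r))"
proof -
  define c where "c = e * (1 - d) powr (- (l + 1))"
  define F where "F = (\<lambda>t. (1 - t) powr (- b) * (1 - t * r) powr (- (l + 1)))"
  have pos: "0 < 1 - t * r" if "0 \<le> t" "t < 1" for t
    using mult_strict_mono'[of t 1 r 1] that r by auto
  have "continuous_on {0..<1} F"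
    unfolding F_def using pos by (intro continuous_intros) (auto simp: less_imp_neq)
  then have [measurable]: "F \<in> borel_measurable \<mu>" by (rule continuous_measurable_mu)
  have [measurable]: "{d..<1} \<in> sets \<mu>" using d by (intro tail_sets)
  have cc: "0 \<le> carleson_const b l" using b by (simp add: carleson_const_def)
  have "(\<integral>\<^sup>+t. ennreal (norm (h t) * (1 - t * r) powr (- (l + 1))) \<partial>\<mu>) \<le>
    (\<integral>\<^sup>+t. ennreal c + ennreal G * (ennreal (F t) * indicator {d..<1} t) \<partial>\<mu>)"
  proof (rule nn_integral_mono)
    fix t assume "t \<in> space \<mu>"
    then have t: "0 \<le> t" "t < 1" by (auto simp: space_mu)
    show "ennreal (norm (h t) * (1 - t * r) powr (- (l + 1))) \<le> ennreal c + ennreal G * (ennreal (F t) * indicator {d..<1} t)"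
    proof (cases "t < d")
      case True
      have "t * r \<le> d * 1" using True t r by (intro mult_mono) auto
      then have "norm (h t) * (1 - t * r) powr (- (l + 1)) \<le> c"
        unfolding c_def using small[OF t(1) True] d b eG by (intro mult_mono powr_mono2') auto
      then show ?thesis using True by (simp add: ennreal_leI)
    next
      case False
      have "norm (h t) * (1 - t * r) powr (- (l + 1)) \<le> (G * (1 - t) powr (- b)) * (1 - t * r) powr (- (l + 1))"
        using False t by (intro mult_right_mono growth) auto
      also have "\<dots> = G * F t" by (simp add: F_def)
      finally have "ennreal (norm (h t) * (1 - t * r) powr (- (l + 1))) \<le> ennreal G * ennreal (F t)"
        using eG by (simp add: ennreal_leI F_def flip: ennreal_mult)
      then show ?thesis using False t by (simp add: add_increasing)
    qed
  qed
  also have "\<dots> = ennreal c * emeasure \<mu> (space \<mu>) + ennreal G * (\<integral>\<^sup>+t. ennreal (F t) * indicator {d..<1} t \<partial>\<mu>)"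
    by (subst nn_integral_add) (auto simp: nn_integral_cmult)
  also have "\<dots> \<le> ennreal c * emeasure \<mu> (space \<mu>) + ennreal G * ennreal (carleson_const b l * K / (1 - r))"
    unfolding F_def using tail by (intro add_left_mono mult_left_mono carleson_kernel_bound b d r) auto
  also have "\<dots> = ennreal (c * measure \<mu> (space \<mu>) + G * carleson_const b l * K / (1 - r))"
    using eG b r cc by (simp add: emeasure_eq_measure c_def ennreal_mult[symmetric] ennreal_plus[symmetric] mult_ac del: ennreal_plus)
  finally show ?thesis by (simp add: c_def)
qed

text \<open>
The derivative has the kernel exponent l + 1, for which the preceding bound loses exactly one power of
1 - r; this is the weight of the Bloch norm. The value at 0 is the case r = 0 of the same bound.
\<close>

lemma cauchy_op_bloch:
  fixes h :: "real \<Rightarrow> complex"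
  assumes b: "0 \<le> b" "0 < l" "0 \<le> K" and d: "0 \<le> d" "d < 1" 
    and eG: "0 \<le> e" "0 \<le> G" and int: "integrable \<mu> h"
    and tail: "\<And>t. d \<le> t \<Longrightarrow> t < 1 \<Longrightarrow> measure \<mu> {t..<1} \<le> K * (1 - t) powr (b + l)"
    and small: "\<And>t. 0 \<le> t \<Longrightarrow> t < d \<Longrightarrow> norm (h t) \<le> e"
    and growth: "\<And>t. d \<le> t \<Longrightarrow> t < 1 \<Longrightarrow> norm (h t) \<le> G * (1 - t) powr (- b)"
  shows "cauchy_op l h \<in> bloch"
    and "bloch_norm (cauchy_op l h) \<le>
      (1 + 2 * l) * (e * (1 - d) powr (- (l + 1)) * measure \<mu> (space \<mu>) + G * carleson_const b l * K)"
proof -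
  define c where "c = e * (1 - d) powr (- (l + 1)) * measure \<mu> (space \<mu>)"
  define k where "k = G * carleson_const b l * K"
  have c0: "0 \<le> c" using eG by (simp add: c_def)
  have k0: "0 \<le> k" using eG b by (simp add: k_def carleson_const_def)
  have nn: "ennreal x \<le> ennreal (c + k / (1 - r)) \<Longrightarrow> x \<le> c + k / (1 - r)" if "0 \<le> r" "r < 1" for x r
    using c0 k0 that by (subst (asm) ennreal_le_iff) auto
  note split = kernel_split_bound[OF b d _ _ eG tail small growth, folded c_def k_def]
  have at0: "norm (cauchy_op l h 0) \<le> c + k"
  proof -
    have "ennreal (norm (cauchy_op l h 0)) \<le> (\<integral>\<^sup>+t. ennreal (norm (h t) * (1 - t * norm (0::complex)) powr (- l)) \<partial>\<mu>)"
      using b by (intro norm_cauchy_op_le int) auto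
    also have "\<dots> = (\<integral>\<^sup>+t. ennreal (norm (h t) * (1 - t * 0) powr (- (l + 1))) \<partial>\<mu>)" by simp
    also have "\<dots> \<le> ennreal (c + k / (1 - 0))" by (rule split) auto
    finally show ?thesis using nn[of 0] by simp
  qed
  have der: "(1 - (norm z)\<^sup>2) * norm (deriv (cauchy_op l h) z) \<le> 2 * l * (c + k)" if z: "norm z < 1" for z
  proof -
    define r where "r = norm z"
    have r: "0 \<le> r" "r < 1" using z by (auto simp: r_def)
    have "ennreal (norm (cauchy_op (l + 1) (\<lambda>t. h t * of_real t) z)) \<le>
       (\<integral>\<^sup>+t. ennreal (norm (h t * of_real t) * (1 - t * r) powr (- (l + 1))) \<partial>\<mu>)"
      unfolding r_def using b integrable_mult_power[OF int, of 1] by (intro norm_cauchy_op_le z) auto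
    also have "\<dots> \<le> (\<integral>\<^sup>+t. ennreal (norm (h t) * (1 - t * r) powr (- (l + 1))) \<partial>\<mu>)"
      by (intro nn_integral_mono ennreal_leI mult_right_mono)
         (auto simp: norm_mult space_mu intro!: mult_left_le)
    also have "\<dots> \<le> ennreal (c + k / (1 - r))" by (rule split[OF r])
    finally have "norm (cauchy_op (l + 1) (\<lambda>t. h t * of_real t) z) \<le> c + k / (1 - r)" by (rule nn[OF r])
    then have "norm (deriv (cauchy_op l h) z) \<le> l * (c + k / (1 - r))"
      using deriv_cauchy_op[OF int z, of l] b by (simp add: norm_mult mult_left_mono)
    then have "(1 - r\<^sup>2) * norm (deriv (cauchy_op l h) z) \<le> (1 - r\<^sup>2) * (l * (c + k / (1 - r)))"
      using r by (intro mult_left_mono) (auto simp: power_le_one)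
    also have "\<dots> = l * (1 + r) * ((1 - r) * c + k)"
      using r by (simp add: power2_eq_square field_simps)
    also have "\<dots> \<le> l * 2 * (1 * c + k)"
      using r b c0 k0 by (intro mult_mono add_right_mono mult_right_mono) auto
    finally show ?thesis by (simp add: r_def mult_ac)
  qed
  note * = bloch_normI[OF cauchy_op_holomorphic[OF int b(2)] at0 der]
  show "cauchy_op l h \<in> bloch" by (rule *(1))
  have "bloch_norm (cauchy_op l h) \<le> (c + k) + 2 * l * (c + k)" by (rule *(2))
  then show "bloch_norm (cauchy_op l h) \<le>
      (1 + 2 * l) * (e * (1 - d) powr (- (l + 1)) * measure \<mu> (space \<mu>) + G * carleson_const b l * K)"
    by (simp add: c_def k_def algebra_simps)
qed

end


section \<open>The two operators as Cauchy transforms\<close>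

context unit_interval_measure
begin

text \<open>
The partial sums of the moment series are the integrals of t^n times the Taylor sections of f, so an
integrable majorant of the sections sums the series by dominated convergence, even when it does not
converge absolutely.
\<close>

lemma hankel_eq_cauchy_op:
  fixes f :: "complex \<Rightarrow> complex" and W :: "real \<Rightarrow> real"
  assumes al: "- 1 < \<alpha>" and hol: "f holomorphic_on ball 0 1" and W: "integrable \<mu> W"
    and le: "\<And>N t. 0 \<le> t \<Longrightarrow> t < 1 \<Longrightarrow> norm (\<Sum>k<N. taylor_coeff f k * of_real t ^ k) \<le> W t"
  shows "f \<in> hankel_dom \<alpha> \<mu>"
    and "integrable \<mu> (\<lambda>t. f (of_real t))"
    and "norm z < 1 \<Longrightarrow> hankel \<alpha> \<mu> f z = cauchy_op (\<alpha> + 1) (\<lambda>t. f (of_real t)) z"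
proof -
  define S where "S = (\<lambda>N t. \<Sum>k<N. taylor_coeff f k * of_real t ^ k)"
  have contf: "continuous_on {0..<1} (\<lambda>t. f (of_real t))"
    by (intro continuous_on_compose2[OF holomorphic_on_imp_continuous_on[OF hol]] continuous_intros) auto
  have fm: "(\<lambda>t. f (of_real t)) \<in> borel_measurable \<mu>" by (rule continuous_measurable_mu[OF contf])
  have Sf: "(\<lambda>N. S N t) \<longlonglongrightarrow> f (of_real t)" if "0 \<le> t" "t < 1" for t
    using taylor_sums[OF hol, of "of_real t"] that by (simp add: S_def sums_def)
  have fW: "norm (f (of_real t)) \<le> W t" if "0 \<le> t" "t < 1" for t
    using Sf[OF that] le[OF that] by (intro LIMSEQ_le_const2[OF tendsto_norm[OF Sf[OF that]]]) (auto simp: S_def)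
  show int: "integrable \<mu> (\<lambda>t. f (of_real t))"
    using fW by (intro Bochner_Integration.integrable_bound[OF W fm] AE_I2)
      (auto simp: space_mu intro: order_trans[OF _ abs_ge_self])
  have sums: "(\<lambda>k. of_real (moment \<mu> (n + k)) * taylor_coeff f k) sums (LINT t|\<mu>. f (of_real t) * of_real t ^ n)" for n
  proof -
    have ip: "integrable \<mu> (\<lambda>t. complex_of_real (t ^ j))" for j
      using integrable_mult_power[of "\<lambda>_. 1" j] by simp
    have "(LINT t|\<mu>. S N t * of_real t ^ n) = (\<Sum>k<N. of_real (moment \<mu> (n + k)) * taylor_coeff f k)" for N
    proof -
      have "(LINT t|\<mu>. S N t * of_real t ^ n) = (LINT t|\<mu>. (\<Sum>k<N. taylor_coeff f k * complex_of_real (t ^ (n + k))))"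
      proof -
        have "S N t * of_real t ^ n = (\<Sum>k<N. taylor_coeff f k * complex_of_real (t ^ (n + k)))" for t
          unfolding S_def sum_distrib_right by (rule sum.cong) (auto simp: power_add)
        then show ?thesis by presburger
      qed
      also have "\<dots> = (\<Sum>k<N. LINT t|\<mu>. taylor_coeff f k * complex_of_real (t ^ (n + k)))"
        by (intro Bochner_Integration.integral_sum integrable_mult_right ip)
      also have "\<dots> = (\<Sum>k<N. of_real (moment \<mu> (n + k)) * taylor_coeff f k)"
        by (simp only: integral_mult_right_zero integral_complex_of_real moment_def mult.commute)
      finally show ?thesis .
    qed
    moreover have "(\<lambda>N. LINT t|\<mu>. S N t * of_real t ^ n) \<longlonglongrightarrow> (LINT t|\<mu>. f (of_real t) * of_real t ^ n)"
    proof (rule integral_dominated_convergence[where w = W])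
      show "(\<lambda>t. f (of_real t) * of_real t ^ n) \<in> borel_measurable \<mu>"
        using contf by (intro continuous_measurable_mu continuous_intros)
      show "(\<lambda>t. S N t * of_real t ^ n) \<in> borel_measurable \<mu>" for N
        unfolding S_def by (intro continuous_measurable_mu continuous_intros)
      show "integrable \<mu> W" by (rule W)
      show "AE t in \<mu>. (\<lambda>N. S N t * of_real t ^ n) \<longlonglongrightarrow> f (of_real t) * of_real t ^ n"
        using Sf by (intro AE_I2 tendsto_intros) (auto simp: space_mu)
      show "AE t in \<mu>. norm (S N t * of_real t ^ n) \<le> W t" for N
      proof (rule AE_I2)
        fix t assume "t \<in> space \<mu>"
        then have t: "0 \<le> t" "t < 1" by (auto simp: space_mu)
        have "norm (S N t * of_real t ^ n) \<le> norm (S N t) * 1"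
          unfolding norm_mult using t by (intro mult_left_mono) (auto simp: norm_power power_le_one)
        also have "\<dots> \<le> W t" using le[OF t] by (simp add: S_def)
        finally show "norm (S N t * of_real t ^ n) \<le> W t" .
      qed
    qed
    ultimately show ?thesis by (simp add: sums_def)
  qed
  have coeff: "hankel_coeff \<alpha> \<mu> f n = of_real (binom_coeff (\<alpha> + 1) n) * (LINT t|\<mu>. f (of_real t) * of_real t ^ n)" for n
    unfolding hankel_coeff_def binom_coeff_Gamma[OF al] using sums[of n] by (simp add: sums_iff)
  have ps: "(\<lambda>n. hankel_coeff \<alpha> \<mu> f n * z ^ n) sums cauchy_op (\<alpha> + 1) (\<lambda>t. f (of_real t)) z" if "norm z < 1" for z
    unfolding coeff using al by (intro cauchy_op_sums int that) auto
  show "f \<in> hankel_dom \<alpha> \<mu>" using sums ps by (auto simp: hankel_dom_def sums_iff)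
  show "hankel \<alpha> \<mu> f z = cauchy_op (\<alpha> + 1) (\<lambda>t. f (of_real t)) z" if "norm z < 1" for z
    using ps[OF that] by (simp add: hankel_def sums_iff)
qed

lemma int_op_eq_cauchy_op:
  assumes "integrable \<mu> (\<lambda>t. complex_of_real (norm (f (of_real t))))" "- 1 < \<alpha>"
  shows "f \<in> int_op_dom \<alpha> \<mu>"
    and "int_op \<alpha> \<mu> f z = cauchy_op (\<alpha> + 1) (\<lambda>t. of_real (norm (f (of_real t)))) z"
proof -
  have eq: "int_kernel \<alpha> f z t = of_real (norm (f (of_real t))) * (1 - of_real t * z) powr of_real (- (\<alpha> + 1))" for z t
    unfolding int_kernel_def of_real_minus by (simp only: powr_minus_divide) simp
  show "f \<in> int_op_dom \<alpha> \<mu>"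
    unfolding int_op_dom_def
  proof safe
    fix z :: complex assume "z \<in> ball 0 1"
    then show "integrable \<mu> (int_kernel \<alpha> f z)"
      using integrable_kernel[OF assms(1), of z "\<alpha> + 1"] assms(2) unfolding eq[abs_def] by simp
  qed
  show "int_op \<alpha> \<mu> f z = cauchy_op (\<alpha> + 1) (\<lambda>t. of_real (norm (f (of_real t)))) z"
    by (simp only: int_op_def cauchy_op_def eq)
qed

end


section \<open>Test functions concentrating at a boundary point\<close>

text \<open>
A multiple, bounded above and below uniformly in a, of the p-th root of the squared normalised Bergman
kernel at a, where b = 2 / p.
\<close>

definition test_fun :: "real \<Rightarrow> real \<Rightarrow> complex \<Rightarrow> complex" where
  "test_fun b a z = of_real ((1 - a) powr b) * (1 - of_real a * z) powr of_real (- (2 * b))"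

text \<open>
The restriction of the test function to the radius, as a real function.
\<close>

definition test_profile :: "real \<Rightarrow> real \<Rightarrow> real \<Rightarrow> real" where
  "test_profile b a t = (1 - a) powr b * (1 - a * t) powr (- (2 * b))"

lemma test_fun_real:
  assumes "0 \<le> a" "a < 1" "0 \<le> t" "t < 1"
  shows "test_fun b a (of_real t) = of_real (test_profile b a t)"
proof -
  have "a * t \<le> 1" using mult_mono[of a 1 t 1] assms by simp
  then show ?thesis
    using powr_of_real[of "1 - a * t" "- (2 * b)"] by (simp add: test_fun_def test_profile_def)
qed

lemma test_fun_holomorphic:
  assumes "0 < a" "a < 1"
  shows "test_fun b a holomorphic_on ball 0 (1 / a)"
proof -
  have "1 - of_real a * z \<notin> \<real>\<^sub>\<le>\<^sub>0" if "z \<in> ball 0 (1 / a)" for z :: complex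
  proof -
    have "Re (of_real a * z) \<le> norm (of_real a * z)" by (rule complex_Re_le_cmod)
    also have "\<dots> < 1" using that assms by (simp add: norm_mult field_simps)
    finally show ?thesis by (auto simp: complex_nonpos_Reals_iff)
  qed
  then show ?thesis unfolding test_fun_def by (intro holomorphic_intros) auto
qed

lemma ball_subset_test: "0 < a \<Longrightarrow> a < 1 \<Longrightarrow> ball (0::complex) 1 \<subseteq> ball 0 (1 / a)"
  by (intro subset_ball) (simp add: field_simps)

text \<open>
The test function is analytic across the unit circle, so its Taylor coefficients are absolutely summable and a
constant majorizes all sections. This sums the Hankel series for the test functions by
finiteness of \<mu> alone.
\<close>

lemma test_fun_partial_sums:
  assumes "0 < a" "a < 1"
  obtains W where "\<And>N t. 0 \<le> t \<Longrightarrow> t < 1 \<Longrightarrow>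
    norm (\<Sum>k<N. taylor_coeff (test_fun b a) k * of_real t ^ k) \<le> W"
proof -
  define c where "c = taylor_coeff (test_fun b a)"
  obtain w where w: "1 < w" "w < 1 / a" using assms dense[of 1 "1 / a"] by (auto simp: field_simps)
  have "summable (\<lambda>k. c k * of_real w ^ k)"
    using taylor_sums[OF test_fun_holomorphic[OF assms], of "of_real w" b] w by (auto simp: c_def sums_iff)
  from powser_insidea[OF this, of 1] have sm: "summable (\<lambda>k. norm (c k))" using w by simp
  show thesis
  proof (rule that)
    fix N and t :: real assume t: "0 \<le> t" "t < 1"
    have "norm (\<Sum>k<N. c k * of_real t ^ k) \<le> (\<Sum>k<N. norm (c k))"
      using t by (intro sum_norm_le) (auto simp: norm_mult norm_power power_le_one intro!: mult_left_le)
    also have "\<dots> \<le> (\<Sum>k. norm (c k))" by (intro sum_le_suminf sm) auto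
    finally show "norm (\<Sum>k<N. taylor_coeff (test_fun b a) k * of_real t ^ k) \<le> (\<Sum>k. norm (c k))"
      by (simp add: c_def)
  qed
qed

lemma nn_integral_arctan_kernel:
  fixes \<delta> :: real
  assumes "0 < \<delta>"
  shows "(\<integral>\<^sup>+u. ennreal (1 / (\<delta>\<^sup>2 + u\<^sup>2)) * indicator {-2..2} u \<partial>lborel) \<le> ennreal (pi / \<delta>)"
proof -
  define F where "F = (\<lambda>u. arctan (u / \<delta>) / \<delta>)"
  have "(\<integral>\<^sup>+u. ennreal (1 / (\<delta>\<^sup>2 + u\<^sup>2)) * indicator {-2..2} u \<partial>lborel) = ennreal (F 2 - F (-2))"
  proof (rule nn_integral_FTC_Icc)
    fix u :: real
    have "\<delta> * \<delta> * (1 + (u / \<delta>)\<^sup>2) = \<delta>\<^sup>2 + u\<^sup>2" using assms by (simp add: power2_eq_square field_simps)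
    then have "inverse (1 + (u / \<delta>)\<^sup>2) * (1 / \<delta>) / \<delta> = 1 / (\<delta>\<^sup>2 + u\<^sup>2)"
      by (simp add: divide_simps mult_ac)
    moreover have "(F has_real_derivative inverse (1 + (u / \<delta>)\<^sup>2) * (1 / \<delta>) / \<delta>) (at u)"
      unfolding F_def by (rule derivative_eq_intros refl | use assms in simp)+
    ultimately show "(F has_real_derivative 1 / (\<delta>\<^sup>2 + u\<^sup>2)) (at u)" by simp
  qed auto
  also have "F 2 - F (-2) \<le> pi / \<delta>"
    using arctan_ubound[of "2 / \<delta>"] assms by (simp add: F_def arctan_minus field_simps)
  finally show ?thesis by (simp add: ennreal_leI)
qed

text \<open>
Separating real and imaginary part turns the area integral of |1 - a z|^(-4) into a product of two
arctangent integrals, each of order 1 / \<delta>.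
\<close>

lemma kernel_norm_lower_bound:
  fixes z :: complex
  assumes a: "1 / 2 \<le> a" "a < 1" and z: "norm z < 1"
  defines "\<delta> \<equiv> 1 - a"
  shows "(\<delta>\<^sup>2 + (Re z - 1)\<^sup>2) * (\<delta>\<^sup>2 + (Im z)\<^sup>2) \<le> 16 * norm (1 - of_real a * z) powr 4"
proof -
  define n where "n = (norm (1 - of_real a * z))\<^sup>2"
  have n: "n = (1 - a * Re z)\<^sup>2 + (a * Im z)\<^sup>2" by (simp add: n_def cmod_power2)
  have re: "Re z < 1" using complex_Re_le_cmod[of z] z by linarith
  have "a * (1 - Re z) \<ge> 1 / 2 * (1 - Re z)" using a re by (intro mult_right_mono) auto
  then have lb: "\<delta> + (1 - Re z) / 2 \<le> 1 - a * Re z" by (simp add: \<delta>_def algebra_simps)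
  have d: "0 < \<delta>" using a by (simp add: \<delta>_def)
  have "\<delta>\<^sup>2 + ((1 - Re z) / 2)\<^sup>2 \<le> (\<delta> + (1 - Re z) / 2)\<^sup>2"
    using d re by (simp add: power2_sum)
  also have lb2: "\<dots> \<le> (1 - a * Re z)\<^sup>2" using lb d re by (intro power_mono) auto
  finally have 1: "\<delta>\<^sup>2 + ((1 - Re z) / 2)\<^sup>2 \<le> (1 - a * Re z)\<^sup>2" .
  have "((1 - Re z) / 2)\<^sup>2 = (Re z - 1)\<^sup>2 / 4" by (simp add: power2_eq_square field_simps)
  then have A: "\<delta>\<^sup>2 + (Re z - 1)\<^sup>2 \<le> 4 * n"
    using 1 n zero_le_power2[of \<delta>] zero_le_power2[of "a * Im z"] by linarith
  have "(1 / 2)\<^sup>2 * (Im z)\<^sup>2 \<le> a\<^sup>2 * (Im z)\<^sup>2" using a by (intro mult_right_mono power_mono) auto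
  then have "(Im z)\<^sup>2 / 4 \<le> (a * Im z)\<^sup>2" by (simp add: power_mult_distrib) (simp add: power2_eq_square)
  moreover have "\<delta>\<^sup>2 \<le> (1 - a * Re z)\<^sup>2" using 1 zero_le_power2[of "(1 - Re z) / 2"] by linarith
  ultimately have B: "\<delta>\<^sup>2 + (Im z)\<^sup>2 \<le> 4 * n"
    using n zero_le_power2[of \<delta>] by linarith
  have "(\<delta>\<^sup>2 + (Re z - 1)\<^sup>2) * (\<delta>\<^sup>2 + (Im z)\<^sup>2) \<le> (4 * n) * (4 * n)"
    using A B by (intro mult_mono) (auto simp: n_def)
  also have "\<dots> = 16 * norm (1 - of_real a * z) powr 4"
    by (cases "1 - of_real a * z = 0") (auto simp: n_def powr_numeral power2_eq_square power4_eq_xxxx)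
  finally show ?thesis .
qed

lemma test_fun_bergman:
  assumes p: "0 < p" and a: "1 / 2 \<le> a" "a < 1"
  shows "test_fun (2 / p) a \<in> bergman p" and "bergman_norm p (test_fun (2 / p) a) \<le> (16 * pi) powr (1 / p)"
proof -
  define \<delta> where "\<delta> = 1 - a"
  have d: "0 < \<delta>" using a by (simp add: \<delta>_def)
  let ?f = "test_fun (2 / p) a"
  define k where "k = (\<lambda>u::real. ennreal (1 / (\<delta>\<^sup>2 + u\<^sup>2)) * indicator {-2..2} u)"
  have [measurable]: "k \<in> borel_measurable borel" unfolding k_def by measurable
  have hol: "?f holomorphic_on ball 0 1"
    using a by (intro holomorphic_on_subset[OF test_fun_holomorphic ball_subset_test]) auto
  have eq: "norm (?f z) powr p = \<delta>\<^sup>2 / norm (1 - of_real a * z) powr 4" if "norm z < 1" for z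
  proof -
    have "norm ((1 - of_real a * z) powr of_real (- (2 * (2 / p)))) = norm (1 - of_real a * z) powr (- (4 / p))"
      by (subst norm_powr_real_powr') auto
    then have "norm (?f z) powr p = (\<delta> powr (2 / p) * norm (1 - of_real a * z) powr (- (4 / p))) powr p"
      by (simp only: test_fun_def norm_mult) (simp add: \<delta>_def)
    also have "\<dots> = \<delta> powr 2 * norm (1 - of_real a * z) powr (- 4)"
      using p d by (simp add: powr_mult powr_powr)
    finally show ?thesis using d by (simp add: powr_minus divide_inverse powr_numeral)
  qed
  have pt: "ennreal (norm (indicator (ball 0 1) z *\<^sub>R (norm (?f z) powr p))) \<le> ennreal (16 * \<delta>\<^sup>2) * (k (-1 + Re z) * k (Im z))" for z
  proof (cases "norm z < 1")
    case True
    have "0 < norm (1 - of_real a * z)" using one_minus_mult_pos[of a z] a True by auto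
    moreover have "0 < (\<delta>\<^sup>2 + (Re z - 1)\<^sup>2) * (\<delta>\<^sup>2 + (Im z)\<^sup>2)" using d by (simp add: add_pos_nonneg)
    ultimately have "\<delta>\<^sup>2 / norm (1 - of_real a * z) powr 4 \<le> 16 * \<delta>\<^sup>2 / ((\<delta>\<^sup>2 + (Re z - 1)\<^sup>2) * (\<delta>\<^sup>2 + (Im z)\<^sup>2))"
      using kernel_norm_lower_bound[OF a True] mult_left_mono[OF kernel_norm_lower_bound[OF a True], of "\<delta>\<^sup>2"]
      unfolding \<delta>_def[symmetric] by (simp add: field_simps)
    also have "\<dots> = 16 * \<delta>\<^sup>2 * ((1 / (\<delta>\<^sup>2 + (Re z - 1)\<^sup>2)) * (1 / (\<delta>\<^sup>2 + (Im z)\<^sup>2)))" by simp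
    finally have "ennreal (norm (?f z) powr p) \<le>
       ennreal (16 * \<delta>\<^sup>2 * ((1 / (\<delta>\<^sup>2 + (Re z - 1)\<^sup>2)) * (1 / (\<delta>\<^sup>2 + (Im z)\<^sup>2))))"
      using eq[OF True] by (simp add: ennreal_leI)
    also have "\<dots> = ennreal (16 * \<delta>\<^sup>2) * (ennreal (1 / (\<delta>\<^sup>2 + (Re z - 1)\<^sup>2)) * ennreal (1 / (\<delta>\<^sup>2 + (Im z)\<^sup>2)))"
      by (simp only: ennreal_mult zero_le_mult_iff zero_le_divide_iff add_nonneg_nonneg zero_le_power2 zero_le_one zero_le_numeral simp_thms)
    also have "\<dots> = ennreal (16 * \<delta>\<^sup>2) * (k (-1 + Re z) * k (Im z))"
    proof -
      have "-1 + Re z \<in> {-2..2}" "Im z \<in> {-2..2}"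
        using abs_Re_le_cmod[of z] abs_Im_le_cmod[of z] True by auto
      then show ?thesis by (simp add: k_def)
    qed
    finally show ?thesis using True by simp
  qed simp
  have meas: "(\<lambda>z. indicator (ball 0 1) z *\<^sub>R (norm (?f z) powr p)) \<in> borel_measurable borel"
  proof -
    define g where "g = (\<lambda>z. indicator (ball 0 1) z *\<^sub>R ?f z)"
    have [measurable]: "g \<in> borel_measurable borel" unfolding g_def
      by (intro borel_measurable_continuous_on_indicator holomorphic_on_imp_continuous_on hol) auto
    have "(\<lambda>z. norm (g z) powr p) \<in> borel_measurable borel" by measurable
    also have "(\<lambda>z. norm (g z) powr p) = (\<lambda>z. indicator (ball 0 1) z *\<^sub>R (norm (?f z) powr p))"
      by (auto simp: indicator_def g_def)
    finally show ?thesis .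
  qed
  have "(\<integral>\<^sup>+z. ennreal (norm (indicator (ball 0 1) z *\<^sub>R (norm (?f z) powr p))) \<partial>lborel) \<le>
     (\<integral>\<^sup>+z. ennreal (16 * \<delta>\<^sup>2) * (k (-1 + Re z) * k (Im z)) \<partial>lborel)"
    by (intro nn_integral_mono pt)
  also have "\<dots> = ennreal (16 * \<delta>\<^sup>2) * (\<integral>\<^sup>+z. k (-1 + Re z) * k (Im z) \<partial>lborel)"
    by (intro nn_integral_cmult) measurable
  also have "(\<integral>\<^sup>+z. k (-1 + Re z) * k (Im z) \<partial>lborel) = (\<integral>\<^sup>+x. \<integral>\<^sup>+y. k (-1 + x) * k y \<partial>lborel \<partial>lborel)"
  proof -
    have "(\<lambda>z. k (-1 + Re z) * k (Im z)) \<in> borel_measurable borel"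
      by (intro borel_measurable_times_ennreal measurable_compose[OF _ \<open>k \<in> borel_measurable borel\<close>])
        (auto intro!: borel_measurable_continuous_onI continuous_intros)
    then show ?thesis by (simp add: nn_integral_complex(1))
  qed
  also have "\<dots> = (\<integral>\<^sup>+x. k (-1 + x) \<partial>lborel) * (\<integral>\<^sup>+y. k y \<partial>lborel)"
    by (simp add: nn_integral_cmult nn_integral_multc)
  also have "(\<integral>\<^sup>+x. k (-1 + x) \<partial>lborel) = (\<integral>\<^sup>+y. k y \<partial>lborel)"
    using nn_integral_real_affine[of k 1 "-1"] by simp
  also have "ennreal (16 * \<delta>\<^sup>2) * ((\<integral>\<^sup>+y. k y \<partial>lborel) * (\<integral>\<^sup>+y. k y \<partial>lborel)) \<le>
      ennreal (16 * \<delta>\<^sup>2) * (ennreal (pi / \<delta>) * ennreal (pi / \<delta>))"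
    unfolding k_def using nn_integral_arctan_kernel[OF d] by (intro mult_left_mono mult_mono) auto
  also have "\<dots> = ennreal (16 * pi * pi)"
    using d by (simp add: power2_eq_square flip: ennreal_mult)
  finally have bound: "(\<integral>\<^sup>+z. ennreal (norm (indicator (ball 0 1) z *\<^sub>R (norm (?f z) powr p))) \<partial>lborel) \<le> ennreal (16 * pi * pi)" .
  then have "(\<integral>\<^sup>+z. ennreal (norm (indicator (ball 0 1) z *\<^sub>R (norm (?f z) powr p))) \<partial>lborel) < \<infinity>"
    by (rule le_less_trans) simp
  then have int: "integrable lborel (\<lambda>z. indicator (ball 0 1) z *\<^sub>R (norm (?f z) powr p))"
    using meas by (intro integrableI_bounded) auto
  then show "?f \<in> bergman p" using hol by (simp add: bergman_def set_integrable_def)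
  define J where "J = (LINT z:ball 0 1|lborel. norm (?f z) powr p)"
  have "ennreal J = (\<integral>\<^sup>+z. ennreal (norm (indicator (ball 0 1) z *\<^sub>R (norm (?f z) powr p))) \<partial>lborel)"
    unfolding J_def set_lebesgue_integral_def using int by (subst nn_integral_eq_integral[symmetric]) auto
  then have "ennreal J \<le> ennreal (16 * pi * pi)" using bound by simp
  then have J: "J \<le> 16 * pi * pi" by (subst (asm) ennreal_le_iff) auto
  have "0 \<le> J" unfolding J_def set_lebesgue_integral_def by (intro integral_nonneg_AE) auto
  then have "(J / pi) powr (1 / p) \<le> (16 * pi) powr (1 / p)"
    using J p by (intro powr_mono2) (auto simp: field_simps)
  then show "bergman_norm p ?f \<le> (16 * pi) powr (1 / p)" by (simp add: bergman_norm_def J_def)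
qed

text \<open>
The second bound is an integrable majorant independent of a; the third one tends to 0 with 1 - a for
fixed t.
\<close>

lemma test_profile_le:
  assumes "0 \<le> a" "a < 1" "0 \<le> t" "t < 1" "0 \<le> b"
  shows "0 \<le> test_profile b a t" "test_profile b a t \<le> (1 - t) powr (- b)"
    "test_profile b a t \<le> (1 - a) powr b * (1 - t) powr (- (2 * b))"
proof -
  show "0 \<le> test_profile b a t" by (simp add: test_profile_def)
  have at: "a * t \<le> a" "a * t \<le> t" using assms mult_left_mono[of t 1 a] mult_right_mono[of a 1 t] by auto
  have "test_profile b a t \<le> (1 - a * t) powr b * (1 - a * t) powr (- (2 * b))"
    unfolding test_profile_def using at assms by (intro mult_right_mono powr_mono2) auto
  also have "\<dots> = (1 - a * t) powr (- b)" by (simp flip: powr_add)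
  also have "\<dots> \<le> (1 - t) powr (- b)" using at assms by (intro powr_mono2') auto
  finally show "test_profile b a t \<le> (1 - t) powr (- b)" .
  show "test_profile b a t \<le> (1 - a) powr b * (1 - t) powr (- (2 * b))"
    unfolding test_profile_def using at assms by (intro mult_left_mono powr_mono2') auto
qed


section \<open>Compactness forces vanishing Carleson tails\<close>

context unit_interval_measure
begin

lemma test_profile_integrable:
  assumes a: "0 \<le> a" "a < 1" and b: "0 \<le> b"
  shows "integrable \<mu> (\<lambda>t. complex_of_real (test_profile b a t))"
proof -
  have at: "a * t \<le> a" if "0 \<le> t" "t < 1" for t using mult_left_mono[of t 1 a] that a by simp
  have "continuous_on {0..<1} (\<lambda>t. complex_of_real (test_profile b a t))"
    unfolding test_profile_def using at a by (intro continuous_intros) force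
  then have "(\<lambda>t. complex_of_real (test_profile b a t)) \<in> borel_measurable \<mu>" by (rule continuous_measurable_mu)
  moreover have "norm (complex_of_real (test_profile b a t)) \<le> (1 - a) powr b * (1 - a) powr (- (2 * b))"
    if "0 \<le> t" "t < 1" for t
    unfolding norm_of_real abs_of_nonneg[OF test_profile_le(1)[OF a that b]]
    using at[OF that] a b unfolding test_profile_def by (intro mult_left_mono powr_mono2') auto
  ultimately show ?thesis using integrable_bounded_mult[of "\<lambda>_. 1"] by fastforce
qed

text \<open>
At the real point a the integrand of the derivative is nonnegative, so the integral may be restricted to
[a,1), where 1 - a t \<le> 2 (1 - a) and t \<ge> 1/2.
\<close>

lemma test_deriv_lower_bound:
  assumes a: "1 / 2 \<le> a" "a < 1" and b: "0 \<le> b" "0 < l"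
  shows "l * 2 powr (- (2 * b + l + 2)) * (measure \<mu> {a..<1} / (1 - a) powr (b + l)) \<le>
     (1 - a\<^sup>2) * norm (deriv (cauchy_op l (\<lambda>t. of_real (test_profile b a t))) (of_real a))"
proof -
  define q where "q = (\<lambda>t. test_profile b a t * t * (1 - t * a) powr (- (l + 1)))"
  have a0: "0 \<le> a" using a by simp
  have na: "norm (complex_of_real a) < 1" using a by simp
  define h where "h = (\<lambda>t. complex_of_real (test_profile b a t))"
  have int: "integrable \<mu> h" unfolding h_def by (intro test_profile_integrable a0 a b)
  have int1: "integrable \<mu> (\<lambda>t. h t * of_real t)" using integrable_mult_power[OF int, of 1] by simp
  have eq: "h t * of_real t * (1 - of_real t * of_real a) powr of_real (- (l + 1)) = of_real (q t)"
    if "t \<in> space \<mu>" for t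
  proof -
    have "t * a \<le> 1" using that a mult_mono[of t 1 a 1] by (auto simp: space_mu)
    then have "(1 - complex_of_real t * of_real a) powr of_real (- (l + 1)) = of_real ((1 - t * a) powr (- (l + 1)))"
      using powr_of_real[of "1 - t * a" "- (l + 1)"] by simp
    then show ?thesis by (simp add: q_def h_def)
  qed
  have co: "cauchy_op (l + 1) (\<lambda>t. h t * of_real t) (of_real a) = of_real (LINT t|\<mu>. q t)"
    unfolding cauchy_op_def using eq
    by (subst integral_complex_of_real[symmetric], intro Bochner_Integration.integral_cong) auto
  have "integrable \<mu> (\<lambda>t. h t * of_real t * (1 - of_real t * of_real a) powr of_real (- (l + 1)))"
    using b by (intro integrable_kernel int1 na) auto
  then have "integrable \<mu> (\<lambda>t. complex_of_real (q t))"
    by (subst (asm) Bochner_Integration.integrable_cong[OF refl eq]) auto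
  then have qi: "integrable \<mu> q" using integrable_Re by fastforce
  define c where "c = 2 powr (- (2 * b + l + 2)) * (1 - a) powr (- (b + l + 1))"
  have qc: "c * indicator {a..<1} t \<le> q t" if "t \<in> space \<mu>" for t
  proof (cases "t \<in> {a..<1}")
    case True
    have "a * a \<le> t * a" using True a by (intro mult_right_mono) auto
    moreover have "0 \<le> (1 - a) * (1 - a)" by simp
    ultimately have up: "1 - t * a \<le> 2 * (1 - a)" by (simp add: algebra_simps)
    have lo: "0 < 1 - t * a" using True a mult_strict_mono'[of t 1 a 1] by auto
    have "c = (1 - a) powr b * (2 * (1 - a)) powr (- (2 * b)) * (1 / 2) * (2 * (1 - a)) powr (- (l + 1))"
    proof -
      have pm: "(2 * (1 - a)) powr x = 2 powr x * (1 - a) powr x" for x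
        by (rule powr_mult)
      have "(1 - a) powr b * (2 * (1 - a)) powr (- (2 * b)) * (1 / 2) * (2 * (1 - a)) powr (- (l + 1)) =
         (2 powr (- (2 * b)) * 2 powr (- 1) * 2 powr (- (l + 1))) *
         ((1 - a) powr b * (1 - a) powr (- (2 * b)) * (1 - a) powr (- (l + 1)))"
        unfolding pm by (simp add: powr_minus[of 2 1])
      also have "\<dots> = c"
      proof -
        have "- (2 * b) + - 1 + - (l + 1) = - (2 * b + l + 2)" "b + - (2 * b) + - (l + 1) = - (b + l + 1)" by auto
        then show ?thesis by (simp only: powr_add[symmetric] c_def)
      qed
      finally show ?thesis ..
    qed
    also have "\<dots> \<le> (1 - a) powr b * (1 - a * t) powr (- (2 * b)) * t * (1 - t * a) powr (- (l + 1))"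
      using up lo a b True by (intro mult_mono powr_mono2' order_refl) (auto simp: mult.commute)
    finally show ?thesis using True by (simp add: q_def test_profile_def)
  next
    case False
    then show ?thesis using that test_profile_le(1)[OF a0 a(2), of t b] b by (auto simp: q_def space_mu)
  qed
  have "c * measure \<mu> {a..<1} = (LINT t|\<mu>. c * indicator {a..<1} t)"
    using tail_sets[OF a0] by simp
  also have "\<dots> \<le> (LINT t|\<mu>. q t)"
    using tail_sets[OF a0] qc qi by (intro integral_mono) (auto simp: emeasure_eq_measure)
  finally have "l * (c * measure \<mu> {a..<1}) \<le> norm (deriv (cauchy_op l h) (of_real a))"
    using deriv_cauchy_op[OF int na b(2)] b co by (simp add: norm_mult mult_left_mono)
  moreover have "1 - a \<le> 1 - a\<^sup>2" using a power_le_one[of a 1] mult_right_mono[of a 1 a] by (simp add: power2_eq_square)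
  moreover have "0 \<le> l * (c * measure \<mu> {a..<1})" using b by (simp add: c_def)
  ultimately have "(1 - a) * (l * (c * measure \<mu> {a..<1})) \<le> (1 - a\<^sup>2) * norm (deriv (cauchy_op l h) (of_real a))"
    using a by (intro mult_mono) auto
  moreover have "(1 - a) * c = 2 powr (- (2 * b + l + 2)) / (1 - a) powr (b + l)"
  proof -
    have "(1 - a) powr (- (b + l)) = (1 - a) powr 1 * (1 - a) powr (- (b + l + 1))"
      by (simp only: powr_add[symmetric]) simp
    then have "(1 - a) * (1 - a) powr (- (b + l + 1)) = 1 / (1 - a) powr (b + l)"
      using a unfolding powr_minus_divide[of "1 - a" "b + l"] by simp
    moreover have "(1 - a) * c = 2 powr (- (2 * b + l + 2)) * ((1 - a) * (1 - a) powr (- (b + l + 1)))"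
      by (simp only: c_def mult.left_commute)
    ultimately show ?thesis by simp
  qed
  then have "(1 - a) * (l * (c * measure \<mu> {a..<1})) =
     l * 2 powr (- (2 * b + l + 2)) * (measure \<mu> {a..<1} / (1 - a) powr (b + l))"
  proof -
    assume eq: "(1 - a) * c = 2 powr (- (2 * b + l + 2)) / (1 - a) powr (b + l)"
    have "(1 - a) * (l * (c * measure \<mu> {a..<1})) = l * ((1 - a) * c) * measure \<mu> {a..<1}" by simp
    then show ?thesis unfolding eq by simp
  qed
  ultimately show ?thesis by (simp add: h_def)
qed

lemma test_op_tendsto_zero:
  fixes A :: "nat \<Rightarrow> real"
  assumes A: "\<And>k. 0 \<le> A k" "\<And>k. A k < 1" "A \<longlonglongrightarrow> 1" and b: "0 < b" "0 < l" "0 \<le> K" and \<beta>: "0 \<le> \<beta>"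
    and tail: "\<And>t. 0 \<le> t \<Longrightarrow> t < 1 \<Longrightarrow> measure \<mu> {t..<1} \<le> K * (1 - t) powr (b + l)"
    and z: "norm z < 1"
  shows "(\<lambda>k. cauchy_op \<beta> (\<lambda>t. of_real (test_profile b (A k) t) * of_real t) z) \<longlonglongrightarrow> 0"
proof -
  define w where "w = (\<lambda>t. (1 - t) powr (- b) * (1 - norm z) powr (- \<beta>))"
  have b0: "0 \<le> b" using b by simp
  have wi: "integrable \<mu> w" unfolding w_def
    using b by (intro integrable_mult_left integrable_of_growth[where b = b and l = l and K = K and G = 1] tail)
      (auto intro!: continuous_measurable_mu continuous_intros)
  have int: "integrable \<mu> (\<lambda>t. of_real (test_profile b (A k) t) * of_real t * (1 - of_real t * z) powr of_real (- \<beta>))" for k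
    using integrable_mult_power[OF test_profile_integrable[OF A(1)[of k] A(2)[of k] b0], of 1] \<beta>
    by (intro integrable_kernel z) auto
  have bound: "norm (of_real (test_profile b (A k) t) * of_real t * (1 - of_real t * z) powr of_real (- \<beta>)) \<le>
      test_profile b (A k) t * (1 - norm z) powr (- \<beta>)" if t: "0 \<le> t" "t < 1" for k t
  proof -
    have tp: "0 \<le> test_profile b (A k) t" by (rule test_profile_le(1)[OF A(1,2) t b0])
    have "norm ((1 - of_real t * z) powr of_real (- \<beta>)) \<le> (1 - t * norm z) powr (- \<beta>)"
      using t z \<beta> by (intro norm_kernel_le) auto
    also have "\<dots> \<le> (1 - norm z) powr (- \<beta>)"
      using t z \<beta> mult_right_mono[of t 1 "norm z"] by (intro powr_mono2') auto
    finally have n: "norm ((1 - of_real t * z) powr of_real (- \<beta>)) \<le> (1 - norm z) powr (- \<beta>)" .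
    have "norm (of_real (test_profile b (A k) t) * of_real t :: complex) \<le> test_profile b (A k) t"
      using t tp by (simp add: norm_mult mult_left_le)
    then show ?thesis unfolding norm_mult[of _ "_ powr _"] using n tp by (intro mult_mono) auto
  qed
  have "(\<lambda>k. LINT t|\<mu>. of_real (test_profile b (A k) t) * of_real t * (1 - of_real t * z) powr of_real (- \<beta>))
     \<longlonglongrightarrow> (LINT t|\<mu>. 0)"
  proof (rule integral_dominated_convergence[where w = w])
    show "(\<lambda>t. of_real (test_profile b (A k) t) * of_real t * (1 - of_real t * z) powr of_real (- \<beta>)) \<in> borel_measurable \<mu>" for k
      using int by auto
    show "AE t in \<mu>. norm (of_real (test_profile b (A k) t) * of_real t * (1 - of_real t * z) powr of_real (- \<beta>)) \<le> w t" for k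
    proof (rule AE_I2)
      fix t assume "t \<in> space \<mu>"
      then have t: "0 \<le> t" "t < 1" by (auto simp: space_mu)
      show "norm (of_real (test_profile b (A k) t) * of_real t * (1 - of_real t * z) powr of_real (- \<beta>)) \<le> w t"
        unfolding w_def using test_profile_le(2)[OF A(1,2) t b0]
        by (intro order_trans[OF bound[OF t]] mult_right_mono) auto
    qed
    show "AE t in \<mu>. (\<lambda>k. of_real (test_profile b (A k) t) * of_real t * (1 - of_real t * z) powr of_real (- \<beta>)) \<longlonglongrightarrow> 0"
    proof (rule AE_I2)
      fix t assume "t \<in> space \<mu>"
      then have t: "0 \<le> t" "t < 1" by (auto simp: space_mu)
      have "(\<lambda>k. (1 - A k) powr b) \<longlonglongrightarrow> (1 - 1) powr b"
      proof (rule tendsto_powr2)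
        show "(\<lambda>k. 1 - A k) \<longlonglongrightarrow> 1 - 1" by (intro tendsto_intros A)
        show "\<forall>\<^sub>F k in sequentially. 0 \<le> 1 - A k" using A(2) by (simp add: less_imp_le)
      qed (use b in auto)
      then have lim: "(\<lambda>k. (1 - A k) powr b * ((1 - t) powr (- (2 * b)) * (1 - norm z) powr (- \<beta>))) \<longlonglongrightarrow> 0"
        using b by (auto intro: tendsto_mult_left_zero)
      have bnd: "norm (of_real (test_profile b (A k) t) * of_real t * (1 - of_real t * z) powr of_real (- \<beta>)) \<le>
          (1 - A k) powr b * ((1 - t) powr (- (2 * b)) * (1 - norm z) powr (- \<beta>))" for k
        unfolding mult.assoc[symmetric] using test_profile_le(3)[OF A(1,2) t b0]
        by (intro order_trans[OF bound[OF t, unfolded mult.assoc[symmetric]]] mult_right_mono) auto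
      show "(\<lambda>k. of_real (test_profile b (A k) t) * of_real t * (1 - of_real t * z) powr of_real (- \<beta>)) \<longlonglongrightarrow> 0"
        by (rule Lim_null_comparison[OF always_eventually[OF allI[OF bnd]] lim])
    qed
  qed (use wi in auto)
  then show ?thesis by (simp add: cauchy_op_def)
qed

text \<open>
The test functions are used twice: first to see that the quotients R a are bounded, which provides
the integrable majorant, and then to see that they tend to 0. In both steps a subsequence converges in the
Bloch norm, and the derivative of the limit at a is compared with the lower bound for R a.
\<close>

lemma compact_imp_vanishing_carleson:
  fixes T :: "(complex \<Rightarrow> complex) \<Rightarrow> complex \<Rightarrow> complex"
  assumes p: "0 < p" and l: "0 < l" and compact: "compact_bergman_bloch p D T"
    and T: "\<And>a z. 1 / 2 \<le> a \<Longrightarrow> a < 1 \<Longrightarrow> norm z < 1 \<Longrightarrow>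
       T (test_fun (2 / p) a) z = cauchy_op l (\<lambda>t. of_real (test_profile (2 / p) a t)) z"
  shows "vanishing_carleson (2 / p + l) \<mu>"
proof -
  define b where "b = 2 / p"
  have b: "0 < b" "0 \<le> b" using p by (auto simp: b_def)
  define R where "R = (\<lambda>a. measure \<mu> {a..<1} / (1 - a) powr (b + l))"
  define c where "c = l * 2 powr (- (2 * b + l + 2))"
  have c: "0 < c" using l by (simp add: c_def)
  define U where "U = (\<lambda>a. cauchy_op l (\<lambda>t. complex_of_real (test_profile b a t)))"
  have R0: "0 \<le> R a" for a by (simp add: R_def)
  have subseq_lim: "\<exists>r g. strict_mono (r :: nat \<Rightarrow> nat) \<and> g \<in> bloch \<and> (\<forall>k. U (A k) \<in> bloch) \<and>
      (\<lambda>k. bloch_norm (\<lambda>z. U (A (r k)) z - g z)) \<longlonglongrightarrow> 0"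
    if A: "\<And>k. 1 / 2 \<le> A k" "\<And>k. A k < 1" for A :: "nat \<Rightarrow> real"
  proof -
    have mem: "\<forall>k. test_fun b (A k) \<in> bergman p" 
      and nb: "\<exists>C. \<forall>k. bergman_norm p (test_fun b (A k)) \<le> C"
      using test_fun_bergman[OF p A] unfolding b_def by blast+
    obtain r g where rg: "strict_mono (r :: nat \<Rightarrow> nat)" "g \<in> bloch"
      "(\<lambda>k. bloch_norm (\<lambda>z. T (test_fun b (A (r k))) z - g z)) \<longlonglongrightarrow> 0"
      using compact mem nb unfolding compact_bergman_bloch_def by (meson)
    have TU: "T (test_fun b (A k)) z = U (A k) z" if "norm z < 1" for k z
      using T[OF A that] by (simp add: U_def b_def)
    have "T (test_fun b (A k)) \<in> bloch" for k
      using compact mem unfolding compact_bergman_bloch_def by blast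
    then have "U (A k) \<in> bloch" for k using bloch_cong(1)[of "T (test_fun b (A k))" "U (A k)"] TU by blast
    moreover have "bloch_norm (\<lambda>z. T (test_fun b (A (r k))) z - g z) = bloch_norm (\<lambda>z. U (A (r k)) z - g z)" for k
      using TU by (intro bloch_cong(2)) auto
    ultimately show ?thesis using rg by auto
  qed
  have lower: "c * R a \<le> (1 - a\<^sup>2) * norm (deriv (U a) (of_real a))" if "1 / 2 \<le> a" "a < 1" for a
    using test_deriv_lower_bound[OF that b(2) l] by (simp add: c_def R_def U_def)
  have lower2: "c * R a \<le> bloch_norm (\<lambda>z. U a z - g z) + (1 - a\<^sup>2) * norm (deriv g (of_real a))"
    if a: "1 / 2 \<le> a" "a < 1" and "U a \<in> bloch" "g \<in> bloch" for a g
  proof -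
    have "c * R a \<le> (1 - a\<^sup>2) * norm (deriv (U a) (of_real a))" by (rule lower[OF a])
    also have "\<dots> \<le> (1 - a\<^sup>2) * (norm (deriv (U a) (of_real a) - deriv g (of_real a)) + norm (deriv g (of_real a)))"
      using a by (intro mult_left_mono norm_triangle_sub[THEN order_trans])
        (auto simp: power_le_one add.commute)
    also have "\<dots> \<le> bloch_norm (\<lambda>z. U a z - g z) + (1 - a\<^sup>2) * norm (deriv g (of_real a))"
      using deriv_diff_bloch[OF that(3,4), of "of_real a"] a by (simp add: distrib_left)
    finally show ?thesis .
  qed
  \<comment> \<open>If R were unbounded, points with R (A k) > k would contradict the boundedness of a Bloch-convergent
    subsequence.\<close>
  have "\<exists>M. \<forall>a. 1 / 2 \<le> a \<longrightarrow> a < 1 \<longrightarrow> R a \<le> M"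
  proof (rule ccontr)
    assume "\<nexists>M. \<forall>a. 1 / 2 \<le> a \<longrightarrow> a < 1 \<longrightarrow> R a \<le> M"
    then have "\<forall>k::nat. \<exists>a. 1 / 2 \<le> a \<and> a < 1 \<and> real k < R a" by (meson not_le)
    then obtain A where A: "\<And>k::nat. 1 / 2 \<le> A k" "\<And>k. A k < 1" "\<And>k. real k < R (A k)" by metis
    obtain r g where rg: "strict_mono (r :: nat \<Rightarrow> nat)" "g \<in> bloch" "\<forall>k. U (A k) \<in> bloch"
      "(\<lambda>k. bloch_norm (\<lambda>z. U (A (r k)) z - g z)) \<longlonglongrightarrow> 0" using subseq_lim[of A, OF A(1,2)] by (elim exE conjE) (rule that)
    have "convergent (\<lambda>k. bloch_norm (\<lambda>z. U (A (r k)) z - g z))" using rg(4) by (auto simp: convergent_def)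
    from convergent_imp_Bseq[OF this] obtain B where "\<forall>k. \<bar>bloch_norm (\<lambda>z. U (A (r k)) z - g z)\<bar> \<le> B"
      by (auto simp: Bseq_def)
    then have B: "bloch_norm (\<lambda>z. U (A (r k)) z - g z) \<le> B" for k
      by (meson abs_le_D1)
    have "c * real k \<le> B + bloch_norm g" for k
    proof -
      have "real k \<le> R (A (r k))" using A(3)[of "r k"] seq_suble[OF rg(1), of k] by linarith
      then have "c * real k \<le> c * R (A (r k))" using c by simp
      also have "\<dots> \<le> bloch_norm (\<lambda>z. U (A (r k)) z - g z) + (1 - (A (r k))\<^sup>2) * norm (deriv g (of_real (A (r k))))"
        using rg by (intro lower2 A) auto
      also have "\<dots> \<le> B + bloch_norm g"
        using A(1,2)[of "r k"] deriv_le_bloch_norm[OF rg(2), of "of_real (A (r k))"] by (intro add_mono B) auto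
      finally show ?thesis .
    qed
    moreover obtain n :: nat where "(B + bloch_norm g) / c < n" using reals_Archimedean2 by blast
    then have "B + bloch_norm g < c * real n" using c by (simp add: field_simps)
    ultimately show False by (meson not_le)
  qed
  then obtain M where M: "\<And>a. 1 / 2 \<le> a \<Longrightarrow> a < 1 \<Longrightarrow> R a \<le> M" by blast
  define m where "m = measure \<mu> (space \<mu>)"
  \<comment> \<open>For t < 1/2 the factor (1 - t)^(b+l) is bounded below, so the total mass m serves as a bound.\<close>
  define K where "K = max M (m * 2 powr (b + l)) + 1"
  have K: "0 < K" by (simp add: K_def m_def add_nonneg_pos le_max_iff_disj)
  have tail: "measure \<mu> {t..<1} \<le> K * (1 - t) powr (b + l)" if t: "0 \<le> t" "t < 1" for t
  proof (cases "1 / 2 \<le> t")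
    case True
    have "R t \<le> K" using M[OF True t(2)] by (simp add: K_def)
    then show ?thesis using t by (simp add: R_def field_simps)
  next
    case False
    have "measure \<mu> {t..<1} \<le> m" unfolding m_def by (rule bounded_measure)
    also have "\<dots> = m * 2 powr (b + l) * (1 / 2) powr (b + l)" by (simp add: powr_divide)
    also have "\<dots> \<le> K * (1 - t) powr (b + l)"
      using False b l K by (intro mult_mono powr_mono2) (auto simp: K_def)
    finally show ?thesis .
  qed
  have car: "carleson (b + l) \<mu>"
    unfolding carleson_def using K tail by (auto simp: emeasure_eq_measure intro!: exI[of _ K] ennreal_leI)
  have "(R \<longlongrightarrow> 0) (at_left 1)"
  proof (rule ccontr)
    assume "\<not> (R \<longlongrightarrow> 0) (at_left 1)"
    then obtain e where e: "0 < e" "\<not> (\<forall>\<^sub>F a in at_left 1. dist (R a) 0 < e)" by (auto simp: tendsto_iff)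
    have "\<exists>a. max (1 / 2) (1 - 1 / real (Suc k)) < a \<and> a < 1 \<and> e \<le> R a" for k
    proof -
      have "\<exists>a>max (1 / 2) (1 - 1 / real (Suc k)). a < 1 \<and> \<not> dist (R a) 0 < e"
      proof -
        have lt: "max (1 / 2) (1 - 1 / real (Suc k)) < 1" by simp
        then show ?thesis using e(2) unfolding eventually_at_left[OF lt] by blast
      qed
      then show ?thesis using R0 by (auto simp: not_less)
    qed
    then obtain A where A: "\<And>k. max (1 / 2) (1 - 1 / real (Suc k)) < A k" "\<And>k. A k < 1" "\<And>k. e \<le> R (A k)" by metis
    have A1: "1 / 2 \<le> A k" "0 \<le> A k" for k using A(1)[of k] by auto
    have Alim: "A \<longlonglongrightarrow> 1"
    proof (rule tendsto_sandwich[OF _ _ _ tendsto_const])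
      show "(\<lambda>k. 1 - 1 / real (Suc k)) \<longlonglongrightarrow> 1"
        using tendsto_diff[OF tendsto_const[of 1] LIMSEQ_inverse_real_of_nat] by (simp add: inverse_eq_divide)
      show "\<forall>\<^sub>F k in sequentially. 1 - 1 / real (Suc k) \<le> A k" using A(1) by (simp add: less_imp_le)
      show "\<forall>\<^sub>F k in sequentially. A k \<le> 1" using A(2) by (simp add: less_imp_le)
    qed
    obtain r g where rg: "strict_mono (r :: nat \<Rightarrow> nat)" "g \<in> bloch" "\<forall>k. U (A k) \<in> bloch"
      "(\<lambda>k. bloch_norm (\<lambda>z. U (A (r k)) z - g z)) \<longlonglongrightarrow> 0" using subseq_lim[of A, OF A1(1) A(2)] by (elim exE conjE) (rule that)
    \<comment> \<open>The limit g has derivative 0: Bloch convergence implies pointwise convergence of the derivatives, and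
      these tend to 0.\<close>
    have gz: "deriv g z = 0" if z: "norm z < 1" for z
    proof -
      have "deriv (U (A (r k))) z = of_real l * cauchy_op (l + 1) (\<lambda>t. of_real (test_profile b (A (r k)) t) * of_real t) z" for k
        unfolding U_def by (intro deriv_cauchy_op test_profile_integrable A1 A b z l)
      moreover have "(\<lambda>k. cauchy_op (l + 1) (\<lambda>t. of_real (test_profile b (A (r k)) t) * of_real t) z) \<longlonglongrightarrow> 0"
        using A1 A Alim l K
        by (intro test_op_tendsto_zero[where K = K and l = l] LIMSEQ_subseq_LIMSEQ[OF Alim rg(1), unfolded o_def] b tail z) auto
      ultimately have 1: "(\<lambda>k. deriv (U (A (r k))) z) \<longlonglongrightarrow> 0"
        using tendsto_mult_right_zero by auto
      have pos: "0 < 1 - (norm z)\<^sup>2" using z by (simp add: abs_square_less_1)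
      have bnd: "norm (deriv (U (A (r k))) z - deriv g z) \<le> bloch_norm (\<lambda>z. U (A (r k)) z - g z) / (1 - (norm z)\<^sup>2)" for k
        using deriv_diff_bloch[OF _ rg(2) z, of "U (A (r k))"] rg(3) pos by (simp add: field_simps)
      have lim: "(\<lambda>k. bloch_norm (\<lambda>z. U (A (r k)) z - g z) / (1 - (norm z)\<^sup>2)) \<longlonglongrightarrow> 0"
        using tendsto_divide[OF rg(4) tendsto_const, of "1 - (norm z)\<^sup>2"] pos by simp
      have "(\<lambda>k. deriv (U (A (r k))) z - deriv g z) \<longlonglongrightarrow> 0"
        by (rule Lim_null_comparison[OF always_eventually[OF allI[OF bnd]] lim])
      then have "(\<lambda>k. deriv (U (A (r k))) z) \<longlonglongrightarrow> deriv g z" by (simp add: LIM_zero_iff)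
      then show ?thesis using 1 LIMSEQ_unique by blast
    qed
    have "c * e \<le> bloch_norm (\<lambda>z. U (A (r k)) z - g z)" for k
    proof -
      have "c * e \<le> c * R (A (r k))" using A(3)[of "r k"] c by simp
      also have "\<dots> \<le> bloch_norm (\<lambda>z. U (A (r k)) z - g z) + (1 - (A (r k))\<^sup>2) * norm (deriv g (of_real (A (r k))))"
        using rg by (intro lower2 A A1) auto
      also have "deriv g (of_real (A (r k))) = 0" using A1(2) A(2) by (intro gz) auto
      finally show ?thesis by simp
    qed
    then have "c * e \<le> 0" using LIMSEQ_le_const[OF rg(4)] by blast
    then show False using c e by (simp add: mult_le_0_iff)
  qed
  then show ?thesis using car by (simp add: vanishing_carleson_def R_def b_def)
qed

end


section \<open>Vanishing Carleson tails give compactness\<close>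

context unit_interval_measure
begin

lemma vanishing_carleson_tail:
  assumes "vanishing_carleson s \<mu>"
  obtains K where "0 < K" "\<And>t. 0 \<le> t \<Longrightarrow> t < 1 \<Longrightarrow> measure \<mu> {t..<1} \<le> K * (1 - t) powr s"
proof -
  obtain K where K: "0 < K" "\<And>t. t \<in> {0..<1} \<Longrightarrow> emeasure \<mu> {t..<1} \<le> ennreal (K * (1 - t) powr s)"
    using assms unfolding vanishing_carleson_def carleson_def by blast
  show thesis
  proof (rule that[OF K(1)])
    fix t :: real assume "0 \<le> t" "t < 1"
    then have "ennreal (measure \<mu> {t..<1}) \<le> ennreal (K * (1 - t) powr s)"
      using K(2)[of t] by (simp add: emeasure_eq_measure)
    then show "measure \<mu> {t..<1} \<le> K * (1 - t) powr s" using K(1) by (simp add: ennreal_le_iff)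
  qed
qed

lemma vanishing_carleson_small_tail:
  assumes "vanishing_carleson s \<mu>" "0 < \<epsilon>"
  obtains d where "0 \<le> d" "d < 1" "\<And>t. d \<le> t \<Longrightarrow> t < 1 \<Longrightarrow> measure \<mu> {t..<1} \<le> \<epsilon> * (1 - t) powr s"
proof -
  have "\<forall>\<^sub>F t in at_left 1. dist (measure \<mu> {t..<1} / (1 - t) powr s) 0 < \<epsilon>"
    using assms unfolding vanishing_carleson_def by (blast dest: tendstoD)
  then obtain b where b: "b < 1" "\<And>t. b < t \<Longrightarrow> t < 1 \<Longrightarrow> dist (measure \<mu> {t..<1} / (1 - t) powr s) 0 < \<epsilon>"
    unfolding eventually_at_left[OF zero_less_one] by blast
  show thesis
  proof (rule that[of "max 0 ((b + 1) / 2)"])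
    fix t :: real assume t: "max 0 ((b + 1) / 2) \<le> t" "t < 1"
    then have "b < t" using b(1) by (auto simp: field_simps)
    then have "measure \<mu> {t..<1} / (1 - t) powr s < \<epsilon>" using b(2)[of t] t by simp
    then show "measure \<mu> {t..<1} \<le> \<epsilon> * (1 - t) powr s" using t by (simp add: field_simps)
  qed (use b in auto)
qed

text \<open>
First \<kappa> is chosen for the tails, which determines d; then e is chosen for the data on [0,d), where the kernel is
bounded by D.
\<close>

lemma cauchy_op_null_sequence:
  fixes h :: "nat \<Rightarrow> real \<Rightarrow> complex"
  assumes b: "0 \<le> b" "0 < l" and van: "vanishing_carleson (b + l) \<mu>" and G: "0 < G"
    and int: "\<And>k. integrable \<mu> (h k)"
    and growth: "\<And>k t. 0 \<le> t \<Longrightarrow> t < 1 \<Longrightarrow> norm (h k t) \<le> G * (1 - t) powr (- b)"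
    and unif: "\<And>d e. 0 \<le> d \<Longrightarrow> d < 1 \<Longrightarrow> 0 < e \<Longrightarrow> \<forall>\<^sub>F k in sequentially. \<forall>t. 0 \<le> t \<and> t < d \<longrightarrow> norm (h k t) \<le> e"
  shows "(\<lambda>k. bloch_norm (cauchy_op l (h k))) \<longlonglongrightarrow> 0"
proof (rule LIMSEQ_I)
  fix \<epsilon> :: real assume eps: "0 < \<epsilon>"
  define m where "m = measure \<mu> (space \<mu>)"
  have m: "0 \<le> m" by (simp add: m_def)
  define cc where "cc = carleson_const b l"
  have cc: "0 < cc" using b by (simp add: cc_def carleson_const_def)
  define n where "n = 1 + 2 * l"
  have n: "0 < n" using b by (simp add: n_def)
  define \<kappa> where "\<kappa> = \<epsilon> / (4 * n * G * cc)"
  have kp: "0 < \<kappa>" using eps n G cc by (simp add: \<kappa>_def)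
  obtain d where d: "0 \<le> d" "d < 1" "\<And>t. d \<le> t \<Longrightarrow> t < 1 \<Longrightarrow> measure \<mu> {t..<1} \<le> \<kappa> * (1 - t) powr (b + l)"
    using vanishing_carleson_small_tail[OF van kp] by blast
  define D where "D = (1 - d) powr (- (l + 1))"
  have D: "0 < D" using d by (simp add: D_def)
  define e where "e = \<epsilon> / (4 * n * D * (m + 1))"
  have e: "0 < e" using eps n D m by (simp add: e_def)
  have "\<forall>\<^sub>F k in sequentially. bloch_norm (cauchy_op l (h k)) < \<epsilon>"
    using unif[OF d(1,2) e]
  proof eventually_elim
    case (elim k)
    have "bloch_norm (cauchy_op l (h k)) \<le> n * (e * D * m + G * cc * \<kappa>)"
      unfolding D_def m_def cc_def n_def
      using elim d kp e G growth int b by (intro cauchy_op_bloch(2)[where b = b]) auto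
    also have "\<dots> \<le> n * (e * D * (m + 1) + G * cc * \<kappa>)"
      using n e D by (intro mult_left_mono add_right_mono) auto
    also have "\<dots> = n * (e * D * (m + 1)) + n * (G * cc * \<kappa>)"
      by (simp add: distrib_left)
    also have "n * (e * D * (m + 1)) = \<epsilon> / 4"
      using n D m by (simp add: e_def)
    also have "n * (G * cc * \<kappa>) = \<epsilon> / 4"
      using n G cc by (simp add: \<kappa>_def)
    finally show ?case using eps by linarith
  qed
  moreover have "cauchy_op l (h k) \<in> bloch" for k
  proof -
    obtain d' where d': "0 \<le> d'" "d' < 1" "\<And>t. d' \<le> t \<Longrightarrow> t < 1 \<Longrightarrow> measure \<mu> {t..<1} \<le> 1 * (1 - t) powr (b + l)"
      using vanishing_carleson_small_tail[OF van zero_less_one] by blast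
    obtain K where K: "0 < K" "\<And>t. 0 \<le> t \<Longrightarrow> t < 1 \<Longrightarrow> measure \<mu> {t..<1} \<le> K * (1 - t) powr (b + l)"
      using vanishing_carleson_tail[OF van] by blast
    show ?thesis
      using b G K growth int by (intro cauchy_op_bloch(1)[where b = b and d = 0 and e = 0 and G = G and K = K]) auto
  qed
  then have "0 \<le> bloch_norm (cauchy_op l (h k))" for k by (rule bloch_norm_nonneg)
  ultimately show "\<exists>N. \<forall>k\<ge>N. norm (bloch_norm (cauchy_op l (h k)) - 0) < \<epsilon>"
    by (simp add: eventually_sequentially)
qed

end

text \<open>
The limit is described by the growth bound that it inherits from the sequence: this is the condition under which its
Cauchy transform is defined and lies in the Bloch space.
\<close>

lemma Montel_growth:
  fixes F :: "nat \<Rightarrow> complex \<Rightarrow> complex"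
  assumes b: "0 \<le> b" and G: "0 \<le> G" and hol: "\<And>k. F k holomorphic_on ball 0 1"
    and growth: "\<And>k z. norm z < 1 \<Longrightarrow> norm (F k z) \<le> G * (1 - norm z) powr (- b)"
  obtains g r where "g holomorphic_on ball 0 1" "strict_mono (r :: nat \<Rightarrow> nat)"
    "\<And>z. norm z < 1 \<Longrightarrow> norm (g z) \<le> G * (1 - norm z) powr (- b)"
    "\<And>d. d < 1 \<Longrightarrow> uniform_limit (cball 0 d) (\<lambda>k. F (r k)) g sequentially"
proof -
  define H where "H = {h. h holomorphic_on ball 0 1 \<and> (\<forall>z. norm z < 1 \<longrightarrow> norm (h z) \<le> G * (1 - norm z) powr (- b))}"
  obtain g r where gr: "g holomorphic_on ball 0 1" "strict_mono (r :: nat \<Rightarrow> nat)"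
    "\<And>x. x \<in> ball 0 1 \<Longrightarrow> (\<lambda>n. F (r n) x) \<longlonglongrightarrow> g x"
    "\<And>K. compact K \<Longrightarrow> K \<subseteq> ball 0 1 \<Longrightarrow> uniform_limit K (F \<circ> r) g sequentially"
  proof (rule Montel[of "ball 0 1" H F])
    fix K :: "complex set" assume K: "compact K" "K \<subseteq> ball 0 1"
    show "\<exists>B. \<forall>h\<in>H. \<forall>z\<in>K. norm (h z) \<le> B"
    proof (cases "K = {}")
      case False
      then obtain w where w: "w \<in> K" "\<And>z. z \<in> K \<Longrightarrow> norm z \<le> norm w"
        using continuous_attains_sup[OF K(1) False, of norm] continuous_on_norm_id by blast
      have "norm (h z) \<le> G * (1 - norm w) powr (- b)" if "h \<in> H" "z \<in> K" for h z
      proof -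
        have z: "norm z < 1" "norm w < 1" using K(2) that w by auto
        then have "norm (h z) \<le> G * (1 - norm z) powr (- b)" using that by (simp add: H_def)
        also have "\<dots> \<le> G * (1 - norm w) powr (- b)"
          using w(2)[OF that(2)] z b G by (intro mult_left_mono powr_mono2') auto
        finally show ?thesis .
      qed
      then show ?thesis by blast
    qed auto
  qed (use hol growth in \<open>auto simp: H_def\<close>)
  show thesis
  proof (rule that[OF gr(1,2)])
    show "norm (g z) \<le> G * (1 - norm z) powr (- b)" if "norm z < 1" for z
      using that growth by (intro LIMSEQ_le_const2[OF tendsto_norm[OF gr(3)]]) auto
    show "uniform_limit (cball 0 d) (\<lambda>k. F (r k)) g sequentially" if "d < 1" for d
      using gr(4)[of "cball 0 d"] that by (simp add: o_def subset_eq)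
  qed
qed

context unit_interval_measure
begin

text \<open>
P is the identity for the Hankel operator and the modulus for the sublinear operator. That P
does not increase distances replaces linearity: the difference of two images is the transform of a
function dominated by the difference of the two arguments.
\<close>

lemma vanishing_carleson_imp_compact:
  fixes T :: "(complex \<Rightarrow> complex) \<Rightarrow> complex \<Rightarrow> complex" and P :: "complex \<Rightarrow> complex"
  assumes p: "0 < p" and l: "0 < l" and van: "vanishing_carleson (2 / p + l) \<mu>"
    and P: "\<And>v w. norm (P v - P w) \<le> norm (v - w)" "P 0 = 0" "continuous_on UNIV P"
    and T: "\<And>f G. f holomorphic_on ball 0 1 \<Longrightarrow> 0 < G \<Longrightarrow>
        (\<And>z. norm z < 1 \<Longrightarrow> norm (f z) \<le> G * (1 - norm z) powr (- (2 / p))) \<Longrightarrow>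
        f \<in> D \<and> (\<forall>z. norm z < 1 \<longrightarrow> T f z = cauchy_op l (\<lambda>t. P (f (of_real t))) z)"
  shows "compact_bergman_bloch p D T"
proof -
  define b where "b = 2 / p"
  have b: "0 \<le> b" "0 < b" using p by (auto simp: b_def)
  have van': "vanishing_carleson (b + l) \<mu>" using van by (simp add: b_def)
  obtain K where K: "0 < K" "\<And>t. 0 \<le> t \<Longrightarrow> t < 1 \<Longrightarrow> measure \<mu> {t..<1} \<le> K * (1 - t) powr (b + l)"
    using vanishing_carleson_tail[OF van'] by blast
  obtain C where C: "0 < C" "\<And>f B z. f \<in> bergman p \<Longrightarrow> bergman_norm p f \<le> B \<Longrightarrow> 0 < B \<Longrightarrow> norm z < 1 \<Longrightarrow>
     norm (f z) \<le> C * B * (1 - norm z) powr (- 2 / p)"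
    using bergman_growth[OF p] by blast
  have normP: "norm (P v) \<le> norm v" for v using P(1)[of v 0] P(2) by simp
  have Pint: "integrable \<mu> (\<lambda>t. P (f (of_real t)))" and Pbloch: "cauchy_op l (\<lambda>t. P (f (of_real t))) \<in> bloch"
    if f: "f holomorphic_on ball 0 1" and G: "0 < G" and gr: "\<And>z. norm z < 1 \<Longrightarrow> norm (f z) \<le> G * (1 - norm z) powr (- b)"
    for f G
  proof -
    have gP: "norm (P (f (of_real t))) \<le> G * (1 - t) powr (- b)" if "0 \<le> t" "t < 1" for t
      using order_trans[OF normP gr[of "of_real t"]] that by simp
    have "continuous_on {0..<1} (\<lambda>t. f (complex_of_real t))"
      by (intro continuous_on_compose2[OF holomorphic_on_imp_continuous_on[OF f]] continuous_intros) auto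
    then have "continuous_on {0..<1} (\<lambda>t. P (f (complex_of_real t)))"
      by (rule continuous_on_compose2[OF P(3)]) auto
    then have meas: "(\<lambda>t. P (f (complex_of_real t))) \<in> borel_measurable \<mu>" by (rule continuous_measurable_mu)
    show int: "integrable \<mu> (\<lambda>t. P (f (of_real t)))"
      using K(1) by (intro integrable_of_growth[OF b(1) l _ meas K(2) gP]) auto
    show "cauchy_op l (\<lambda>t. P (f (of_real t))) \<in> bloch"
      using b l K G gP int by (intro cauchy_op_bloch(1)[where b = b and d = 0 and e = 0 and G = G and K = K]) auto
  qed
  have Tb: "f \<in> D" "T f \<in> bloch" "\<And>z. norm z < 1 \<Longrightarrow> T f z = cauchy_op l (\<lambda>t. P (f (of_real t))) z"
    if f: "f holomorphic_on ball 0 1" and G: "0 < G" and gr: "\<And>z. norm z < 1 \<Longrightarrow> norm (f z) \<le> G * (1 - norm z) powr (- b)"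
    for f G
  proof -
    note * = T[OF f G, folded b_def, OF gr]
    show "f \<in> D" using * by blast
    show eq: "T f z = cauchy_op l (\<lambda>t. P (f (of_real t))) z" if "norm z < 1" for z using * that by blast
    show "T f \<in> bloch" 
      using bloch_cong(1)[of "T f" "cauchy_op l (\<lambda>t. P (f (of_real t)))", OF eq] Pbloch[OF f G gr] by blast
  qed
  show ?thesis
    unfolding compact_bergman_bloch_def
  proof (intro conjI ballI allI impI; (elim conjE exE)?)
    fix f assume f: "f \<in> bergman p"
    define B where "B = max 1 (bergman_norm p f)"
    have B: "0 < B" "bergman_norm p f \<le> B" by (auto simp: B_def)
    have hol: "f holomorphic_on ball 0 1" using f by (simp add: bergman_def)
    have CB: "0 < C * B" using C B by simp
    have gr: "norm (f z) \<le> C * B * (1 - norm z) powr (- b)" if "norm z < 1" for z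
      using C(2)[OF f B(2,1) that] by (simp add: b_def)
    show "f \<in> D" by (rule Tb(1)[OF hol CB gr])
    show "T f \<in> bloch" by (rule Tb(2)[OF hol CB gr])
  next
    fix F :: "nat \<Rightarrow> complex \<Rightarrow> complex" and C0 :: real
    assume F: "\<forall>k. F k \<in> bergman p" and C0: "\<forall>k. bergman_norm p (F k) \<le> C0"
    define B where "B = max 1 C0"
    have B: "0 < B" "bergman_norm p (F k) \<le> B" for k using C0 by (auto simp: B_def le_max_iff_disj)
    define G where "G = C * B"
    have G: "0 < G" using C B by (simp add: G_def)
    have hol: "F k holomorphic_on ball 0 1" for k using F by (simp add: bergman_def)
    have gr: "norm (F k z) \<le> G * (1 - norm z) powr (- b)" if "norm z < 1" for z k
      using C(2)[OF F[rule_format] B(2,1) that] by (simp add: b_def G_def)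
    obtain g r where g: "g holomorphic_on ball 0 1" "strict_mono (r :: nat \<Rightarrow> nat)"
      "\<And>z. norm z < 1 \<Longrightarrow> norm (g z) \<le> G * (1 - norm z) powr (- b)"
      "\<And>d. d < 1 \<Longrightarrow> uniform_limit (cball 0 d) (\<lambda>k. F (r k)) g sequentially"
      by (rule Montel_growth[OF b(1) less_imp_le[OF G] hol gr]) (assumption, rule that)
    define h where "h = (\<lambda>k t. P (F (r k) (of_real t)) - P (g (of_real t)))"
    have intF: "integrable \<mu> (\<lambda>t. P (F (r k) (of_real t)))" for k by (rule Pint[OF hol G gr])
    have intg: "integrable \<mu> (\<lambda>t. P (g (of_real t)))" by (rule Pint[OF g(1) G g(3)])
    have "(\<lambda>k. bloch_norm (cauchy_op l (h k))) \<longlonglongrightarrow> 0"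
    proof (rule cauchy_op_null_sequence[OF b(1) l van'])
      show "0 < 2 * G" using G by simp
      show "integrable \<mu> (h k)" for k unfolding h_def by (rule Bochner_Integration.integrable_diff[OF intF intg])
      show "norm (h k t) \<le> 2 * G * (1 - t) powr (- b)" if "0 \<le> t" "t < 1" for k t
      proof -
        have "norm (h k t) \<le> norm (P (F (r k) (of_real t))) + norm (P (g (of_real t)))"
          unfolding h_def by (rule norm_triangle_ineq4)
        also have "\<dots> \<le> norm (F (r k) (of_real t)) + norm (g (of_real t))" by (intro add_mono normP)
        also have "\<dots> \<le> G * (1 - t) powr (- b) + G * (1 - t) powr (- b)"
          using gr[of "of_real t"] g(3)[of "of_real t"] that by (intro add_mono) auto
        finally show ?thesis by simp
      qed
      fix d e :: real assume de: "0 \<le> d" "d < 1" "0 < e"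
      have "\<forall>\<^sub>F k in sequentially. \<forall>z\<in>cball 0 d. dist (F (r k) z) (g z) < e"
        using g(4)[OF de(2)] de(3) by (rule uniform_limitD)
      then show "\<forall>\<^sub>F k in sequentially. \<forall>t. 0 \<le> t \<and> t < d \<longrightarrow> norm (h k t) \<le> e"
      proof eventually_elim
        case (elim k)
        show ?case
        proof (intro allI impI)
          fix t assume t: "0 \<le> t \<and> t < d"
          have "norm (h k t) \<le> norm (F (r k) (of_real t) - g (of_real t))" unfolding h_def by (rule P(1))
          also have "\<dots> \<le> e" using elim t by (auto simp: dist_norm intro: less_imp_le)
          finally show "norm (h k t) \<le> e" .
        qed
      qed
    qed
    moreover have "bloch_norm (\<lambda>z. T (F (r k)) z - cauchy_op l (\<lambda>t. P (g (of_real t))) z) = bloch_norm (cauchy_op l (h k))" for k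
    proof (rule bloch_cong(2))
      fix z :: complex assume z: "norm z < 1"
      show "T (F (r k)) z - cauchy_op l (\<lambda>t. P (g (of_real t))) z = cauchy_op l (h k) z"
      proof -
        have "T (F (r k)) z = cauchy_op l (\<lambda>t. P (F (r k) (of_real t))) z"
          by (rule Tb(3)[OF hol G gr z])
        then show ?thesis
          unfolding h_def using cauchy_op_diff[OF intF[of k] intg z less_imp_le[OF l]] by simp
      qed
    qed
    ultimately have "(\<lambda>k. bloch_norm (\<lambda>z. T (F (r k)) z - cauchy_op l (\<lambda>t. P (g (of_real t))) z)) \<longlonglongrightarrow> 0"
      by simp
    then show "\<exists>r g. strict_mono (r :: nat \<Rightarrow> nat) \<and> g \<in> bloch \<and>
           (\<lambda>k. bloch_norm (\<lambda>z. T (F (r k)) z - g z)) \<longlonglongrightarrow> 0"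
      using g(2) Pbloch[OF g(1) G g(3)] by blast
  qed
qed

end


section \<open>Equivalence of the three conditions\<close>

text \<open>
The Carleson bound at t = 0 bounds the total mass.
\<close>

lemma carleson_imp_finite_measure:
  assumes "borel_measure_unit \<mu>" "carleson s \<mu>"
  shows "unit_interval_measure \<mu>"
proof -
  have sets: "sets \<mu> = sets (restrict_space borel {0..<1})" using assms by (simp add: borel_measure_unit_def)
  have "space \<mu> = {0..<1}"
    using sets_eq_imp_space_eq[OF sets] by (simp add: space_restrict_space)
  moreover obtain M where "emeasure \<mu> {0..<1} \<le> ennreal (M * (1 - 0) powr s)"
    using assms(2) unfolding carleson_def by force
  ultimately have "emeasure \<mu> (space \<mu>) \<noteq> \<infinity>" by (auto simp: top_unique)
  then show ?thesis using sets by (intro unit_interval_measure.intro finite_measureI unit_interval_measure_axioms.intro) auto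
qed

theorem theorem4p4:
  fixes p \<alpha> :: real and \<mu> :: "real measure"
  assumes "0 < p" and "\<alpha> > -1"
    and "borel_measure_unit \<mu>"
    and "p \<le> 1 \<Longrightarrow> carleson (2 / p) \<mu>"
    and "1 \<le> p \<Longrightarrow> p \<le> 2 \<Longrightarrow> carleson ((2 - (p - 1)\<^sup>2) / p) \<mu>"
    and "2 < p \<Longrightarrow> carleson (1 / p) \<mu>"
  shows "(compact_bergman_bloch p (hankel_dom \<alpha> \<mu>) (hankel \<alpha> \<mu>) \<longleftrightarrow>
           compact_bergman_bloch p (int_op_dom \<alpha> \<mu>) (int_op \<alpha> \<mu>)) \<and>
         (compact_bergman_bloch p (int_op_dom \<alpha> \<mu>) (int_op \<alpha> \<mu>) \<longleftrightarrow>
           vanishing_carleson (2 / p + \<alpha> + 1) \<mu>)"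
proof -
  have "\<exists>s. carleson s \<mu>"
  proof (cases "p \<le> 1")
    case False
    then show ?thesis using assms(5,6) by (cases "p \<le> 2") auto
  qed (use assms(4) in blast)
  then interpret unit_interval_measure \<mu> using carleson_imp_finite_measure[OF assms(3)] by blast
  define b l where "b = 2 / p" and "l = \<alpha> + 1"
  have b: "0 < b" "0 \<le> b" and l: "0 < l" using assms by (auto simp: b_def l_def)
  have exponent: "2 / p + \<alpha> + 1 = 2 / p + l" by (simp add: l_def)
  have hol: "test_fun b a holomorphic_on ball 0 1" if "1 / 2 \<le> a" "a < 1" for a
    using that by (intro holomorphic_on_subset[OF test_fun_holomorphic ball_subset_test]) auto
  have Htest: "hankel \<alpha> \<mu> (test_fun b a) z = cauchy_op l (\<lambda>t. of_real (test_profile b a t)) z"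
    if a: "1 / 2 \<le> a" "a < 1" and z: "norm z < 1" for a z
  proof -
    obtain W where W: "\<And>N t. 0 \<le> t \<Longrightarrow> t < 1 \<Longrightarrow>
        norm (\<Sum>k<N. taylor_coeff (test_fun b a) k * of_real t ^ k) \<le> W"
      using test_fun_partial_sums[of a b] a by auto
    have "hankel \<alpha> \<mu> (test_fun b a) z = cauchy_op l (\<lambda>t. test_fun b a (of_real t)) z"
      unfolding l_def using W z by (intro hankel_eq_cauchy_op(3)[OF assms(2) hol[OF a], of "\<lambda>_. W"]) auto
    also have "\<dots> = cauchy_op l (\<lambda>t. of_real (test_profile b a t)) z"
      using a by (intro cauchy_op_cong test_fun_real) auto
    finally show ?thesis .
  qed
  have Itest: "int_op \<alpha> \<mu> (test_fun b a) z = cauchy_op l (\<lambda>t. of_real (test_profile b a t)) z"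
    if a: "1 / 2 \<le> a" "a < 1" for a z
  proof -
    have eq: "complex_of_real (norm (test_fun b a (of_real t))) = of_real (test_profile b a t)" if "0 \<le> t" "t < 1" for t
      using a that b test_profile_le(1)[of a t b] by (subst test_fun_real) auto
    have "integrable \<mu> (\<lambda>t. complex_of_real (test_profile b a t))"
      using a b by (intro test_profile_integrable) auto
    then have "integrable \<mu> (\<lambda>t. complex_of_real (norm (test_fun b a (of_real t))))"
      by (rule Bochner_Integration.integrable_cong[THEN iffD1, rotated 2]) (auto simp: eq space_mu)
    then have "int_op \<alpha> \<mu> (test_fun b a) z = cauchy_op l (\<lambda>t. of_real (norm (test_fun b a (of_real t)))) z"
      unfolding l_def using assms(2) by (rule int_op_eq_cauchy_op(2))
    also have "\<dots> = cauchy_op l (\<lambda>t. of_real (test_profile b a t)) z"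
      by (rule cauchy_op_cong[OF eq])
    finally show ?thesis .
  qed
  have H: "f \<in> hankel_dom \<alpha> \<mu> \<and> (\<forall>z. norm z < 1 \<longrightarrow> hankel \<alpha> \<mu> f z = cauchy_op l (\<lambda>t. f (of_real t)) z)"
    and I: "f \<in> int_op_dom \<alpha> \<mu> \<and> (\<forall>z. norm z < 1 \<longrightarrow> int_op \<alpha> \<mu> f z = cauchy_op l (\<lambda>t. of_real (norm (f (of_real t)))) z)"
    if van: "vanishing_carleson (b + l) \<mu>" and f: "f holomorphic_on ball 0 1" and G: "0 < G"
      and gr: "\<And>z. norm z < 1 \<Longrightarrow> norm (f z) \<le> G * (1 - norm z) powr (- b)" for f G
  proof -
    obtain K where K: "0 < K" "\<And>t. 0 \<le> t \<Longrightarrow> t < 1 \<Longrightarrow> measure \<mu> {t..<1} \<le> K * (1 - t) powr (b + l)"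
      using vanishing_carleson_tail[OF van] by blast
    \<comment> \<open>The loss e in the bound for the Taylor sections has to stay below the gap l between the growth exponent b
      and the Carleson exponent b + l.\<close>
    define e where "e = min (1 / 2) (l / 2)"
    have e: "0 < e" "e < 1" "0 < l - e" using l by (auto simp: e_def min_def)
    define W where "W = (\<lambda>t. 8 * G / e * ((1 - t) / 2) powr (- (b + e)))"
    have "continuous_on {0..<1} W" unfolding W_def by (intro continuous_intros) auto
    then have Wm: "W \<in> borel_measurable \<mu>" by (rule continuous_measurable_mu)
    have Wi: "integrable \<mu> W"
    proof (rule integrable_of_growth[OF _ e(3) _ Wm])
      show "measure \<mu> {t..<1} \<le> K * (1 - t) powr (b + e + (l - e))" if "0 \<le> t" "t < 1" for t
        using K(2)[OF that] by simp
      show "norm (W t) \<le> (8 * G / e * 2 powr (b + e)) * (1 - t) powr (- (b + e))" if "0 \<le> t" "t < 1" for t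
        using that G e by (simp add: W_def powr_divide powr_minus_divide[of 2] mult_ac del: minus_add_distrib)
    qed (use b e K in auto)
    have le: "norm (\<Sum>k<N. taylor_coeff f k * of_real t ^ k) \<le> W t" if "0 \<le> t" "t < 1" for N t
      unfolding W_def by (rule partial_sum_growth[OF f b(2) e(1,2) less_imp_le[OF G] gr that])
    note H = hankel_eq_cauchy_op[OF assms(2) f Wi le]
    show "f \<in> hankel_dom \<alpha> \<mu> \<and> (\<forall>z. norm z < 1 \<longrightarrow> hankel \<alpha> \<mu> f z = cauchy_op l (\<lambda>t. f (of_real t)) z)"
      using H(1,3) by (simp add: l_def)
    have ni: "integrable \<mu> (\<lambda>t. complex_of_real (norm (f (of_real t))))"
      using H(2) by (intro integrable_of_real integrable_norm)
    show "f \<in> int_op_dom \<alpha> \<mu> \<and> (\<forall>z. norm z < 1 \<longrightarrow> int_op \<alpha> \<mu> f z = cauchy_op l (\<lambda>t. of_real (norm (f (of_real t)))) z)"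
      using int_op_eq_cauchy_op[OF ni assms(2)] by (simp add: l_def)
  qed
  have a_c: "vanishing_carleson (2 / p + l) \<mu>" if "compact_bergman_bloch p (hankel_dom \<alpha> \<mu>) (hankel \<alpha> \<mu>)"
    by (rule compact_imp_vanishing_carleson[OF assms(1) l that Htest[unfolded b_def]])
  have b_c: "vanishing_carleson (2 / p + l) \<mu>" if "compact_bergman_bloch p (int_op_dom \<alpha> \<mu>) (int_op \<alpha> \<mu>)"
    by (rule compact_imp_vanishing_carleson[OF assms(1) l that Itest[unfolded b_def]])
  have c_a: "compact_bergman_bloch p (hankel_dom \<alpha> \<mu>) (hankel \<alpha> \<mu>)" if van: "vanishing_carleson (2 / p + l) \<mu>"
    by (rule vanishing_carleson_imp_compact[OF assms(1) l van, of "\<lambda>w. w"])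
       (simp, simp, rule continuous_on_id, rule H[OF van[folded b_def]], assumption+, simp add: b_def)
  have c_b: "compact_bergman_bloch p (int_op_dom \<alpha> \<mu>) (int_op \<alpha> \<mu>)" if van: "vanishing_carleson (2 / p + l) \<mu>"
  proof (rule vanishing_carleson_imp_compact[OF assms(1) l van, of "\<lambda>w. of_real (norm w)"])
    show "norm (complex_of_real (norm v) - of_real (norm w)) \<le> norm (v - w)" for v w :: complex
      by (simp add: norm_triangle_ineq3 flip: of_real_diff)
    show "continuous_on UNIV (\<lambda>w::complex. complex_of_real (norm w))" by (intro continuous_intros)
    show "complex_of_real (norm (0::complex)) = 0" by simp
  qed (rule I[OF van[folded b_def]], assumption+, simp add: b_def)
  show ?thesis
    unfolding exponent by (intro conjI iffI) (erule c_b[OF a_c] c_a[OF b_c] b_c c_b)+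
qed

end
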